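(* Let $M$ be a smooth Banach manifold, let $X\in\mathfrak{X}(TM)$, and set $X^{c_0}=X$, $X^{c_1}:=X^c=D\kappa_2\circ\kappa_3\circ DX\circ\kappa_2$ and $X^{c_j}:=(X^{c_{j-1}})^c$ for $j\in\mathbb{N}$. Then: (i) $D^2\pi_0\circ X^{c_1}=X\circ D\pi_0$. (ii) For any $i\in\mathbb{N}$, $D^2\pi_i\circ X^{c_{i+1}}=X^{c_i}\circ D\pi_i$. (iii) For any $i,j\in\mathbb{N}$ with $j\ge i$, $D^2\pi_{j,i}\circ X^{c_j}=X^{c_i}\circ D\pi_{j,i}$, where $\pi_{j,i}:=\pi_i\circ\pi_{i+1}\circ\cdots\circ\pi_{j-1}:T^jM\to T^iM$ (and $\pi_{i,i}=\mathrm{id}$).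
   Context: All maps and manifolds are smooth; $M$ is a Banach manifold admitting smooth partitions of unity ("partitionable"). $T^0M=M$, $T^rM=T(T^{r-1}M)$, and $\pi_r:T^{r+1}M\to T^rM$ is the tangent bundle projection. $D$ denotes the tangent map, $D^2=DD$. $\mathfrak{X}(N)$ is the set of vector fields (smooth sections of $TN\to N$). Canonical involution: $\kappa_1=\mathrm{id}_{TM}$, and for $r\ge 2$, $\kappa_r:T^rM\to T^rM$ is the diffeomorphism with $\partial_t\partial_s\gamma(t,s)=\kappa_r\partial_s\partial_t\gamma(t,s)$ for every smooth $\gamma:(-\epsilon,\epsilon)^2\to T^{r-2}M$; in the charts of $T^rM$ induced by charts of $M$, $\kappa_r(x,y,X,Y)=(x,X,y,Y)$. Complete lift: for a vector field $\mathbf{A}:T^rM\to T^{r+1}M$ ($r\ge0$), $\mathbf{A}^c=D\kappa_{r+1}\circ\kappa_{r+2}\circ D\mathbf{A}\circ\kappa_{r+1}:T^{r+1}M\to T^{r+2}M$, a vector field on $T^{r+1}M$. Thus $X^{c_j}:T(T^jM)\to T^2(T^jM)$. *)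

theory Defs
  imports "HOL-Analysis.Analysis"
begin

section \<open>Smooth maps between Banach spaces\<close>

text \<open>
  \<open>F\<close> is a linear subspace of the ambient normed space and \<open>U\<close> a relatively open subset of \<open>F\<close>.
  The map \<open>f\<close> is \<open>C\<^sup>\<infinity>\<close> in the sense of Frechet: \<open>D n x\<close> is the \<open>n\<close>-th derivative of \<open>f\<close>
  at \<open>x\<close>, viewed as a bounded \<open>n\<close>-linear map on \<open>F\<close> (its arguments are collected in a list),
  and \<open>D (Suc n) x\<close> is the Frechet derivative of \<open>D n\<close> at \<open>x\<close> with respect to the operator norm
  on \<open>n\<close>-linear maps, under the usual identification \<open>L(F, L\<^sup>n(F; G)) = L\<^sup>n\<^sup>+\<^sup>1(F; G)\<close>.
  A single family \<open>D\<close> is used because the spaces of \<open>n\<close>-linear maps have different types for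
  different \<open>n\<close>.
\<close>

definition bounded_multilinear_on ::
    "'a::real_normed_vector set \<Rightarrow> nat \<Rightarrow> ('a list \<Rightarrow> 'b::real_normed_vector) \<Rightarrow> bool" where
  "bounded_multilinear_on F n B \<longleftrightarrow>
     (\<forall>vs. length vs = n \<longrightarrow> set vs \<subseteq> F \<longrightarrow>
        (\<forall>k<n. \<forall>a\<in>F. \<forall>b\<in>F. \<forall>c.
           B (vs[k := a + c *\<^sub>R b]) = B (vs[k := a]) + c *\<^sub>R B (vs[k := b]))) \<and>
     (\<exists>K. \<forall>vs. length vs = n \<longrightarrow> set vs \<subseteq> F \<longrightarrow> norm (B vs) \<le> K * prod_list (map norm vs))"

definition smooth_within ::
    "'a::real_normed_vector set \<Rightarrow> 'a set \<Rightarrow> ('a \<Rightarrow> 'b::real_normed_vector) \<Rightarrow> bool" where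
  "smooth_within F U f \<longleftrightarrow>
     (\<exists>D :: nat \<Rightarrow> 'a \<Rightarrow> 'a list \<Rightarrow> 'b.
        (\<forall>x\<in>U. D 0 x [] = f x) \<and>
        (\<forall>n. \<forall>x\<in>U. bounded_multilinear_on F n (D n x)) \<and>
        (\<forall>n. \<forall>x\<in>U. \<forall>e>0. \<forall>\<^sub>F y in at x within U.
           \<forall>vs. length vs = n \<longrightarrow> set vs \<subseteq> F \<longrightarrow>
             norm (D n y vs - D n x vs - D (Suc n) x ((y - x) # vs))
               \<le> e * norm (y - x) * prod_list (map norm vs)))"

lemma fderiv_tower:
  fixes D :: "nat \<Rightarrow> 'a::real_normed_vector \<Rightarrow> 'a list \<Rightarrow> 'b::real_normed_vector"
  assumes U: "open U" and x: "x \<in> U"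
    and ml: "\<forall>n. \<forall>x\<in>U. bounded_multilinear_on UNIV n (D n x)"
    and der: "\<forall>n. \<forall>x\<in>U. \<forall>e>0. \<forall>\<^sub>F y in at x within U.
           \<forall>vs. length vs = n \<longrightarrow> set vs \<subseteq> UNIV \<longrightarrow>
             norm (D n y vs - D n x vs - D (Suc n) x ((y - x) # vs))
               \<le> e * norm (y - x) * prod_list (map norm vs)"
    and vs: "length vs = n"
  shows "((\<lambda>y. D n y vs) has_derivative (\<lambda>h. D (Suc n) x (h # vs))) (at x)"
proof -
  have add: "D (Suc n) x ((a + c *\<^sub>R b) # vs) = D (Suc n) x (a # vs) + c *\<^sub>R D (Suc n) x (b # vs)"
    for a b c
    using ml[rule_format, OF x, of "Suc n", unfolded bounded_multilinear_on_def, THEN conjunct1,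
        rule_format, of "0 # vs" 0 a b c] vs by simp
  have zero: "D (Suc n) x (0 # vs) = 0" using add[of 0 1 0] by simp
  have pl: "prod_list (map norm vs) \<ge> 0" by (induction vs) auto
  obtain K where K: "\<forall>vs. length vs = Suc n \<longrightarrow> norm (D (Suc n) x vs) \<le> K * prod_list (map norm vs)"
    using ml[rule_format, OF x, of "Suc n"] by (auto simp: bounded_multilinear_on_def)
  have "bounded_linear (\<lambda>h. D (Suc n) x (h # vs))"
  proof (rule bounded_linear_intro[where K = "K * prod_list (map norm vs)"])
    show "D (Suc n) x ((a + b) # vs) = D (Suc n) x (a # vs) + D (Suc n) x (b # vs)" for a b
      using add[of a 1 b] by simp
    show "D (Suc n) x (r *\<^sub>R a # vs) = r *\<^sub>R D (Suc n) x (a # vs)" for r a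
      using add[of 0 r a] zero by simp
    show "norm (D (Suc n) x (a # vs)) \<le> norm a * (K * prod_list (map norm vs))" for a
      using K[rule_format, of "a # vs"] vs by (simp add: algebra_simps)
  qed
  moreover have "\<exists>d>0. \<forall>y. norm (y - x) < d \<longrightarrow>
      norm (D n y vs - D n x vs - D (Suc n) x ((y - x) # vs)) \<le> e * norm (y - x)" if e: "e > 0" for e
  proof -
    define e' where "e' = e / (prod_list (map norm vs) + 1)"
    have e': "e' > 0" using e pl by (simp add: e'_def add_nonneg_pos)
    have le: "e' * prod_list (map norm vs) \<le> e"
      using e pl by (simp add: e'_def field_simps add_nonneg_pos)
    have "\<forall>\<^sub>F y in at x. norm (D n y vs - D n x vs - D (Suc n) x ((y - x) # vs))
        \<le> e' * norm (y - x) * prod_list (map norm vs)"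
      using der[rule_format, OF x e', of n] vs unfolding at_within_open[OF x U]
      by (auto elim: eventually_mono)
    then obtain d where d: "d > 0" "\<And>y. y \<noteq> x \<Longrightarrow> dist y x < d \<Longrightarrow>
        norm (D n y vs - D n x vs - D (Suc n) x ((y - x) # vs)) \<le> e' * norm (y - x) * prod_list (map norm vs)"
      unfolding eventually_at by auto
    have "norm (D n y vs - D n x vs - D (Suc n) x ((y - x) # vs)) \<le> e * norm (y - x)"
      if "norm (y - x) < d" for y
    proof (cases "y = x")
      case False
      then have "norm (D n y vs - D n x vs - D (Suc n) x ((y - x) # vs))
          \<le> e' * norm (y - x) * prod_list (map norm vs)"
        using d(2) that by (simp add: dist_norm)
      also have "\<dots> = e' * prod_list (map norm vs) * norm (y - x)" by simp
      also have "\<dots> \<le> e * norm (y - x)" by (intro mult_right_mono le) auto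
      finally show ?thesis .
    qed (simp add: zero)
    with d(1) show ?thesis by blast
  qed
  ultimately show ?thesis unfolding has_derivative_at_alt by blast
qed

lemma symmetric_second_derivative:
  fixes D :: "nat \<Rightarrow> 'a::real_normed_vector \<Rightarrow> 'a list \<Rightarrow> 'b::real_normed_vector"
  assumes U: "open U" and x: "x \<in> U"
    and ml: "\<forall>n. \<forall>x\<in>U. bounded_multilinear_on UNIV n (D n x)"
    and der: "\<forall>n. \<forall>x\<in>U. \<forall>e>0. \<forall>\<^sub>F y in at x within U.
           \<forall>vs. length vs = n \<longrightarrow> set vs \<subseteq> UNIV \<longrightarrow>
             norm (D n y vs - D n x vs - D (Suc n) x ((y - x) # vs))
               \<le> e * norm (y - x) * prod_list (map norm vs)"
  shows "D 2 x [u, w] = D 2 x [w, u]"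
proof -
  have add1: "D 1 y [a + c *\<^sub>R b] = D 1 y [a] + c *\<^sub>R D 1 y [b]" if "y \<in> U" for y a b c
    using ml[rule_format, OF that, of 1, unfolded bounded_multilinear_on_def, THEN conjunct1,
        rule_format, of "[0]" 0 a b c] by simp
  have add2: "D 2 x [a + c *\<^sub>R b, v] = D 2 x [a, v] + c *\<^sub>R D 2 x [b, v]" for a b c v
    using ml[rule_format, OF x, of 2, unfolded bounded_multilinear_on_def, THEN conjunct1,
        rule_format, of "[0, v]" 0 a b c] by simp
  have sc1: "D 1 y [c *\<^sub>R b] = c *\<^sub>R D 1 y [b]" if "y \<in> U" for y b c
    using add1[OF that, of 0 c b] add1[OF that, of 0 1 0] by simp
  have zero2: "D 2 x [0, v] = 0" for v using add2[of 0 1 0 v] by simp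
  have sc2: "D 2 x [c *\<^sub>R b, v] = c *\<^sub>R D 2 x [b, v]" for c b v
    using add2[of 0 c b v] zero2 by simp
  have at: "at y within U = at y" if "y \<in> U" for y using at_within_open[OF that U] .
  have d1: "((\<lambda>y. D 0 y []) has_derivative (\<lambda>h. D 1 y [h])) (at y)" if y: "y \<in> U" for y
    using fderiv_tower[OF U y ml der, of "[]" 0] by simp
  define \<Delta> where "\<Delta> u w r =
      D 0 (x + r *\<^sub>R u + r *\<^sub>R w) [] - D 0 (x + r *\<^sub>R u) [] - D 0 (x + r *\<^sub>R w) [] + D 0 x []"
    for u w and r :: real
  have key: "\<exists>d>0. \<forall>r. 0 < r \<and> r < d \<longrightarrow> norm (\<Delta> u w r - r\<^sup>2 *\<^sub>R D 2 x [w, u]) \<le> e * r\<^sup>2"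
    if e: "e > 0" for e :: real and u w
  proof -
    define C where "C = (2 * norm u + norm w) * norm u + 1"
    have C: "C > 0" by (simp add: C_def add_nonneg_pos)
    define e' where "e' = e / C"
    have e': "e' > 0" using e C by (simp add: e'_def)
    obtain d1 where d1': "d1 > 0" and ball: "ball x d1 \<subseteq> U"
      using U x by (metis openE)
    from der[rule_format, OF x e', of 1]
    have "\<exists>d>0. \<forall>z\<in>UNIV. z \<noteq> x \<and> dist z x < d \<longrightarrow> (\<forall>vs. length vs = 1 \<longrightarrow> set vs \<subseteq> UNIV \<longrightarrow>
        norm (D 1 z vs - D 1 x vs - D (Suc 1) x ((z - x) # vs)) \<le> e' * norm (z - x) * prod_list (map norm vs))"
      unfolding at[OF x] eventually_at .
    then obtain d2 where d2: "d2 > 0" and D2: "\<And>z vs. z \<noteq> x \<Longrightarrow> dist z x < d2 \<Longrightarrow> length vs = 1 \<Longrightarrow>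
        norm (D 1 z vs - D 1 x vs - D (Suc 1) x ((z - x) # vs)) \<le> e' * norm (z - x) * prod_list (map norm vs)"
      by blast
    have D2': "norm (D 1 z [v] - D 1 x [v] - D 2 x [z - x, v]) \<le> e' * norm (z - x) * norm v"
      if "dist z x < d2" for z v
      using D2[of z "[v]"] that by (cases "z = x") (auto simp: zero2 numeral_2_eq_2[symmetric])
    define d where "d = min d1 d2 / (norm u + norm w + 1)"
    have dpos: "d > 0" using d1' d2 by (simp add: d_def add_nonneg_pos)
    have "norm (\<Delta> u w r - r\<^sup>2 *\<^sub>R D 2 x [w, u]) \<le> e * r\<^sup>2" if r: "0 < r" "r < d" for r
    proof -
      have small: "norm (q *\<^sub>R (r *\<^sub>R u) + p *\<^sub>R (r *\<^sub>R w)) < min d1 d2"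
        if "0 \<le> q" "q \<le> 1" "0 \<le> p" "p \<le> 1" for q p
      proof -
        have "norm (q *\<^sub>R (r *\<^sub>R u) + p *\<^sub>R (r *\<^sub>R w)) \<le> q * (r * norm u) + p * (r * norm w)"
          using that r by (intro norm_triangle_le) simp
        also have "\<dots> \<le> 1 * (r * norm u) + 1 * (r * norm w)"
          using that r by (intro add_mono mult_right_mono) auto
        also have "\<dots> = r * (norm u + norm w)" by (simp add: algebra_simps)
        also have "\<dots> < r * (norm u + norm w + 1)" using r by simp
        also have "\<dots> \<le> d * (norm u + norm w + 1)" using r by (intro mult_right_mono) auto
        also have "\<dots> = min d1 d2" unfolding d_def
          by (smt (verit) norm_ge_zero nonzero_eq_divide_eq)
        finally show ?thesis .
      qed
      let ?a = "\<lambda>q. x + q *\<^sub>R (r *\<^sub>R u) + r *\<^sub>R w" and ?b = "\<lambda>q. x + q *\<^sub>R (r *\<^sub>R u)"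
      have na: "?a q \<in> U" "dist (?a q) x < d2" and nb: "?b q \<in> U" "dist (?b q) x < d2"
        if "0 \<le> q" "q \<le> 1" for q
        using small[of q 1] small[of q 0] that ball
        by (auto simp: dist_norm add.assoc subset_iff norm_minus_commute)
      define \<psi> where "\<psi> q = D 0 (?a q) [] - D 0 (?b q) [] - q *\<^sub>R (r\<^sup>2 *\<^sub>R D 2 x [w, u])" for q
      define \<psi>' where "\<psi>' q = D 1 (?a q) [r *\<^sub>R u] - D 1 (?b q) [r *\<^sub>R u] - r\<^sup>2 *\<^sub>R D 2 x [w, u]" for q
      have der\<psi>: "(\<psi> has_derivative (\<lambda>h. h *\<^sub>R \<psi>' q)) (at q within {0..1})"
        if q: "q \<in> {0..1}" for q
      proof -
        have 1: "((\<lambda>q. D 0 (?a q) []) has_derivative (\<lambda>h. D 1 (?a q) [h *\<^sub>R (r *\<^sub>R u)])) (at q within {0..1})"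
          by (rule has_derivative_compose[OF _ d1]) (use q na in \<open>auto intro!: derivative_eq_intros\<close>)
        have 2: "((\<lambda>q. D 0 (?b q) []) has_derivative (\<lambda>h. D 1 (?b q) [h *\<^sub>R (r *\<^sub>R u)])) (at q within {0..1})"
          by (rule has_derivative_compose[OF _ d1]) (use q nb in \<open>auto intro!: derivative_eq_intros\<close>)
        have 3: "((\<lambda>q. q *\<^sub>R (r\<^sup>2 *\<^sub>R D 2 x [w, u])) has_derivative (\<lambda>h. h *\<^sub>R (r\<^sup>2 *\<^sub>R D 2 x [w, u]))) (at q within {0..1})"
          by (auto intro!: derivative_eq_intros)
        have "D 1 (?a q) [h *\<^sub>R (r *\<^sub>R u)] - D 1 (?b q) [h *\<^sub>R (r *\<^sub>R u)] - h *\<^sub>R (r\<^sup>2 *\<^sub>R D 2 x [w, u])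
            = h *\<^sub>R \<psi>' q" for h
          using q na nb by (simp only: sc1 \<psi>'_def scaleR_diff_right atLeastAtMost_iff)
        with has_derivative_diff[OF has_derivative_diff[OF 1 2] 3] show ?thesis
          by (simp add: \<psi>_def[abs_def])
      qed
      have bound: "norm (\<psi>' q) \<le> e * r\<^sup>2" if q: "0 \<le> q" "q \<le> 1" for q
      proof -
        let ?u = "r *\<^sub>R u"
        have split: "D 2 x [?a q - x, ?u] - D 2 x [?b q - x, ?u] = r *\<^sub>R D 2 x [w, ?u]"
          using add2[of "q *\<^sub>R ?u" r w ?u] by simp
        have lin2: "D 2 x [w, ?u] = r *\<^sub>R D 2 x [w, u]"
        proof -
          have add3: "D 2 x [v, a + c *\<^sub>R b] = D 2 x [v, a] + c *\<^sub>R D 2 x [v, b]" for a b c v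
            using ml[rule_format, OF x, of 2, unfolded bounded_multilinear_on_def, THEN conjunct1,
                rule_format, of "[v, 0]" 1 a b c] by simp
          show ?thesis using add3[of w 0 r u] add3[of w 0 1 0] by simp
        qed
        have "\<psi>' q = (D 1 (?a q) [?u] - D 1 x [?u] - D 2 x [?a q - x, ?u])
            - (D 1 (?b q) [?u] - D 1 x [?u] - D 2 x [?b q - x, ?u])"
          using split unfolding \<psi>'_def lin2 by (simp add: power2_eq_square algebra_simps)
        then have "norm (\<psi>' q) \<le> norm (D 1 (?a q) [?u] - D 1 x [?u] - D 2 x [?a q - x, ?u])
            + norm (D 1 (?b q) [?u] - D 1 x [?u] - D 2 x [?b q - x, ?u])"
          by (simp only: norm_triangle_ineq4)
        also have "\<dots> \<le> e' * norm (?a q - x) * norm ?u + e' * norm (?b q - x) * norm ?u"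
          by (rule add_mono[OF D2'[OF na(2)[OF q]] D2'[OF nb(2)[OF q]]])
        also have "\<dots> = e' * norm ?u * (norm (?a q - x) + norm (?b q - x))"
          by (simp only: algebra_simps)
        also have "\<dots> \<le> e' * norm ?u * (r * norm u + r * norm w + r * norm u)"
        proof (intro mult_left_mono add_mono)
          have qr: "q * (r * norm u) \<le> r * norm u"
            using q r by (intro mult_left_le_one_le) auto
          show "norm (?b q - x) \<le> r * norm u" using qr q r by simp
          have "norm (?a q - x) \<le> q * (r * norm u) + r * norm w"
            using norm_triangle_ineq[of "q *\<^sub>R ?u" "r *\<^sub>R w"] q r by (simp add: add.assoc)
          then show "norm (?a q - x) \<le> r * norm u + r * norm w" using qr by linarith
        qed (use e' in auto)
        also have "\<dots> = e' * r\<^sup>2 * (C - 1)"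
          using r by (simp add: C_def power2_eq_square algebra_simps)
        also have "\<dots> \<le> e' * r\<^sup>2 * C" using e' by (intro mult_left_mono) auto
        also have "\<dots> = e * r\<^sup>2" using C by (simp add: e'_def)
        finally show ?thesis .
      qed
      have "norm (\<psi> 1 - \<psi> 0) \<le> e * r\<^sup>2 * norm (1 - 0 :: real)"
      proof (rule differentiable_bound[of "{0..1}" \<psi> "\<lambda>q h. h *\<^sub>R \<psi>' q"])
        show "onorm (\<lambda>h. h *\<^sub>R \<psi>' q) \<le> e * r\<^sup>2" if "q \<in> {0..1}" for q
          using bound[of q] that by (intro onorm_le) (simp add: mult.commute mult_left_mono)
      qed (use der\<psi> in auto)
      then show ?thesis by (simp add: \<psi>_def \<Delta>_def algebra_simps)
    qed
    with dpos show ?thesis by blast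
  qed
  have "norm (D 2 x [u, w] - D 2 x [w, u]) \<le> e" if "e > 0" for e
  proof -
    obtain a b where a: "a > 0" "\<And>r. 0 < r \<Longrightarrow> r < a \<Longrightarrow> norm (\<Delta> u w r - r\<^sup>2 *\<^sub>R D 2 x [w, u]) \<le> e / 2 * r\<^sup>2"
      and b: "b > 0" "\<And>r. 0 < r \<Longrightarrow> r < b \<Longrightarrow> norm (\<Delta> w u r - r\<^sup>2 *\<^sub>R D 2 x [u, w]) \<le> e / 2 * r\<^sup>2"
      using key[of "e / 2" u w] key[of "e / 2" w u] \<open>e > 0\<close> by (metis half_gt_zero)
    define r where "r = min a b / 2"
    have r: "0 < r" "r < a" "r < b" using a(1) b(1) by (auto simp: r_def)
    have "\<Delta> w u r = \<Delta> u w r" by (simp add: \<Delta>_def algebra_simps)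
    then have "r\<^sup>2 *\<^sub>R (D 2 x [u, w] - D 2 x [w, u])
        = (\<Delta> u w r - r\<^sup>2 *\<^sub>R D 2 x [w, u]) - (\<Delta> w u r - r\<^sup>2 *\<^sub>R D 2 x [u, w])"
      by (simp add: algebra_simps)
    then have "norm (r\<^sup>2 *\<^sub>R (D 2 x [u, w] - D 2 x [w, u]))
        \<le> norm (\<Delta> u w r - r\<^sup>2 *\<^sub>R D 2 x [w, u]) + norm (\<Delta> w u r - r\<^sup>2 *\<^sub>R D 2 x [u, w])"
      by (simp only: norm_triangle_ineq4)
    also have "\<dots> \<le> e / 2 * r\<^sup>2 + e / 2 * r\<^sup>2"
      by (rule add_mono[OF a(2)[OF r(1,2)] b(2)[OF r(1,3)]])
    finally have "norm (r\<^sup>2 *\<^sub>R (D 2 x [u, w] - D 2 x [w, u])) \<le> e / 2 * r\<^sup>2 + e / 2 * r\<^sup>2" .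
    then have "r\<^sup>2 * norm (D 2 x [u, w] - D 2 x [w, u]) \<le> r\<^sup>2 * e"
      unfolding norm_scaleR by (simp add: mult.commute)
    then show ?thesis using r(1) by simp
  qed
  then have "norm (D 2 x [u, w] - D 2 x [w, u]) \<le> 0" by (rule dense_ge)
  then show ?thesis by simp
qed

lemma smooth_within_differentiable:
  assumes f: "smooth_within F U f" and U: "openin (top_of_set F) U" and x: "x \<in> U"
    and P: "bounded_linear P" "range P = F" "\<And>v. v \<in> F \<Longrightarrow> P v = v"
  shows "f differentiable (at x within F)"
proof -
  obtain D :: "nat \<Rightarrow> 'a \<Rightarrow> 'a list \<Rightarrow> 'b" where D0: "\<forall>x\<in>U. D 0 x [] = f x"
    and ml: "\<forall>n. \<forall>x\<in>U. bounded_multilinear_on F n (D n x)"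
    and der: "\<forall>n. \<forall>x\<in>U. \<forall>e>0. \<forall>\<^sub>F y in at x within U. \<forall>vs. length vs = n \<longrightarrow> set vs \<subseteq> F \<longrightarrow>
             norm (D n y vs - D n x vs - D (Suc n) x ((y - x) # vs))
               \<le> e * norm (y - x) * prod_list (map norm vs)"
    using f unfolding smooth_within_def by blast
  interpret P: bounded_linear P by (rule P(1))
  have PF: "P v \<in> F" for v using P(2) by blast
  have F0: "0 \<in> F" using PF[of 0] by (simp add: P.zero)
  have Fdiff: "a - b \<in> F" if "a \<in> F" "b \<in> F" for a b
    using PF[of "a - b"] P(3) that by (simp add: P.diff)
  have UF: "U \<subseteq> F" using U by (rule openin_imp_subset)
  obtain T where T: "open T" "U = F \<inter> T" using U by (auto simp: openin_open)
  have at: "at x within U = at x within F"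
    by (rule at_within_nhd[of x T]) (use T x in auto)
  have add1: "D 1 x [a + c *\<^sub>R b] = D 1 x [a] + c *\<^sub>R D 1 x [b]" if "a \<in> F" "b \<in> F" for a b c
    using ml[rule_format, OF x, of 1, unfolded bounded_multilinear_on_def, THEN conjunct1,
        rule_format, of "[0]" 0 a b c] that F0 by simp
  have zero1: "D 1 x [0] = 0" using add1[OF F0 F0, of 1] by simp
  obtain K where K: "\<forall>vs. length vs = 1 \<longrightarrow> set vs \<subseteq> F \<longrightarrow> norm (D 1 x vs) \<le> K * prod_list (map norm vs)"
    using ml[rule_format, OF x, of 1] by (auto simp: bounded_multilinear_on_def)
  obtain B where B: "\<And>v. norm (P v) \<le> norm v * B" using P.bounded by blast
  have "bounded_linear (\<lambda>h. D 1 x [P h])"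
  proof (rule bounded_linear_intro[where K = "\<bar>K\<bar> * B"])
    show "D 1 x [P (a + b)] = D 1 x [P a] + D 1 x [P b]" for a b
      using add1[OF PF PF, of a 1 b] by (simp add: P.add)
    show "D 1 x [P (r *\<^sub>R a)] = r *\<^sub>R D 1 x [P a]" for r a
      using add1[OF F0 PF, of r a] zero1 by (simp add: P.scaleR)
    show "norm (D 1 x [P a]) \<le> norm a * (\<bar>K\<bar> * B)" for a
    proof -
      have "norm (D 1 x [P a]) \<le> K * norm (P a)" using K[rule_format, of "[P a]"] PF by simp
      also have "\<dots> \<le> \<bar>K\<bar> * norm (P a)" by (intro mult_right_mono) auto
      also have "\<dots> \<le> \<bar>K\<bar> * (norm a * B)" by (intro mult_left_mono B) auto
      finally show ?thesis by (simp add: algebra_simps)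
    qed
  qed
  moreover have "\<exists>d>0. \<forall>y\<in>F. norm (y - x) < d \<longrightarrow> norm (f y - f x - D 1 x [P (y - x)]) \<le> e * norm (y - x)"
    if "e > 0" for e
  proof -
    have "\<forall>\<^sub>F y in at x within U. norm (D 0 y [] - D 0 x [] - D 1 x [y - x]) \<le> e * norm (y - x)"
      using der[rule_format, OF x that, of 0] by simp
    moreover have "\<forall>\<^sub>F y in at x within U. y \<in> U" by (simp add: eventually_at_filter)
    ultimately have "\<forall>\<^sub>F y in at x within U. norm (f y - f x - D 1 x [P (y - x)]) \<le> e * norm (y - x)"
      by eventually_elim (use D0 x UF in \<open>auto simp: P(3) Fdiff subset_iff\<close>)
    then obtain d where d: "d > 0"
      "\<And>y. y \<in> F \<Longrightarrow> y \<noteq> x \<Longrightarrow> dist y x < d \<Longrightarrow> norm (f y - f x - D 1 x [P (y - x)]) \<le> e * norm (y - x)"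
      unfolding at eventually_at by auto
    have "norm (f y - f x - D 1 x [P (y - x)]) \<le> e * norm (y - x)" if "y \<in> F" "norm (y - x) < d" for y
      using d(2)[of y] that by (cases "y = x") (auto simp: dist_norm P.zero zero1[unfolded One_nat_def])
    with d(1) show ?thesis by blast
  qed
  ultimately have "(f has_derivative (\<lambda>h. D 1 x [P h])) (at x within F)"
    unfolding has_derivative_within_alt by blast
  then show ?thesis by (auto simp: differentiable_def)
qed


section \<open>Banach manifolds\<close>

text \<open>
  A manifold is given by its set of points and an indexed atlas of charts, the chart with index
  \<open>i\<close> being defined on \<open>chart_dom N i\<close> and taking values in the model space \<open>model N\<close>, a
  complemented closed subspace of the ambient normed space. For a Banach manifold \<open>M\<close> the model space is a whole
  Banach space \<open>'e\<close>; proper subspaces occur for the iterated tangent bundles below.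
\<close>

record ('p, 'i, 'v) manifold =
  carrier :: "'p set"
  index :: "'i set"
  chart_dom :: "'i \<Rightarrow> 'p set"
  chart :: "'i \<Rightarrow> 'p \<Rightarrow> 'v"
  model :: "'v set"

definition local_rep ::
    "('p, 'i, 'v) manifold \<Rightarrow> ('q, 'j, 'w) manifold \<Rightarrow> 'i \<Rightarrow> 'j \<Rightarrow> ('p \<Rightarrow> 'q) \<Rightarrow> 'v \<Rightarrow> 'w" where
  "local_rep N N' i j f = chart N' j \<circ> f \<circ> inv_into (chart_dom N i) (chart N i)"

definition local_rep_dom ::
    "('p, 'i, 'v) manifold \<Rightarrow> ('q, 'j, 'w) manifold \<Rightarrow> 'i \<Rightarrow> 'j \<Rightarrow> ('p \<Rightarrow> 'q) \<Rightarrow> 'v set" where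
  "local_rep_dom N N' i j f = chart N i ` {p \<in> chart_dom N i. f p \<in> chart_dom N' j}"

definition smooth_atlas :: "('p, 'i, 'v::real_normed_vector) manifold \<Rightarrow> bool" where
  "smooth_atlas N \<longleftrightarrow>
     (\<Union>i\<in>index N. chart_dom N i) = carrier N \<and>
     (\<forall>i\<in>index N. inj_on (chart N i) (chart_dom N i)) \<and>
     (\<forall>i\<in>index N. openin (top_of_set (model N)) (chart N i ` chart_dom N i)) \<and>
     (\<forall>i\<in>index N. \<forall>j\<in>index N.
        openin (top_of_set (model N)) (local_rep_dom N N i j id) \<and>
        smooth_within (model N) (local_rep_dom N N i j id) (local_rep N N i j id))"

definition banach_manifold :: "('p, 'i, 'e::banach) manifold \<Rightarrow> bool" where
  "banach_manifold M \<longleftrightarrow> smooth_atlas M \<and> model M = UNIV"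

text \<open>
  The condition on \<open>local_rep_dom\<close> says that \<open>f\<close> is continuous.
\<close>

definition smooth_map ::
    "('p, 'i, 'v::real_normed_vector) manifold \<Rightarrow> ('q, 'j, 'w::real_normed_vector) manifold
       \<Rightarrow> ('p \<Rightarrow> 'q) \<Rightarrow> bool" where
  "smooth_map N N' f \<longleftrightarrow>
     f ` carrier N \<subseteq> carrier N' \<and>
     (\<forall>i\<in>index N. \<forall>j\<in>index N'.
        openin (top_of_set (model N)) (local_rep_dom N N' i j f) \<and>
        smooth_within (model N) (local_rep_dom N N' i j f) (local_rep N N' i j f))"

definition manifold_topology :: "('p, 'i, 'v::real_normed_vector) manifold \<Rightarrow> 'p topology" where
  "manifold_topology N = topology (\<lambda>W. W \<subseteq> carrier N \<and>
     (\<forall>i\<in>index N. openin (top_of_set (model N)) (chart N i ` (W \<inter> chart_dom N i))))"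

lemma openin_manifold_topology:
  assumes "smooth_atlas N"
  shows "openin (manifold_topology N) W \<longleftrightarrow> W \<subseteq> carrier N \<and>
     (\<forall>i\<in>index N. openin (top_of_set (model N)) (chart N i ` (W \<inter> chart_dom N i)))"
proof -
  let ?P = "\<lambda>W. W \<subseteq> carrier N \<and>
     (\<forall>i\<in>index N. openin (top_of_set (model N)) (chart N i ` (W \<inter> chart_dom N i)))"
  have inj: "inj_on (chart N i) (chart_dom N i)" if "i \<in> index N" for i
    using assms that by (auto simp: smooth_atlas_def)
  have "istopology ?P"
    unfolding istopology_def
  proof (intro conjI allI impI)
    fix S T assume S: "?P S" and T: "?P T"
    show "S \<inter> T \<subseteq> carrier N" using S by blast
    show "\<forall>i\<in>index N. openin (top_of_set (model N)) (chart N i ` (S \<inter> T \<inter> chart_dom N i))"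
    proof
      fix i assume i: "i \<in> index N"
      have "chart N i ` (S \<inter> T \<inter> chart_dom N i)
          = chart N i ` (S \<inter> chart_dom N i) \<inter> chart N i ` (T \<inter> chart_dom N i)"
        using inj[OF i] by (auto simp: inj_on_def)
      then show "openin (top_of_set (model N)) (chart N i ` (S \<inter> T \<inter> chart_dom N i))"
        using S T i by (simp add: openin_Int)
    qed
  next
    fix K assume K: "\<forall>W\<in>K. ?P W"
    show "\<Union>K \<subseteq> carrier N" using K by blast
    show "\<forall>i\<in>index N. openin (top_of_set (model N)) (chart N i ` (\<Union>K \<inter> chart_dom N i))"
    proof
      fix i assume i: "i \<in> index N"
      have "chart N i ` (\<Union>K \<inter> chart_dom N i) = (\<Union>W\<in>K. chart N i ` (W \<inter> chart_dom N i))"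
        by blast
      then show "openin (top_of_set (model N)) (chart N i ` (\<Union>K \<inter> chart_dom N i))"
        using K i by auto
    qed
  qed
  then show ?thesis
    unfolding manifold_topology_def by (simp add: topology_inverse')
qed

definition smooth_function :: "('p, 'i, 'v::real_normed_vector) manifold \<Rightarrow> ('p \<Rightarrow> real) \<Rightarrow> bool"
  where "smooth_function N f \<longleftrightarrow>
     (\<forall>i\<in>index N. smooth_within (model N) (chart N i ` chart_dom N i)
        (f \<circ> inv_into (chart_dom N i) (chart N i)))"

text \<open>
  Every open cover has a subordinate smooth partition of unity, indexed by the members of the cover.
\<close>

definition partitionable :: "('p, 'i, 'v::real_normed_vector) manifold \<Rightarrow> bool" where
  "partitionable N \<longleftrightarrow>
     Hausdorff_space (manifold_topology N) \<and>
     (\<forall>\<C>. (\<forall>U\<in>\<C>. openin (manifold_topology N) U) \<longrightarrow> \<Union>\<C> = carrier N \<longrightarrow>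
        (\<exists>\<psi> :: 'p set \<Rightarrow> 'p \<Rightarrow> real.
           (\<forall>U\<in>\<C>. smooth_function N (\<psi> U) \<and> (\<forall>p\<in>carrier N. 0 \<le> \<psi> U p) \<and>
              manifold_topology N closure_of {p \<in> carrier N. \<psi> U p \<noteq> 0} \<subseteq> U) \<and>
           (\<forall>p\<in>carrier N. \<exists>W. openin (manifold_topology N) W \<and> p \<in> W \<and>
              finite {U \<in> \<C>. \<exists>q\<in>W. \<psi> U q \<noteq> 0}) \<and>
           (\<forall>p\<in>carrier N. (\<Sum>U | U \<in> \<C> \<and> \<psi> U p \<noteq> 0. \<psi> U p) = 1)))"


section \<open>Iterated tangent bundles\<close>

text \<open>
  All the model spaces \<open>E, E\<^sup>2, E\<^sup>4, \<dots>\<close> of \<open>M, TM, T\<^sup>2M, \<dots>\<close> are realised inside the one normed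
  space of bounded sequences in \<open>E\<close> with the supremum norm: \<open>E\<close> is the space of sequences
  supported at \<open>0\<close>, and \<open>vpair\<close> identifies \<open>F \<times> F\<close> with a space of sequences by interleaving,
  so that \<open>T\<^sup>rM\<close> is modelled on the sequences supported in \<open>{..<2^r}\<close>.
\<close>

type_synonym 'e seqs = "nat \<Rightarrow>\<^sub>C 'e"

definition vembed :: "'e::real_normed_vector \<Rightarrow> 'e seqs" where
  "vembed x = Bcontfun (\<lambda>n. if n = 0 then x else 0)"

definition vpair :: "'e::real_normed_vector seqs \<Rightarrow> 'e seqs \<Rightarrow> 'e seqs" where
  "vpair v w = Bcontfun (\<lambda>n. if even n then v (n div 2) else w (n div 2))"

definition vfst :: "'e::real_normed_vector seqs \<Rightarrow> 'e seqs" where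
  "vfst v = Bcontfun (\<lambda>n. v (2 * n))"

definition vsnd :: "'e::real_normed_vector seqs \<Rightarrow> 'e seqs" where
  "vsnd v = Bcontfun (\<lambda>n. v (2 * n + 1))"

lemma bcontfun_nat_iff:
  "f \<in> (bcontfun :: (nat \<Rightarrow> 'e::real_normed_vector) set) \<longleftrightarrow> bounded (range f)"
  by (simp add: bcontfun_def)

lemma apply_vembed: "vembed x n = (if n = 0 then x else 0)"
proof -
  have "(\<lambda>n::nat. if n = 0 then x else 0) \<in> bcontfun"
    unfolding bcontfun_nat_iff by (rule boundedI[of _ "norm x"]) auto
  then show ?thesis by (simp add: vembed_def Bcontfun_inverse)
qed

lemma apply_vpair: "vpair v w n = (if even n then v (n div 2) else w (n div 2))"
proof -
  have "(\<lambda>n. if even n then v (n div 2) else w (n div 2)) \<in> bcontfun"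
    unfolding bcontfun_nat_iff
    by (rule boundedI[of _ "max (norm v) (norm w)"])
       (auto intro: norm_bounded[THEN order_trans])
  then show ?thesis by (simp add: vpair_def Bcontfun_inverse)
qed

lemma apply_vfst: "vfst v n = v (2 * n)"
proof -
  have "(\<lambda>n. v (2 * n)) \<in> bcontfun"
    unfolding bcontfun_nat_iff
    by (rule boundedI[of _ "norm v"]) (auto intro: norm_bounded)
  then show ?thesis by (simp add: vfst_def Bcontfun_inverse)
qed

lemma apply_vsnd: "vsnd v n = v (2 * n + 1)"
proof -
  have "(\<lambda>n. v (2 * n + 1)) \<in> bcontfun"
    unfolding bcontfun_nat_iff
    by (rule boundedI[of _ "norm v"]) (auto intro: norm_bounded simp del: One_nat_def add_Suc_right)
  then show ?thesis by (simp add: vsnd_def Bcontfun_inverse)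
qed

lemma vfst_vpair [simp]: "vfst (vpair v w) = v"
  and vsnd_vpair [simp]: "vsnd (vpair v w) = w"
  and vpair_vfst_vsnd [simp]: "vpair (vfst v) (vsnd v) = v"
  by (rule bcontfun_eqI; simp add: apply_vfst apply_vsnd apply_vpair)+

text \<open>
  A tangent vector \<open>Tan p \<xi>\<close> at \<open>p\<close> consists of its components \<open>\<xi> i\<close> in all the charts at \<open>p\<close>,
  which are related by the derivatives of the transition maps. As the charts of \<open>TN\<close> are indexed
  by the charts of \<open>N\<close>, points of all the \<open>T\<^sup>rM\<close> are elements of a single datatype.
  The map \<open>foot\<close> is the tangent bundle projection \<open>\<pi>\<^sub>r : T\<^sup>r\<^sup>+\<^sup>1M \<rightarrow> T\<^sup>rM\<close>, for every \<open>r\<close>.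
\<close>

datatype ('m, 'i, 'v) tpoint =
    Base 'm
  | Tan (foot: "('m, 'i, 'v) tpoint") (comps: "'i \<Rightarrow> 'v")

type_synonym ('m, 'i, 'e) tmanifold = "(('m, 'i, 'e seqs) tpoint, 'i, 'e seqs) manifold"

definition base_manifold ::
    "('m, 'i, 'e::real_normed_vector) manifold \<Rightarrow> ('m, 'i, 'e) tmanifold" where
  "base_manifold M =
     \<lparr>carrier = Base ` carrier M,
      index = index M,
      chart_dom = (\<lambda>i. Base ` chart_dom M i),
      chart = (\<lambda>i p. case p of Base x \<Rightarrow> vembed (chart M i x) | Tan _ _ \<Rightarrow> 0),
      model = vembed ` model M\<rparr>"

definition tangent_carrier ::
    "('m, 'i, 'e::real_normed_vector) tmanifold \<Rightarrow> ('m, 'i, 'e seqs) tpoint set" where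
  "tangent_carrier N = {Tan p \<xi> | p \<xi>. p \<in> carrier N \<and>
     (\<forall>i. if i \<in> index N \<and> p \<in> chart_dom N i then \<xi> i \<in> model N else \<xi> i = 0) \<and>
     (\<forall>i\<in>index N. \<forall>j\<in>index N. p \<in> chart_dom N i \<inter> chart_dom N j \<longrightarrow>
        \<xi> j = frechet_derivative (local_rep N N i j id) (at (chart N i p) within model N) (\<xi> i))}"

definition tangent_bundle ::
    "('m, 'i, 'e::real_normed_vector) tmanifold \<Rightarrow> ('m, 'i, 'e) tmanifold" where
  "tangent_bundle N =
     \<lparr>carrier = tangent_carrier N,
      index = index N,
      chart_dom = (\<lambda>i. {q \<in> tangent_carrier N. foot q \<in> chart_dom N i}),
      chart = (\<lambda>i q. vpair (chart N i (foot q)) (comps q i)),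
      model = {vpair v w | v w. v \<in> model N \<and> w \<in> model N}\<rparr>"

primrec iter_tangent ::
    "('m, 'i, 'e::real_normed_vector) manifold \<Rightarrow> nat \<Rightarrow> ('m, 'i, 'e) tmanifold" where
  "iter_tangent M 0 = base_manifold M"
| "iter_tangent M (Suc r) = tangent_bundle (iter_tangent M r)"

text \<open>
  The tangent map \<open>Df\<close>, computed in an arbitrary chart at the foot point of its argument.
\<close>

definition tangent_map ::
    "('m, 'i, 'e::real_normed_vector) tmanifold \<Rightarrow> ('m, 'i, 'e) tmanifold
       \<Rightarrow> (('m, 'i, 'e seqs) tpoint \<Rightarrow> ('m, 'i, 'e seqs) tpoint)
       \<Rightarrow> ('m, 'i, 'e seqs) tpoint \<Rightarrow> ('m, 'i, 'e seqs) tpoint" where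
  "tangent_map N N' f q =
     (let p = foot q; i = (SOME i. i \<in> index N \<and> p \<in> chart_dom N i)
      in Tan (f p) (\<lambda>j. if j \<in> index N' \<and> f p \<in> chart_dom N' j
           then frechet_derivative (local_rep N N' i j f) (at (chart N i p) within model N) (comps q i)
           else 0))"

definition tangent_map2 ::
    "('m, 'i, 'e::real_normed_vector) tmanifold \<Rightarrow> ('m, 'i, 'e) tmanifold
       \<Rightarrow> (('m, 'i, 'e seqs) tpoint \<Rightarrow> ('m, 'i, 'e seqs) tpoint)
       \<Rightarrow> ('m, 'i, 'e seqs) tpoint \<Rightarrow> ('m, 'i, 'e seqs) tpoint" where
  "tangent_map2 N N' f = tangent_map (tangent_bundle N) (tangent_bundle N') (tangent_map N N' f)"

definition vector_fields ::
    "('m, 'i, 'e::real_normed_vector) tmanifold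
       \<Rightarrow> (('m, 'i, 'e seqs) tpoint \<Rightarrow> ('m, 'i, 'e seqs) tpoint) set" where
  "vector_fields N = {A. smooth_map N (tangent_bundle N) A \<and> (\<forall>p\<in>carrier N. foot (A p) = p)}"

text \<open>The projection \<open>\<pi>\<^bsub>j,i\<^esub> : T\<^sup>jM \<rightarrow> T\<^sup>iM\<close> for \<open>i \<le> j\<close>.\<close>

definition iter_proj :: "nat \<Rightarrow> nat \<Rightarrow> ('m, 'i, 'v) tpoint \<Rightarrow> ('m, 'i, 'v) tpoint" where
  "iter_proj j i = foot ^^ (j - i)"


section \<open>Canonical involution and complete lift\<close>

text \<open>
  The canonical involution of a second tangent bundle is \<open>(x, y, X, Y) \<mapsto> (x, X, y, Y)\<close> in every
  induced chart; \<open>\<xi> i = y\<close> and \<open>\<eta> i = (X, Y)\<close> are the components in the chart with index \<open>i\<close>.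
\<close>

fun flip :: "('m, 'i, 'e::real_normed_vector seqs) tpoint \<Rightarrow> ('m, 'i, 'e seqs) tpoint" where
  "flip (Tan (Tan x \<xi>) \<eta>) = Tan (Tan x (\<lambda>i. vfst (\<eta> i))) (\<lambda>i. vpair (\<xi> i) (vsnd (\<eta> i)))"
| "flip p = p"

lemma chart_flip:
  assumes "chart (tangent_bundle (tangent_bundle N)) i (Tan (Tan p \<xi>) \<eta>)
             = vpair (vpair x y) (vpair X Y)"
  shows "chart (tangent_bundle (tangent_bundle N)) i (flip (Tan (Tan p \<xi>) \<eta>))
             = vpair (vpair x X) (vpair y Y)"
proof -
  have "vpair (chart N i p) (\<xi> i) = vpair x y" "\<eta> i = vpair X Y"
    using assms[THEN arg_cong[where f = vfst]] assms[THEN arg_cong[where f = vsnd]]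
    by (simp_all add: tangent_bundle_def)
  moreover from this have "chart N i p = x" "\<xi> i = y"
    by (metis vfst_vpair, metis vsnd_vpair)
  ultimately show ?thesis by (simp add: tangent_bundle_def)
qed

text \<open>
  The velocity \<open>\<partial>\<^sub>t c(t)\<close> of a curve in \<open>N\<close>; the lemma \<open>flip_mixed_velocity\<close> below states
  that \<open>flip\<close> has the characteristic property
  \<open>\<partial>\<^sub>t \<partial>\<^sub>s \<gamma>(t, s) = \<kappa> (\<partial>\<^sub>s \<partial>\<^sub>t \<gamma>(t, s))\<close> of the canonical involution.
\<close>

definition velocity ::
    "('m, 'i, 'e::real_normed_vector) tmanifold \<Rightarrow> (real \<Rightarrow> ('m, 'i, 'e seqs) tpoint)
       \<Rightarrow> real \<Rightarrow> ('m, 'i, 'e seqs) tpoint" where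
  "velocity N c t = Tan (c t) (\<lambda>i. if i \<in> index N \<and> c t \<in> chart_dom N i
     then vector_derivative (chart N i \<circ> c) (at t) else 0)"

lemma velocity_in_tangent_bundle:
  assumes N: "smooth_atlas N"
    and P: "bounded_linear P" "range P = model N" "\<And>v. v \<in> model N \<Longrightarrow> P v = v"
    and c: "open I" "t \<in> I" "\<And>s. s \<in> I \<Longrightarrow> c s \<in> carrier N"
    and c_cont: "\<And>i. i \<in> index N \<Longrightarrow> open {s \<in> I. c s \<in> chart_dom N i}"
    and c_diff: "\<And>i. i \<in> index N \<Longrightarrow> c t \<in> chart_dom N i \<Longrightarrow> (chart N i \<circ> c) differentiable (at t)"
  shows "velocity N c t \<in> tangent_carrier N"
proof -
  interpret P: bounded_linear P by (rule P(1))
  have mod: "chart N i p \<in> model N" if "i \<in> index N" "p \<in> chart_dom N i" for i p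
    using N that unfolding smooth_atlas_def by (meson image_subset_iff openin_imp_subset)
  have vd: "((chart N i \<circ> c) has_vector_derivative vector_derivative (chart N i \<circ> c) (at t)) (at t)"
    if "i \<in> index N" "c t \<in> chart_dom N i" for i
    using c_diff[OF that] by (simp add: vector_derivative_works)
  have in_model: "vector_derivative (chart N i \<circ> c) (at t) \<in> model N"
    if i: "i \<in> index N" "c t \<in> chart_dom N i" for i
  proof -
    have "((P \<circ> (chart N i \<circ> c)) has_vector_derivative P (vector_derivative (chart N i \<circ> c) (at t))) (at t)"
      using P.has_vector_derivative[OF vd[OF i]] by (simp add: o_def)
    then have "((chart N i \<circ> c) has_vector_derivative P (vector_derivative (chart N i \<circ> c) (at t))) (at t)"
      by (rule has_vector_derivative_transform_within_open[OF _ c_cont[OF i(1)]])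
         (use i c in \<open>auto simp: P(3) mod\<close>)
    then have "P (vector_derivative (chart N i \<circ> c) (at t)) = vector_derivative (chart N i \<circ> c) (at t)"
      by (rule vector_derivative_at[symmetric])
    then show ?thesis
      using rangeI[of P "vector_derivative (chart N i \<circ> c) (at t)"] unfolding P(2) by (simp only:)
  qed
  have coherent: "vector_derivative (chart N j \<circ> c) (at t)
      = frechet_derivative (local_rep N N i j id) (at (chart N i (c t)) within model N)
          (vector_derivative (chart N i \<circ> c) (at t))"
    if i: "i \<in> index N" "c t \<in> chart_dom N i" and j: "j \<in> index N" "c t \<in> chart_dom N j" for i j
  proof -
    let ?\<tau> = "local_rep N N i j id" and ?g = "chart N i \<circ> c"
    define J where "J = {s \<in> I. c s \<in> chart_dom N i} \<inter> {s \<in> I. c s \<in> chart_dom N j}"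
    have J: "open J" "t \<in> J" using c_cont i j c by (auto simp: J_def)
    have sm: "smooth_within (model N) (local_rep_dom N N i j id) ?\<tau>"
        "openin (top_of_set (model N)) (local_rep_dom N N i j id)"
      and inj: "inj_on (chart N i) (chart_dom N i)"
      using N i j by (auto simp: smooth_atlas_def)
    have "?\<tau> differentiable (at (?g t) within model N)"
      by (rule smooth_within_differentiable[OF sm _ P]) (use i j in \<open>auto simp: local_rep_dom_def\<close>)
    then have "(?\<tau> has_derivative frechet_derivative ?\<tau> (at (?g t) within model N)) (at (?g t) within model N)"
      by (simp add: frechet_derivative_works)
    then have "(?\<tau> has_derivative frechet_derivative ?\<tau> (at (?g t) within model N)) (at (?g t) within ?g ` J)"
      by (rule has_derivative_subset) (auto simp: J_def mod i)
    moreover have "(?g has_derivative (\<lambda>h. h *\<^sub>R vector_derivative ?g (at t))) (at t within J)"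
      using vd[OF i] by (auto simp: has_vector_derivative_def intro: has_derivative_at_withinI)
    ultimately have "((\<lambda>s. ?\<tau> (?g s)) has_derivative
        (\<lambda>h. frechet_derivative ?\<tau> (at (?g t) within model N) (h *\<^sub>R vector_derivative ?g (at t)))) (at t within J)"
      by (rule has_derivative_in_compose[rotated])
    moreover have lin: "linear (frechet_derivative ?\<tau> (at (?g t) within model N))"
      using \<open>?\<tau> differentiable _\<close> by (rule linear_frechet_derivative)
    ultimately have "((\<lambda>s. ?\<tau> (?g s)) has_vector_derivative
        frechet_derivative ?\<tau> (at (?g t) within model N) (vector_derivative ?g (at t))) (at t)"
      unfolding has_vector_derivative_def at_within_open[OF J(2,1)] linear_scale[OF lin] by -
    then have "((chart N j \<circ> c) has_vector_derivative
        frechet_derivative ?\<tau> (at (?g t) within model N) (vector_derivative ?g (at t))) (at t)"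
      by (rule has_vector_derivative_transform_within_open[OF _ J])
         (use inj in \<open>auto simp: J_def local_rep_def\<close>)
    from vector_derivative_at[OF this] show ?thesis unfolding comp_apply .
  qed
  define \<xi> where "\<xi> i = (if i \<in> index N \<and> c t \<in> chart_dom N i
      then vector_derivative (chart N i \<circ> c) (at t) else 0)" for i
  have \<xi>: "\<xi> i = vector_derivative (chart N i \<circ> c) (at t)" if "i \<in> index N" "c t \<in> chart_dom N i" for i
    using that by (simp add: \<xi>_def)
  have "velocity N c t = Tan (c t) \<xi>" by (simp add: velocity_def \<xi>_def fun_eq_iff)
  moreover have "\<forall>i. if i \<in> index N \<and> c t \<in> chart_dom N i then \<xi> i \<in> model N else \<xi> i = 0"
  proof
    fix i
    show "if i \<in> index N \<and> c t \<in> chart_dom N i then \<xi> i \<in> model N else \<xi> i = 0"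
      by (cases "i \<in> index N \<and> c t \<in> chart_dom N i") (auto simp: \<xi> in_model, auto simp: \<xi>_def)
  qed
  moreover have "\<forall>i\<in>index N. \<forall>j\<in>index N. c t \<in> chart_dom N i \<inter> chart_dom N j \<longrightarrow>
      \<xi> j = frechet_derivative (local_rep N N i j id) (at (chart N i (c t)) within model N) (\<xi> i)"
  proof (intro ballI impI, elim IntE)
    fix i j assume ij: "i \<in> index N" "j \<in> index N" "c t \<in> chart_dom N i" "c t \<in> chart_dom N j"
    show "\<xi> j = frechet_derivative (local_rep N N i j id) (at (chart N i (c t)) within model N) (\<xi> i)"
      unfolding \<xi>[OF ij(1,3)] \<xi>[OF ij(2,4)] by (rule coherent[OF ij(1,3,2,4)])
  qed
  ultimately show ?thesis unfolding tangent_carrier_def using c(2,3) by blast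
qed

lemma has_vector_derivative_vpair:
  fixes f g :: "real \<Rightarrow> 'e::real_normed_vector seqs"
  assumes "(f has_vector_derivative f') (at t)" "(g has_vector_derivative g') (at t)"
  shows "((\<lambda>t. vpair (f t) (g t)) has_vector_derivative vpair f' g') (at t)"
proof -
  have bl: "bounded_linear (\<lambda>p :: 'e seqs \<times> 'e seqs. vpair (fst p) (snd p))"
  proof (rule bounded_linear_intro[where K = 1])
    show "norm (vpair (fst p) (snd p)) \<le> norm p * 1" for p :: "'e seqs \<times> 'e seqs"
    proof -
      obtain v w where p: "p = (v, w)" by (cases p)
      have "norm (v n) \<le> norm p" "norm (w n) \<le> norm p" for n
        using norm_bounded[of v n] norm_bounded[of w n] norm_fst_le[of v w] norm_snd_le[of w v]
        unfolding p by linarith+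
      then show ?thesis by (auto intro!: norm_bound simp: apply_vpair p)
    qed
  qed (auto intro!: bcontfun_eqI simp: apply_vpair)
  show ?thesis
    using bounded_linear.has_vector_derivative[OF bl has_vector_derivative_Pair[OF assms]] by simp
qed

lemma vpair_zero: "vpair 0 0 = 0" and vfst_zero: "vfst 0 = 0" and vsnd_zero: "vsnd 0 = 0"
  by (rule bcontfun_eqI; simp add: apply_vpair apply_vfst apply_vsnd)+

lemma flip_mixed_velocity:
  fixes \<gamma> :: "real \<times> real \<Rightarrow> ('m, 'i, 'e::real_normed_vector seqs) tpoint"
  assumes N: "smooth_atlas N"
    and P: "bounded_linear P" "range P = model N" "\<And>v. v \<in> model N \<Longrightarrow> P v = v"
    and S: "S = {-\<epsilon><..<\<epsilon>} \<times> {-\<epsilon><..<\<epsilon>}" and \<gamma>: "\<gamma> ` S \<subseteq> carrier N"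
    and sm: "\<And>i. i \<in> index N \<Longrightarrow> open {z \<in> S. \<gamma> z \<in> chart_dom N i} \<and>
         smooth_within UNIV {z \<in> S. \<gamma> z \<in> chart_dom N i} (chart N i \<circ> \<gamma>)"
    and ts: "(t, s) \<in> S"
  shows "velocity (tangent_bundle N) (\<lambda>t. velocity N (\<lambda>s. \<gamma> (t, s)) s) t
       = flip (velocity (tangent_bundle N) (\<lambda>s. velocity N (\<lambda>t. \<gamma> (t, s)) t) s)"
proof -
  define A where "A i = {z \<in> S. \<gamma> z \<in> chart_dom N i}" for i
  have openA: "open (A i)" if "i \<in> index N" for i using sm[OF that] by (simp add: A_def)
  have openS: "open S" unfolding S by (intro open_Times) auto
  have slice1: "open {t. (t, s) \<in> B}" if "open B" for B :: "(real \<times> real) set" and s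
    using open_vimage[OF that continuous_on_Pair[OF continuous_on_id continuous_on_const]] by (simp add: vimage_def)
  have slice2: "open {s. (t, s) \<in> B}" if "open B" for B :: "(real \<times> real) set" and t
    using open_vimage[OF that continuous_on_Pair[OF continuous_on_const continuous_on_id]] by (simp add: vimage_def)
  define R where "R i D1 D2 \<longleftrightarrow> (\<forall>t s. (t, s) \<in> A i \<longrightarrow>
        ((\<lambda>s. chart N i (\<gamma> (t, s))) has_vector_derivative D1 (t, s) (0, 1)) (at s) \<and>
        ((\<lambda>t. chart N i (\<gamma> (t, s))) has_vector_derivative D1 (t, s) (1, 0)) (at t) \<and>
        ((\<lambda>s. D1 (t, s) (1, 0)) has_vector_derivative D2 (t, s)) (at s) \<and>
        ((\<lambda>t. D1 (t, s) (0, 1)) has_vector_derivative D2 (t, s)) (at t))"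
    for i and D1 :: "real \<times> real \<Rightarrow> real \<times> real \<Rightarrow> 'e seqs" and D2
  have "\<exists>D1 D2. R i D1 D2"
    if i: "i \<in> index N" for i
  proof -
    let ?g = "chart N i \<circ> \<gamma>"
    have "smooth_within UNIV (A i) ?g" using sm[OF i] by (simp add: A_def)
    then obtain D :: "nat \<Rightarrow> real \<times> real \<Rightarrow> (real \<times> real) list \<Rightarrow> 'e seqs"
      where D0: "\<forall>x\<in>A i. D 0 x [] = ?g x"
      and ml: "\<forall>n. \<forall>x\<in>A i. bounded_multilinear_on UNIV n (D n x)"
      and der: "\<forall>n. \<forall>x\<in>A i. \<forall>e>0. \<forall>\<^sub>F y in at x within A i.
             \<forall>vs. length vs = n \<longrightarrow> set vs \<subseteq> UNIV \<longrightarrow>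
             norm (D n y vs - D n x vs - D (Suc n) x ((y - x) # vs))
               \<le> e * norm (y - x) * prod_list (map norm vs)"
      unfolding smooth_within_def by blast
    have d: "((\<lambda>z. D n z vs) has_derivative (\<lambda>h. D (Suc n) z (h # vs))) (at z)"
      if "z \<in> A i" "length vs = n" for z n vs
      by (rule fderiv_tower[OF openA[OF i] that(1) ml der that(2)])
    have line: "((\<lambda>s. (t, s)) has_derivative (\<lambda>h. (0, h))) (at s)"
        "((\<lambda>t. (t, s)) has_derivative (\<lambda>h. (h, 0))) (at t)" for t s :: real
      by (auto intro!: derivative_eq_intros)
    have sc: "D (Suc n) z (h *\<^sub>R v # vs) = h *\<^sub>R D (Suc n) z (v # vs)"
      if "z \<in> A i" "length vs = n" for n z vs h v
      using linear_scale[OF has_derivative_linear[OF d[OF that]]] by blast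
    have ds: "((\<lambda>s. D n (t, s) vs) has_vector_derivative D (Suc n) (t, s) ((0, 1) # vs)) (at s)"
      and dt: "((\<lambda>t. D n (t, s) vs) has_vector_derivative D (Suc n) (t, s) ((1, 0) # vs)) (at t)"
      if z: "(t, s) \<in> A i" "length vs = n" for t s n vs
    proof -
      have "D (Suc n) (t, s) ((0, h) # vs) = h *\<^sub>R D (Suc n) (t, s) ((0, 1) # vs)"
        "D (Suc n) (t, s) ((h, 0) # vs) = h *\<^sub>R D (Suc n) (t, s) ((1, 0) # vs)" for h
        using sc[OF z, of h "(0, 1)"] sc[OF z, of h "(1, 0)"]
        unfolding scaleR_Pair real_scaleR_def mult_zero_right mult_1_right .
      then have eqs:
        "(\<lambda>h. D (Suc n) (t, s) ((0, h) # vs)) = (\<lambda>h. h *\<^sub>R D (Suc n) (t, s) ((0, 1) # vs))"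
        "(\<lambda>h. D (Suc n) (t, s) ((h, 0) # vs)) = (\<lambda>h. h *\<^sub>R D (Suc n) (t, s) ((1, 0) # vs))"
        by blast+
      show "((\<lambda>s. D n (t, s) vs) has_vector_derivative D (Suc n) (t, s) ((0, 1) # vs)) (at s)"
        using has_derivative_compose[OF line(1) d[OF z]]
        unfolding has_vector_derivative_def eqs(1)[symmetric] .
      show "((\<lambda>t. D n (t, s) vs) has_vector_derivative D (Suc n) (t, s) ((1, 0) # vs)) (at t)"
        using has_derivative_compose[OF line(2) d[OF z]]
        unfolding has_vector_derivative_def eqs(2)[symmetric] .
    qed
    have sym: "D 2 z [(1, 0), (0, 1)] = D 2 z [(0, 1), (1, 0)]" if "z \<in> A i" for z
      by (rule symmetric_second_derivative[OF openA[OF i] that ml der])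
    have chart_s: "((\<lambda>s. chart N i (\<gamma> (t, s))) has_vector_derivative D 1 (t, s) [(0, 1)]) (at s)"
      and chart_t: "((\<lambda>t. chart N i (\<gamma> (t, s))) has_vector_derivative D 1 (t, s) [(1, 0)]) (at t)"
      if z: "(t, s) \<in> A i" for t s
    proof -
      have "((\<lambda>s. D 0 (t, s) []) has_vector_derivative D 1 (t, s) [(0, 1)]) (at s)"
        "((\<lambda>t. D 0 (t, s) []) has_vector_derivative D 1 (t, s) [(1, 0)]) (at t)"
        using ds[OF z, of "[]" 0] dt[OF z, of "[]" 0] by simp_all
      moreover have "open {s. (t, s) \<in> A i}" "open {t. (t, s) \<in> A i}"
        by (rule slice2[OF openA[OF i]], rule slice1[OF openA[OF i]])
      ultimately show
        "((\<lambda>s. chart N i (\<gamma> (t, s))) has_vector_derivative D 1 (t, s) [(0, 1)]) (at s)"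
        "((\<lambda>t. chart N i (\<gamma> (t, s))) has_vector_derivative D 1 (t, s) [(1, 0)]) (at t)"
        by (auto intro: has_vector_derivative_transform_within_open simp: D0 z)
    qed
    have D2s: "((\<lambda>s. D 1 (t, s) [(1, 0)]) has_vector_derivative D 2 (t, s) [(1, 0), (0, 1)]) (at s)"
      and D2t: "((\<lambda>t. D 1 (t, s) [(0, 1)]) has_vector_derivative D 2 (t, s) [(1, 0), (0, 1)]) (at t)"
      if z: "(t, s) \<in> A i" for t s
      using ds[OF z, of "[(1, 0)]" 1] dt[OF z, of "[(0, 1)]" 1] sym[OF z]
      by (simp_all add: numeral_2_eq_2)
    show ?thesis
      by (rule exI[of _ "\<lambda>z u. D 1 z [u]"], rule exI[of _ "\<lambda>z. D 2 z [(1, 0), (0, 1)]"])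
         (use chart_s chart_t D2s D2t in \<open>simp add: R_def\<close>)
  qed
  then obtain D1 D2 where R: "\<And>i. i \<in> index N \<Longrightarrow> R i (D1 i) (D2 i)"
    by metis
  have D1s: "\<And>i t s. i \<in> index N \<Longrightarrow> (t, s) \<in> A i \<Longrightarrow>
        ((\<lambda>s. chart N i (\<gamma> (t, s))) has_vector_derivative D1 i (t, s) (0, 1)) (at s)"
    and     D1t: "\<And>i t s. i \<in> index N \<Longrightarrow> (t, s) \<in> A i \<Longrightarrow>
        ((\<lambda>t. chart N i (\<gamma> (t, s))) has_vector_derivative D1 i (t, s) (1, 0)) (at t)"
    and     D2s: "\<And>i t s. i \<in> index N \<Longrightarrow> (t, s) \<in> A i \<Longrightarrow>
        ((\<lambda>s. D1 i (t, s) (1, 0)) has_vector_derivative D2 i (t, s)) (at s)"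
    and     D2t: "\<And>i t s. i \<in> index N \<Longrightarrow> (t, s) \<in> A i \<Longrightarrow>
        ((\<lambda>t. D1 i (t, s) (0, 1)) has_vector_derivative D2 i (t, s)) (at t)"
    using R unfolding R_def by blast+
  have A_iff: "(t, s) \<in> A i \<longleftrightarrow> (t, s) \<in> S \<and> \<gamma> (t, s) \<in> chart_dom N i" for t s i
    by (simp add: A_def)
  have vs: "velocity N (\<lambda>s. \<gamma> (t, s)) s
      = Tan (\<gamma> (t, s)) (\<lambda>i. if i \<in> index N \<and> (t, s) \<in> A i then D1 i (t, s) (0, 1) else 0)"
    if "(t, s) \<in> S" for t s
    using that by (auto simp: velocity_def A_iff o_def fun_eq_iff intro!: vector_derivative_at D1s)
  have vt: "velocity N (\<lambda>t. \<gamma> (t, s)) t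
      = Tan (\<gamma> (t, s)) (\<lambda>i. if i \<in> index N \<and> (t, s) \<in> A i then D1 i (t, s) (1, 0) else 0)"
    if "(t, s) \<in> S" for t s
    using that by (auto simp: velocity_def A_iff o_def fun_eq_iff intro!: vector_derivative_at D1t)
  have cs: "velocity N (\<lambda>s. \<gamma> (t, s)) s \<in> tangent_carrier N" if "(t, s) \<in> S" for t s
  proof (rule velocity_in_tangent_bundle[OF N P, where I = "{s. (t, s) \<in> S}"])
    show "open {s' \<in> {s. (t, s) \<in> S}. \<gamma> (t, s') \<in> chart_dom N i}" if "i \<in> index N" for i
      using slice2[OF openA[OF that]] by (simp add: A_iff)
    show "(chart N i \<circ> (\<lambda>s. \<gamma> (t, s))) differentiable at s" if "i \<in> index N" "\<gamma> (t, s) \<in> chart_dom N i" for i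
      using D1s[of i t s] that \<open>(t, s) \<in> S\<close>
      by (auto simp: A_iff o_def has_vector_derivative_def differentiable_def)
  qed (use that \<gamma> slice2[OF openS] in auto)
  have ct: "velocity N (\<lambda>t. \<gamma> (t, s)) t \<in> tangent_carrier N" if "(t, s) \<in> S" for t s
  proof (rule velocity_in_tangent_bundle[OF N P, where I = "{t. (t, s) \<in> S}"])
    show "open {t' \<in> {t. (t, s) \<in> S}. \<gamma> (t', s) \<in> chart_dom N i}" if "i \<in> index N" for i
      using slice1[OF openA[OF that]] by (simp add: A_iff)
    show "(chart N i \<circ> (\<lambda>t. \<gamma> (t, s))) differentiable at t" if "i \<in> index N" "\<gamma> (t, s) \<in> chart_dom N i" for i
      using D1t[of i t s] that \<open>(t, s) \<in> S\<close>
      by (auto simp: A_iff o_def has_vector_derivative_def differentiable_def)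
  qed (use that \<gamma> slice1[OF openS] in auto)
  let ?TN = "tangent_bundle N"
  have 1: "vector_derivative (chart ?TN i \<circ> (\<lambda>t. velocity N (\<lambda>s. \<gamma> (t, s)) s)) (at t)
      = vpair (D1 i (t, s) (1, 0)) (D2 i (t, s))" if i: "i \<in> index N" "(t, s) \<in> A i" for i
  proof (rule vector_derivative_at, rule has_vector_derivative_transform_within_open)
    show "((\<lambda>t. vpair (chart N i (\<gamma> (t, s))) (D1 i (t, s) (0, 1)))
        has_vector_derivative vpair (D1 i (t, s) (1, 0)) (D2 i (t, s))) (at t)"
      by (rule has_vector_derivative_vpair[OF D1t[OF i] D2t[OF i]])
    show "open {t. (t, s) \<in> A i}" by (rule slice1[OF openA[OF i(1)]])
  qed (use i in \<open>auto simp: vs A_iff tangent_bundle_def\<close>)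
  have 2: "vector_derivative (chart ?TN i \<circ> (\<lambda>s. velocity N (\<lambda>t. \<gamma> (t, s)) t)) (at s)
      = vpair (D1 i (t, s) (0, 1)) (D2 i (t, s))" if i: "i \<in> index N" "(t, s) \<in> A i" for i
  proof (rule vector_derivative_at, rule has_vector_derivative_transform_within_open)
    show "((\<lambda>s. vpair (chart N i (\<gamma> (t, s))) (D1 i (t, s) (1, 0)))
        has_vector_derivative vpair (D1 i (t, s) (0, 1)) (D2 i (t, s))) (at s)"
      by (rule has_vector_derivative_vpair[OF D1s[OF i] D2s[OF i]])
    show "open {s. (t, s) \<in> A i}" by (rule slice2[OF openA[OF i(1)]])
  qed (use i in \<open>auto simp: vt A_iff tangent_bundle_def\<close>)
  have 3: "velocity ?TN (\<lambda>t. velocity N (\<lambda>s. \<gamma> (t, s)) s) t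
      = Tan (velocity N (\<lambda>s. \<gamma> (t, s)) s)
          (\<lambda>i. if i \<in> index N \<and> (t, s) \<in> A i then vpair (D1 i (t, s) (1, 0)) (D2 i (t, s)) else 0)"
    unfolding velocity_def[of ?TN]
    using cs[OF ts] ts 1 by (auto simp: tangent_bundle_def A_iff vs fun_eq_iff)
  have 4: "velocity ?TN (\<lambda>s. velocity N (\<lambda>t. \<gamma> (t, s)) t) s
      = Tan (velocity N (\<lambda>t. \<gamma> (t, s)) t)
          (\<lambda>i. if i \<in> index N \<and> (t, s) \<in> A i then vpair (D1 i (t, s) (0, 1)) (D2 i (t, s)) else 0)"
    unfolding velocity_def[of ?TN]
    using ct[OF ts] ts 2 by (auto simp: tangent_bundle_def A_iff vt fun_eq_iff)
  show ?thesis
    unfolding 3 4 vs[OF ts] vt[OF ts] by (auto simp: fun_eq_iff vfst_zero vsnd_zero vpair_zero)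
qed

definition kappa :: "nat \<Rightarrow> ('m, 'i, 'e::real_normed_vector seqs) tpoint \<Rightarrow> ('m, 'i, 'e seqs) tpoint"
  where "kappa r = (if r \<ge> 2 then flip else id)"

text \<open>The complete lift of a vector field \<open>A : T\<^sup>rM \<rightarrow> T\<^sup>r\<^sup>+\<^sup>1M\<close>.\<close>

definition complete_lift ::
    "('m, 'i, 'e::real_normed_vector) manifold \<Rightarrow> nat
       \<Rightarrow> (('m, 'i, 'e seqs) tpoint \<Rightarrow> ('m, 'i, 'e seqs) tpoint)
       \<Rightarrow> ('m, 'i, 'e seqs) tpoint \<Rightarrow> ('m, 'i, 'e seqs) tpoint" where
  "complete_lift M r A =
     tangent_map (iter_tangent M (r + 1)) (iter_tangent M (r + 1)) (kappa (r + 1))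
       \<circ> kappa (r + 2)
       \<circ> tangent_map (iter_tangent M r) (iter_tangent M (r + 1)) A
       \<circ> kappa (r + 1)"

text \<open>For \<open>X \<in> \<XX>(TM)\<close>, the \<open>j\<close>-th lift \<open>X\<^bsup>c\<^sub>j\<^esup>\<close> is a vector field on \<open>T\<^sup>j\<^sup>+\<^sup>1M\<close>.\<close>

primrec iter_lift ::
    "('m, 'i, 'e::real_normed_vector) manifold
       \<Rightarrow> (('m, 'i, 'e seqs) tpoint \<Rightarrow> ('m, 'i, 'e seqs) tpoint) \<Rightarrow> nat
       \<Rightarrow> ('m, 'i, 'e seqs) tpoint \<Rightarrow> ('m, 'i, 'e seqs) tpoint" where
  "iter_lift M X 0 = X"
| "iter_lift M X (Suc j) = complete_lift M (j + 1) (iter_lift M X j)"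

end

(*
  The map foot is the projection pi and flip the involution kappa. With these, pi o kappa = D pi and
  D pi o kappa = pi on second tangent bundles, so functoriality of D gives
    D^2 pi o D kappa o kappa o D A o kappa = D pi o kappa o D A o kappa = pi o D A o kappa
      = A o pi o kappa = A o D pi,
  which is (ii) for A = X^{c_i}, and (iii) follows by induction on j - i.

  The chain rule and the smoothness of D f, kappa and A^c are needed for all iterated tangent bundles.
  Smoothness of a local representative f is therefore tracked in the form "f, T f, T T f, ... are
  differentiable", where T f (x, y) = (f x, f'(x) y): this is stable under composition and under T.
  That kappa preserves the iterated tangent bundles is the symmetry of second derivatives.
*)
theory Submission
  imports Defs
begin

section \<open>Smoothness through iterated tangent lifts\<close>

text \<open>The model spaces are proper subspaces of one sequence space, and a derivative within
  such a subspace is determined only on vectors of the subspace; elsewhere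
  \<open>frechet_derivative\<close> makes some choice. Chart representatives are therefore extended
  to open subsets of the ambient space by precomposing with a linear retraction onto the model, and
  all calculus is done with the extensions. Such retractions are used for M and TM only: higher up,
  the tangent lift of an extension extends the tangent map. Smoothness is given as a tower of
  multilinear maps on lists; turning it into differentiability of all tangent lifts requires
  estimates that are uniform in the arguments not yet differentiated. Maps are total functions, so
  the identities for D hold on carriers only. An equality of tangent vectors is checked in a single
  chart, since the transition rule forces the other components.\<close>

lemma bounded_linear_vpair:
  fixes f g :: "'a::real_normed_vector \<Rightarrow> 'e::real_normed_vector seqs"
  assumes "bounded_linear f" "bounded_linear g"
  shows "bounded_linear (\<lambda>x. vpair (f x) (g x))"
proof -
  interpret f: bounded_linear f by fact
  interpret g: bounded_linear g by fact
  obtain K where K: "K > 0" "\<And>x. norm (f x) \<le> norm x * K" using f.pos_bounded by blast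
  obtain L where L: "L > 0" "\<And>x. norm (g x) \<le> norm x * L" using g.pos_bounded by blast
  show ?thesis
  proof (rule bounded_linear_intro[where K = "K + L"])
    show "norm (vpair (f x) (g x)) \<le> norm x * (K + L)" for x
    proof (rule norm_bound)
      fix n
      have "0 \<le> norm x * K" "0 \<le> norm x * L" using K L by auto
      then show "norm (vpair (f x) (g x) n) \<le> norm x * (K + L)"
        using norm_bounded[of "f x" "n div 2"] norm_bounded[of "g x" "n div 2"] K(2)[of x] L(2)[of x]
        unfolding apply_vpair distrib_left by (smt (verit))
    qed
  qed (auto intro!: bcontfun_eqI simp: apply_vpair f.add g.add f.scaleR g.scaleR)
qed

lemma bounded_linear_vfst: "bounded_linear (vfst :: 'e::real_normed_vector seqs \<Rightarrow> _)"
  and bounded_linear_vsnd: "bounded_linear (vsnd :: 'e::real_normed_vector seqs \<Rightarrow> _)"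
  by (rule bounded_linear_intro[where K = 1];
      auto intro!: bcontfun_eqI norm_bound simp: apply_vfst apply_vsnd norm_bounded simp del: One_nat_def add_Suc_right)+

lemma bounded_linear_vembed: "bounded_linear (vembed :: 'e::real_normed_vector \<Rightarrow> _)"
  by (rule bounded_linear_intro[where K = 1]; auto intro!: bcontfun_eqI norm_bound simp: apply_vembed)

lemma bounded_linear_eval: "bounded_linear (\<lambda>v :: 'e::real_normed_vector seqs. v n)"
  by (rule bounded_linear_intro[where K = 1]; auto simp: norm_bounded)

lemmas continuous_on_vfst = linear_continuous_on[OF bounded_linear_vfst]
  and continuous_on_vsnd = linear_continuous_on[OF bounded_linear_vsnd]

lemma vpair_eq_iff: "vpair a b = vpair c d \<longleftrightarrow> a = c \<and> b = d"
  by (metis vfst_vpair vsnd_vpair)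

lemma open_vimage_vfst: "open V \<Longrightarrow> open (vfst -` V)"
  by (intro open_vimage continuous_on_vfst)

section \<open>Iterated tangent lifts on open sets of the sequence space\<close>

definition tangent_lift :: "('e::real_normed_vector seqs \<Rightarrow> 'e seqs) \<Rightarrow> 'e seqs \<Rightarrow> 'e seqs" where
  "tangent_lift f z = vpair (f (vfst z)) (frechet_derivative f (at (vfst z)) (vsnd z))"

text \<open>The tangent lift of a self-map of the sequence space is again such a self-map, so all
  orders live in one type and recursion on \<open>n\<close> is possible, in contrast to spaces of
  \<open>n\<close>-linear maps. The new domain is \<open>V\<close> times the whole space, read
  through \<open>vpair\<close>.\<close>

primrec smooth_order ::
    "nat \<Rightarrow> 'e::real_normed_vector seqs set \<Rightarrow> ('e seqs \<Rightarrow> 'e seqs) \<Rightarrow> bool" where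
  "smooth_order 0 V f \<longleftrightarrow> open V"
| "smooth_order (Suc n) V f \<longleftrightarrow> open V \<and> (\<forall>x\<in>V. f differentiable (at x)) \<and>
     smooth_order n (vfst -` V) (tangent_lift f)"

definition lift_smooth :: "'e::real_normed_vector seqs set \<Rightarrow> ('e seqs \<Rightarrow> 'e seqs) \<Rightarrow> bool" where
  "lift_smooth V f \<longleftrightarrow> (\<forall>n. smooth_order n V f)"

lemma has_derivative_frechet:
  "f differentiable (at x) \<Longrightarrow> (f has_derivative frechet_derivative f (at x)) (at x)"
  using frechet_derivative_works by blast

lemma frechet_derivative_eq: "(f has_derivative f') (at x) \<Longrightarrow> frechet_derivative f (at x) = f'"
  using frechet_derivative_at by metis

lemma tangent_lift_eq:
  "(f has_derivative f') (at (vfst z)) \<Longrightarrow> tangent_lift f z = vpair (f (vfst z)) (f' (vsnd z))"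
  by (simp add: tangent_lift_def frechet_derivative_eq)

lemma vfst_tangent_lift [simp]: "vfst (tangent_lift f z) = f (vfst z)"
  by (simp add: tangent_lift_def)

lemma smooth_order_open: "smooth_order n V f \<Longrightarrow> open V"
  by (cases n) auto

text \<open>A derivative at \<open>x\<close> depends only on the germ at \<open>x\<close>, and
  \<open>V\<close> is open; so agreement on \<open>V\<close> passes to the tangent lifts and the
  induction continues with the lifted maps.\<close>

lemma smooth_order_cong:
  assumes "smooth_order n V f" "\<And>x. x \<in> V \<Longrightarrow> f x = g x"
  shows "smooth_order n V g"
  using assms
proof (induction n arbitrary: V f g)
  case (Suc n)
  have V: "open V" using Suc.prems by simp
  have d: "(g has_derivative frechet_derivative f (at x)) (at x)" if "x \<in> V" for x
    by (rule has_derivative_transform_within_open[OF has_derivative_frechet V that])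
       (use Suc.prems that in auto)
  have "smooth_order n (vfst -` V) (tangent_lift g)"
  proof (rule Suc.IH)
    show "smooth_order n (vfst -` V) (tangent_lift f)" using Suc.prems by simp
    show "tangent_lift f z = tangent_lift g z" if "z \<in> vfst -` V" for z
    proof -
      have z: "vfst z \<in> V" using that by simp
      show ?thesis
        unfolding tangent_lift_eq[OF d[OF z]] unfolding tangent_lift_def Suc.prems(2)[OF z] ..
    qed
  qed
  then show ?case using V d by (auto simp: differentiable_def)
qed simp

lemma smooth_order_subset:
  assumes "smooth_order n V f" "open W" "W \<subseteq> V"
  shows "smooth_order n W f"
  using assms
proof (induction n arbitrary: V W f)
  case (Suc n)
  have "smooth_order n (vfst -` W) (tangent_lift f)"
    by (rule Suc.IH[of "vfst -` V"]) (use Suc.prems in \<open>auto simp: open_vimage_vfst\<close>)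
  then show ?case using Suc.prems by auto
qed simp

text \<open>The tangent lift of a linear map acts by that map on both halves and is linear again, so
  the induction stays among linear maps.\<close>

lemma smooth_order_linear:
  assumes "bounded_linear L" "open V"
  shows "smooth_order n V L"
  using assms
proof (induction n arbitrary: L V)
  case (Suc n)
  have d: "(L has_derivative L) (at x)" for x by (rule bounded_linear_imp_has_derivative[OF Suc.prems(1)])
  have eq: "tangent_lift L = (\<lambda>z. vpair (L (vfst z)) (L (vsnd z)))" by (simp add: fun_eq_iff tangent_lift_eq[OF d])
  have "smooth_order n (vfst -` V) (tangent_lift L)"
    unfolding eq
    by (intro Suc.IH bounded_linear_vpair open_vimage_vfst Suc.prems
        bounded_linear_compose[OF Suc.prems(1)] bounded_linear_vfst bounded_linear_vsnd)
  then show ?case using d Suc.prems by (auto simp: differentiable_def)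
qed simp

text \<open>Functoriality of the tangent lift, T(g o f) = Tg o Tf, reduces every order to the
  first-order chain rule; no formula for higher derivatives of a composition occurs.\<close>

lemma smooth_order_compose:
  assumes "smooth_order n V f" "smooth_order n W g" "\<And>x. x \<in> V \<Longrightarrow> f x \<in> W"
  shows "smooth_order n V (\<lambda>x. g (f x))"
  using assms
proof (induction n arbitrary: V W f g)
  case (Suc n)
  have d: "((\<lambda>x. g (f x)) has_derivative (\<lambda>h. frechet_derivative g (at (f x)) (frechet_derivative f (at x) h))) (at x)"
    if "x \<in> V" for x
    by (rule has_derivative_compose) (use Suc.prems that in \<open>auto intro: has_derivative_frechet\<close>)
  have "smooth_order n (vfst -` V) (tangent_lift (\<lambda>x. g (f x)))"
  proof (rule smooth_order_cong)
    show "smooth_order n (vfst -` V) (\<lambda>z. tangent_lift g (tangent_lift f z))"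
      by (rule Suc.IH[where W = "vfst -` W" and f = "tangent_lift f" and g = "tangent_lift g"])
         (use Suc.prems in auto)
    show "tangent_lift g (tangent_lift f z) = tangent_lift (\<lambda>x. g (f x)) z" if "z \<in> vfst -` V" for z
      using that by (simp add: tangent_lift_eq[OF d]) (simp add: tangent_lift_def)
  qed
  then show ?case using d Suc.prems by (auto simp: differentiable_def)
qed simp

lemma has_derivative_vpair:
  fixes f g :: "'a::real_normed_vector \<Rightarrow> 'e::real_normed_vector seqs"
  assumes "(f has_derivative f') (at x)" "(g has_derivative g') (at x)"
  shows "((\<lambda>x. vpair (f x) (g x)) has_derivative (\<lambda>h. vpair (f' h) (g' h))) (at x)"
proof -
  have "bounded_linear (\<lambda>p :: 'e seqs \<times> 'e seqs. vpair (fst p) (snd p))"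
    by (intro bounded_linear_vpair bounded_linear_fst bounded_linear_snd)
  from bounded_linear.has_derivative[OF this has_derivative_Pair[OF assms]] show ?thesis by simp
qed

text \<open>The canonical involution in coordinates: with \<open>z\<close> read as (x, y, X, Y), the
  two middle entries are exchanged.\<close>

definition vflip :: "'e::real_normed_vector seqs \<Rightarrow> 'e seqs" where
  "vflip z = vpair (vpair (vfst (vfst z)) (vfst (vsnd z))) (vpair (vsnd (vfst z)) (vsnd (vsnd z)))"

lemma bounded_linear_vflip: "bounded_linear vflip"
  unfolding vflip_def
  by (intro bounded_linear_vpair bounded_linear_compose[OF bounded_linear_vfst]
      bounded_linear_compose[OF bounded_linear_vsnd] bounded_linear_vfst bounded_linear_vsnd)

text \<open>The pair of lifts is ((f, f'), (g, g')), whereas the lift of the pair is ((f, g), (f',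
  g')). The linear map \<open>vflip\<close> carries the first to the second, which closes the
  induction.\<close>

lemma smooth_order_vpair:
  assumes "smooth_order n V f" "smooth_order n V g"
  shows "smooth_order n V (\<lambda>x. vpair (f x) (g x))"
  using assms
proof (induction n arbitrary: V f g)
  case (Suc n)
  have d: "((\<lambda>x. vpair (f x) (g x)) has_derivative
      (\<lambda>h. vpair (frechet_derivative f (at x) h) (frechet_derivative g (at x) h))) (at x)"
    if "x \<in> V" for x
    by (rule has_derivative_vpair) (use Suc.prems that in \<open>auto intro: has_derivative_frechet\<close>)
  have "smooth_order n (vfst -` V) (tangent_lift (\<lambda>x. vpair (f x) (g x)))"
  proof (rule smooth_order_cong)
    show "smooth_order n (vfst -` V) (\<lambda>z. vflip (vpair (tangent_lift f z) (tangent_lift g z)))"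
      by (rule smooth_order_compose[OF _ smooth_order_linear[OF bounded_linear_vflip open_UNIV]])
         (use Suc in auto)
    show "vflip (vpair (tangent_lift f z) (tangent_lift g z)) = tangent_lift (\<lambda>x. vpair (f x) (g x)) z"
      if "z \<in> vfst -` V" for z
      using that by (simp add: tangent_lift_eq[OF d]) (simp add: tangent_lift_def vflip_def)
  qed
  then show ?case using d Suc.prems by (auto simp: differentiable_def)
qed simp

lemma smooth_order_add:
  assumes "smooth_order n V f" "smooth_order n V g"
  shows "smooth_order n V (\<lambda>x. f x + g x)"
proof -
  have "smooth_order n V (\<lambda>x. vfst (vpair (f x) (g x)) + vsnd (vpair (f x) (g x)))"
    by (rule smooth_order_compose[OF smooth_order_vpair[OF assms] smooth_order_linear[OF _ open_UNIV]])
       (auto intro: bounded_linear_add bounded_linear_vfst bounded_linear_vsnd)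
  then show ?thesis by simp
qed

lemma smooth_order_sum:
  assumes "open V" "\<And>k. k \<in> K \<Longrightarrow> smooth_order n V (f k)"
  shows "smooth_order n V (\<lambda>x. \<Sum>k\<in>K. f k x)"
  using assms(2)
proof (induction K rule: infinite_finite_induct)
  case (insert k K)
  then show ?case by (simp add: smooth_order_add)
qed (auto intro: smooth_order_linear assms(1) bounded_linear_zero)

lemma lift_smoothD:
  assumes "lift_smooth V f"
  shows "open V" "x \<in> V \<Longrightarrow> f differentiable (at x)" "lift_smooth (vfst -` V) (tangent_lift f)"
proof -
  have "smooth_order (Suc n) V f" for n using assms unfolding lift_smooth_def by blast
  then show "open V" "x \<in> V \<Longrightarrow> f differentiable (at x)" "lift_smooth (vfst -` V) (tangent_lift f)"
    by (auto simp: lift_smooth_def)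
qed

lemma lift_smooth_has_derivative:
  "lift_smooth V f \<Longrightarrow> x \<in> V \<Longrightarrow> (f has_derivative frechet_derivative f (at x)) (at x)"
  by (intro has_derivative_frechet lift_smoothD)

lemma lift_smooth_continuous_on: "lift_smooth V f \<Longrightarrow> continuous_on V f"
  by (meson continuous_at_imp_continuous_on differentiable_imp_continuous_within lift_smoothD(2))

lemma lift_smooth_subset: "lift_smooth V f \<Longrightarrow> open W \<Longrightarrow> W \<subseteq> V \<Longrightarrow> lift_smooth W f"
  unfolding lift_smooth_def using smooth_order_subset by blast

lemma lift_smooth_linear: "bounded_linear L \<Longrightarrow> open V \<Longrightarrow> lift_smooth V L"
  unfolding lift_smooth_def using smooth_order_linear by blast

text \<open>First-order differentiability gives continuity of \<open>f\<close>, so the set on which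
  the composition is formed is open.\<close>

lemma lift_smooth_compose:
  assumes f: "lift_smooth V f" and g: "lift_smooth W g"
  shows "lift_smooth (V \<inter> f -` W) (\<lambda>x. g (f x))"
proof -
  have "open (V \<inter> f -` W)"
    using continuous_open_preimage[OF lift_smooth_continuous_on[OF f]] lift_smoothD(1) f g by blast
  then have "lift_smooth (V \<inter> f -` W) f" by (intro lift_smooth_subset[OF f]) auto
  then show ?thesis using g smooth_order_compose[of _ "V \<inter> f -` W" f W g]
    unfolding lift_smooth_def by blast
qed

section \<open>From towers of multilinear derivatives to tangent lifts\<close>

locale derivative_tower =
  fixes F U :: "'a::real_normed_vector set" and D :: "nat \<Rightarrow> 'a \<Rightarrow> 'a list \<Rightarrow> 'b::real_normed_vector"
  assumes subspace: "subspace F" and openin: "openin (top_of_set F) U"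
    and multilinear: "\<And>n x. x \<in> U \<Longrightarrow> bounded_multilinear_on F n (D n x)"
    and derivative: "\<And>n x e. x \<in> U \<Longrightarrow> e > 0 \<Longrightarrow> \<forall>\<^sub>F y in at x within U.
           \<forall>vs. length vs = n \<longrightarrow> set vs \<subseteq> F \<longrightarrow>
             norm (D n y vs - D n x vs - D (Suc n) x ((y - x) # vs))
               \<le> e * norm (y - x) * prod_list (map norm vs)"
begin

lemma zero_mem: "0 \<in> F"
  using subspace by (rule subspace_0)

lemma multilinear_step:
  assumes "x \<in> U" "length vs + length ws + 1 = n" "set vs \<subseteq> F" "set ws \<subseteq> F" "a \<in> F" "b \<in> F"
  shows "D n x (vs @ (a + c *\<^sub>R b) # ws) = D n x (vs @ a # ws) + c *\<^sub>R D n x (vs @ b # ws)"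
proof -
  have "set (vs @ 0 # ws) \<subseteq> F" "length (vs @ 0 # ws) = n" "length vs < n"
    using assms zero_mem by auto
  with multilinear[OF assms(1), of n, unfolded bounded_multilinear_on_def, THEN conjunct1,
      rule_format, of "vs @ 0 # ws" "length vs" a b c]
  show ?thesis using assms by simp
qed

lemma bounded:
  assumes "x \<in> U"
  obtains K where "K > 0" "\<And>vs. length vs = n \<Longrightarrow> set vs \<subseteq> F \<Longrightarrow> norm (D n x vs) \<le> K * prod_list (map norm vs)"
proof -
  obtain K where K: "\<And>vs. length vs = n \<Longrightarrow> set vs \<subseteq> F \<Longrightarrow> norm (D n x vs) \<le> K * prod_list (map norm vs)"
    using multilinear[OF assms, of n] unfolding bounded_multilinear_on_def by blast
  have "norm (D n x vs) \<le> (\<bar>K\<bar> + 1) * prod_list (map norm vs)" if "length vs = n" "set vs \<subseteq> F" for vs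
  proof -
    have "0 \<le> prod_list (map norm vs)" by (rule prod_list_nonneg) auto
    then have "K * prod_list (map norm vs) \<le> (\<bar>K\<bar> + 1) * prod_list (map norm vs)"
      by (intro mult_right_mono) auto
    with K[OF that] show ?thesis by linarith
  qed
  then show thesis by (intro that[of "\<bar>K\<bar> + 1"]) auto
qed

lemma zero_slot:
  assumes "x \<in> U" "length vs + length ws + 1 = n" "set vs \<subseteq> F" "set ws \<subseteq> F"
  shows "D n x (vs @ 0 # ws) = 0"
  using multilinear_step[OF assms zero_mem zero_mem, of 1] by simp

lemma add_slot:
  assumes "x \<in> U" "length vs + length ws + 1 = n" "set vs \<subseteq> F" "set ws \<subseteq> F" "a \<in> F" "b \<in> F"
  shows "D n x (vs @ (a + b) # ws) = D n x (vs @ a # ws) + D n x (vs @ b # ws)"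
  using multilinear_step[OF assms, of 1] by simp

lemma bounded_linear_slot:
  assumes x: "x \<in> U" and len: "length vs + length ws + 1 = n" and vs: "set vs \<subseteq> F" and ws: "set ws \<subseteq> F"
    and Q: "bounded_linear Q" "range Q \<subseteq> F"
  shows "bounded_linear (\<lambda>h. D n x (vs @ Q h # ws))"
proof -
  interpret Q: bounded_linear Q by fact
  note slot = x len vs ws
  have QF: "Q h \<in> F" for h using Q(2) by auto
  obtain K where K: "K > 0" "\<And>vs. length vs = n \<Longrightarrow> set vs \<subseteq> F \<Longrightarrow> norm (D n x vs) \<le> K * prod_list (map norm vs)"
    using bounded[OF x] by blast
  obtain C where C: "C > 0" "\<And>h. norm (Q h) \<le> norm h * C" using Q.pos_bounded by blast
  define p where "p = K * prod_list (map norm vs) * prod_list (map norm ws)"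
  have p: "p \<ge> 0" unfolding p_def using K(1) by (intro mult_nonneg_nonneg prod_list_nonneg) auto
  show ?thesis
  proof (rule bounded_linear_intro[where K = "p * C"])
    show "D n x (vs @ Q (a + b) # ws) = D n x (vs @ Q a # ws) + D n x (vs @ Q b # ws)" for a b
      using add_slot[OF slot QF QF, of a b] by (simp add: Q.add)
    show "D n x (vs @ Q (r *\<^sub>R a) # ws) = r *\<^sub>R D n x (vs @ Q a # ws)" for r a
      using multilinear_step[OF slot zero_mem QF, of r a] zero_slot[OF slot] by (simp add: Q.scaleR)
    show "norm (D n x (vs @ Q a # ws)) \<le> norm a * (p * C)" for a
    proof -
      have "norm (D n x (vs @ Q a # ws)) \<le> K * prod_list (map norm (vs @ Q a # ws))"
        by (rule K(2)) (use len vs ws QF in auto)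
      also have "\<dots> = p * norm (Q a)" by (simp add: p_def algebra_simps)
      also have "\<dots> \<le> p * (norm a * C)" by (intro mult_left_mono C p)
      finally show ?thesis by (simp add: algebra_simps)
    qed
  qed
qed

lemma bounded_linear_update:
  assumes "x \<in> U" "length vs = n" "set vs \<subseteq> F" "k < n" "bounded_linear Q" "range Q \<subseteq> F"
  shows "bounded_linear (\<lambda>h. D n x (vs[k := Q h]))"
proof -
  have "bounded_linear (\<lambda>h. D n x (take k vs @ Q h # drop (Suc k) vs))"
    by (rule bounded_linear_slot) (use assms in \<open>auto dest: in_set_takeD in_set_dropD\<close>)
  then show ?thesis using assms by (simp add: upd_conv_take_nth_drop)
qed

text \<open>The map \<open>P\<close> may identify points, so \<open>P y = P z\<close> can occur with
  \<open>y\<close> arbitrarily close to but different from \<open>z\<close>. The punctured estimate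
  of the tower is therefore extended to the centre, where it holds because the increment in the
  first slot is zero.\<close>

lemma derivative_nhds:
  assumes P: "bounded_linear P" "range P \<subseteq> F" and z: "P z \<in> U" and e: "e > 0"
  shows "\<forall>\<^sub>F y in nhds z. \<forall>vs. length vs = n \<longrightarrow> set vs \<subseteq> F \<longrightarrow>
           norm (D n (P y) vs - D n (P z) vs - D (Suc n) (P z) (P (y - z) # vs))
             \<le> e * norm (P (y - z)) * prod_list (map norm vs)"
proof -
  have lim: "filterlim P (nhds (P z)) (nhds z)"
    using linear_continuous_at[OF P(1), of z] isCont_def tendsto_at_iff_tendsto_nhds by blast
  obtain T where T: "open T" "U = F \<inter> T" using openin by (auto simp: openin_open)
  have "\<forall>\<^sub>F u in nhds (P z). u \<noteq> P z \<longrightarrow> u \<in> U \<longrightarrow> (\<forall>vs. length vs = n \<longrightarrow> set vs \<subseteq> F \<longrightarrow>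
           norm (D n u vs - D n (P z) vs - D (Suc n) (P z) ((u - P z) # vs))
             \<le> e * norm (u - P z) * prod_list (map norm vs))"
    using derivative[OF z e, of n] unfolding eventually_at_filter .
  moreover have "\<forall>\<^sub>F u in nhds (P z). u \<in> T"
    using T z by (intro eventually_nhds_in_open) auto
  ultimately have "\<forall>\<^sub>F u in nhds (P z). u \<in> F \<longrightarrow> (\<forall>vs. length vs = n \<longrightarrow> set vs \<subseteq> F \<longrightarrow>
           norm (D n u vs - D n (P z) vs - D (Suc n) (P z) ((u - P z) # vs))
             \<le> e * norm (u - P z) * prod_list (map norm vs))"
  proof eventually_elim
    case (elim u)
    have "D (Suc n) (P z) (0 # vs) = 0" if "length vs = n" "set vs \<subseteq> F" for vs
      using zero_slot[OF z, of "[]" vs] that by simp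
    then show ?case using elim T by (cases "u = P z") auto
  qed
  from eventually_compose_filterlim[OF this lim] show ?thesis
    by eventually_elim (use P in \<open>auto simp: linear_diff bounded_linear.linear\<close>)
qed

text \<open>One constant serves all splittings of the \<open>N\<close> free arguments around the
  distinguished slot. It collects the bound of \<open>D n x\<close>, the bound of \<open>Q\<close>
  and the norms of the fixed tail \<open>ys\<close>; the summand 1 in \<open>C\<close> makes it
  positive.\<close>

lemma norm_slot_le:
  assumes z: "x \<in> U" and Qs: "set ys \<subseteq> F" and n: "n = N + Suc (length ys)"
    and Q: "bounded_linear Q" "range Q \<subseteq> F"
  obtains C where "C > 0" "\<And>h vs ws. length vs + length ws = N \<Longrightarrow> set vs \<subseteq> F \<Longrightarrow> set ws \<subseteq> F \<Longrightarrow>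
      norm (D n x (vs @ Q h # ws @ ys)) \<le> C * norm h * prod_list (map norm (vs @ ws))"
proof -
  interpret Q: bounded_linear Q by fact
  obtain B where B: "B > 0" "\<And>h. norm (Q h) \<le> norm h * B" using Q.pos_bounded by blast
  obtain K where K: "K > 0" "\<And>vs. length vs = n \<Longrightarrow> set vs \<subseteq> F \<Longrightarrow> norm (D n x vs) \<le> K * prod_list (map norm vs)"
    using bounded[OF z] by blast
  have nonneg: "0 \<le> prod_list (map norm vs)" for vs :: "'a list" by (rule prod_list_nonneg) auto
  define C where "C = K * (B * prod_list (map norm ys)) + 1"
  have C: "C > 0" using K B nonneg by (simp add: C_def add_nonneg_pos)
  have "norm (D n x (vs @ Q h # ws @ ys)) \<le> C * norm h * prod_list (map norm (vs @ ws))"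
    if "length vs + length ws = N" "set vs \<subseteq> F" "set ws \<subseteq> F" for h vs ws
  proof -
    let ?p = "prod_list (map norm (vs @ ws))"
    have "norm (D n x (vs @ Q h # ws @ ys)) \<le> K * prod_list (map norm (vs @ Q h # ws @ ys))"
      by (rule K(2)) (use that n Qs Q in auto)
    also have "\<dots> = (K * ?p * prod_list (map norm ys)) * norm (Q h)"
      by (simp add: algebra_simps)
    also have "\<dots> \<le> (K * ?p * prod_list (map norm ys)) * (norm h * B)"
      using K nonneg by (intro mult_left_mono B mult_nonneg_nonneg) auto
    also have "\<dots> = (C - 1) * (norm h * ?p)" by (simp add: C_def algebra_simps)
    also have "\<dots> \<le> C * (norm h * ?p)" using nonneg by (intro mult_right_mono mult_nonneg_nonneg) auto
    finally show ?thesis by (simp add: algebra_simps)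
  qed
  with C show thesis by (rule that)
qed

lemma eventually_mult_norm_le:
  fixes z :: "'c::real_normed_vector"
  assumes "C > 0" "e > 0"
  shows "\<forall>\<^sub>F y in nhds z. C * norm (y - z) \<le> e"
proof -
  have "\<forall>\<^sub>F y in nhds z. dist y z < e / C"
    using assms by (auto simp: eventually_nhds_metric intro!: exI[of _ "e / C"])
  then show ?thesis
    by eventually_elim (use assms in \<open>simp add: dist_norm field_simps\<close>)
qed

lemma eventually_norm_le:
  assumes "bounded_linear Q"
  shows "\<forall>\<^sub>F y in nhds z. norm (Q y) \<le> norm (Q z) + 1"
proof -
  interpret Q: bounded_linear Q by fact
  obtain B where B: "B > 0" "\<And>h. norm (Q h) \<le> norm h * B" using Q.pos_bounded by blast
  from eventually_mult_norm_le[OF B(1) zero_less_one, of z] show ?thesis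
  proof eventually_elim
    case (elim y)
    have "norm (Q (y - z)) \<le> 1" using B(2)[of "y - z"] elim by (simp add: mult.commute)
    then show ?case using norm_triangle_ineq2[of "Q y" "Q z"] by (simp add: Q.diff)
  qed
qed

text \<open>Uniformity in \<open>vs\<close> carries the induction on \<open>Qs\<close>: the value of
  the head is appended to \<open>vs\<close> and becomes one more free argument for the shorter list.
  The remaining error changes only the head slot, at the fixed point \<open>P z\<close>, and is
  small by boundedness in that slot.\<close>

lemma continuous_slots:
  assumes P: "bounded_linear P" "range P \<subseteq> F" and z: "P z \<in> U"
    and Qs: "\<forall>Q\<in>set Qs. bounded_linear Q \<and> range Q \<subseteq> F" and e: "e > 0" and m: "m = N + length Qs"
  shows "\<forall>\<^sub>F y in nhds z. \<forall>vs. length vs = N \<longrightarrow> set vs \<subseteq> F \<longrightarrow>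
           norm (D m (P y) (vs @ map (\<lambda>Q. Q y) Qs) - D m (P z) (vs @ map (\<lambda>Q. Q z) Qs))
             \<le> e * prod_list (map norm vs)"
  using Qs e m
proof (induction Qs arbitrary: N e)
  case Nil
  have nonneg: "0 \<le> prod_list (map norm vs)" for vs :: "'a list" by (rule prod_list_nonneg) auto
  obtain B where B: "B > 0" "\<And>h. norm (P h) \<le> norm h * B" using bounded_linear.pos_bounded[OF P(1)] by blast
  obtain C where C: "C > 0" "\<And>h vs ws. length vs + length ws = m \<Longrightarrow> set vs \<subseteq> F \<Longrightarrow> set ws \<subseteq> F \<Longrightarrow>
      norm (D (Suc m) (P z) (vs @ P h # ws @ [])) \<le> C * norm h * prod_list (map norm (vs @ ws))"
    by (rule norm_slot_le[OF z _ _ P, of "[]" "Suc m" m]) auto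
  have "B + C > 0" using B C by simp
  from eventually_mult_norm_le[OF this Nil.prems(2), of z] derivative_nhds[OF P z zero_less_one, of m]
  show ?case
  proof eventually_elim
    case (elim y)
    show ?case
    proof (intro allI impI)
      fix vs :: "'a list" assume vs: "length vs = N" "set vs \<subseteq> F"
      let ?p = "prod_list (map norm vs)" and ?L = "D (Suc m) (P z) (P (y - z) # vs)"
      have "norm (D m (P y) vs - D m (P z) vs) \<le> norm (D m (P y) vs - D m (P z) vs - ?L) + norm ?L"
        using norm_triangle_ineq[of "D m (P y) vs - D m (P z) vs - ?L" ?L] by simp
      also have "\<dots> \<le> norm (P (y - z)) * ?p + C * norm (y - z) * ?p"
        using elim(2) C(2)[of "[]" vs "y - z"] vs Nil.prems(3) by (intro add_mono) auto
      also have "\<dots> \<le> norm (y - z) * B * ?p + C * norm (y - z) * ?p"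
        by (intro add_mono mult_right_mono B nonneg) auto
      also have "\<dots> = ((B + C) * norm (y - z)) * ?p" by (simp add: algebra_simps)
      also have "\<dots> \<le> e * ?p" by (intro mult_right_mono elim nonneg)
      finally show "norm (D m (P y) (vs @ map (\<lambda>Q. Q y) []) - D m (P z) (vs @ map (\<lambda>Q. Q z) [])) \<le> e * ?p"
        by simp
    qed
  qed
next
  case (Cons Q Qs)
  have nonneg: "0 \<le> prod_list (map norm vs)" for vs :: "'a list" by (rule prod_list_nonneg) auto
  have Q: "bounded_linear Q" "range Q \<subseteq> F" and Qs: "\<forall>Q\<in>set Qs. bounded_linear Q \<and> range Q \<subseteq> F"
    using Cons.prems(1) by auto
  let ?q = "\<lambda>y. map (\<lambda>Q. Q y) Qs"
  have qF: "set (?q y) \<subseteq> F" for y using Qs by auto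
  obtain C where C: "C > 0" "\<And>h vs ws. length vs + length ws = N \<Longrightarrow> set vs \<subseteq> F \<Longrightarrow> set ws \<subseteq> F \<Longrightarrow>
      norm (D m (P z) (vs @ Q h # ws @ ?q z)) \<le> C * norm h * prod_list (map norm (vs @ ws))"
    by (rule norm_slot_le[OF z qF _ Q, of m N z]) (use Cons.prems(3) in auto)
  \<comment> \<open>Near \<open>z\<close> the norm of \<open>Q y\<close> is at most
    \<open>c / 2\<close>, so tolerance \<open>e / c\<close> in the induction hypothesis contributes
    at most half of \<open>e\<close>; the other half bounds the change in the head slot.\<close>
  define c where "c = 2 * (norm (Q z) + 1)"
  have c: "c > 0" by (simp add: c_def add_nonneg_pos)
  have "e / c > 0" "e / 2 > 0" "m = (N + 1) + length Qs" using Cons.prems c by auto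
  from Cons.IH[OF Qs this(1,3)] eventually_mult_norm_le[OF C(1) this(2), of z] eventually_norm_le[OF Q(1), of z]
  show ?case
  proof eventually_elim
    case (elim y)
    show ?case
    proof (intro allI impI)
      fix vs :: "'a list" assume vs: "length vs = N" "set vs \<subseteq> F"
      let ?p = "prod_list (map norm vs)"
      have QF: "Q h \<in> F" for h using Q by auto
      have Qy: "Q y = Q z + Q (y - z)" by (simp add: linear_diff[OF bounded_linear.linear[OF Q(1)]])
      have split: "D m (P z) (vs @ Q y # ?q z) = D m (P z) (vs @ Q z # ?q z) + D m (P z) (vs @ Q (y - z) # ?q z)"
        unfolding Qy by (rule add_slot) (use z vs qF QF Cons.prems(3) in auto)
      have "norm (D m (P y) (vs @ Q y # ?q y) - D m (P z) (vs @ Q z # ?q z))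
          \<le> norm (D m (P y) (vs @ Q y # ?q y) - D m (P z) (vs @ Q y # ?q z)) + norm (D m (P z) (vs @ Q (y - z) # ?q z))"
        using norm_triangle_ineq[of "D m (P y) (vs @ Q y # ?q y) - D m (P z) (vs @ Q y # ?q z)" "D m (P z) (vs @ Q (y - z) # ?q z)"]
        unfolding split by (simp add: algebra_simps)
      also have "\<dots> \<le> e / c * (?p * norm (Q y)) + C * norm (y - z) * ?p"
        using elim(1)[rule_format, of "vs @ [Q y]"] C(2)[of vs "[]" "y - z"] vs QF by (intro add_mono) auto
      also have "\<dots> \<le> e / c * (?p * (c / 2)) + e / 2 * ?p"
        using elim Cons.prems(2) c by (intro add_mono mult_left_mono mult_right_mono nonneg) (auto simp: c_def)
      also have "\<dots> = e * ?p" using c by (simp add: field_simps)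
      finally show "norm (D m (P y) (vs @ map (\<lambda>Q. Q y) (Q # Qs)) - D m (P z) (vs @ map (\<lambda>Q. Q z) (Q # Qs))) \<le> e * ?p"
        by simp
    qed
  qed
qed

text \<open>The product rule for a multilinear form whose base point and arguments depend linearly
  on \<open>y\<close>: one term differentiates the form, the sum differentiates its arguments one at
  a time. The free arguments with a uniform error are there for the induction on
  \<open>Qs\<close>.\<close>

lemma derivative_slots:
  assumes P: "bounded_linear P" "range P \<subseteq> F" and z: "P z \<in> U"
    and Qs: "\<forall>Q\<in>set Qs. bounded_linear Q \<and> range Q \<subseteq> F" and e: "e > 0" and m: "m = N + length Qs"
  shows "\<forall>\<^sub>F y in nhds z. \<forall>vs. length vs = N \<longrightarrow> set vs \<subseteq> F \<longrightarrow>
           norm (D m (P y) (vs @ map (\<lambda>Q. Q y) Qs) - D m (P z) (vs @ map (\<lambda>Q. Q z) Qs)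
             - (D (Suc m) (P z) (P (y - z) # vs @ map (\<lambda>Q. Q z) Qs)
               + (\<Sum>k<length Qs. D m (P z) (vs @ (map (\<lambda>Q. Q z) Qs)[k := (Qs ! k) (y - z)]))))
             \<le> e * norm (y - z) * prod_list (map norm vs)"
  using Qs e m
proof (induction Qs arbitrary: N e)
  case Nil
  have nonneg: "0 \<le> prod_list (map norm vs)" for vs :: "'a list" by (rule prod_list_nonneg) auto
  obtain B where B: "B > 0" "\<And>h. norm (P h) \<le> norm h * B" using bounded_linear.pos_bounded[OF P(1)] by blast
  have "e / B > 0" using B Nil.prems by simp
  from derivative_nhds[OF P z this, of m] show ?case
  proof eventually_elim
    case (elim y)
    show ?case
    proof (intro allI impI)
      fix vs :: "'a list" assume vs: "length vs = N" "set vs \<subseteq> F"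
      have "norm (D m (P y) vs - D m (P z) vs - D (Suc m) (P z) (P (y - z) # vs))
          \<le> e / B * norm (P (y - z)) * prod_list (map norm vs)"
        using elim vs Nil.prems by simp
      also have "\<dots> \<le> e / B * (norm (y - z) * B) * prod_list (map norm vs)"
        using Nil.prems B by (intro mult_right_mono mult_left_mono B nonneg) auto
      finally show "norm (D m (P y) (vs @ map (\<lambda>Q. Q y) []) - D m (P z) (vs @ map (\<lambda>Q. Q z) [])
             - (D (Suc m) (P z) (P (y - z) # vs @ map (\<lambda>Q. Q z) [])
               + (\<Sum>k<length []. D m (P z) (vs @ (map (\<lambda>Q. Q z) [])[k := ([] ! k) (y - z)]))))
             \<le> e * norm (y - z) * prod_list (map norm vs)"
        using B by simp
    qed
  qed
next
  case (Cons Q Qs)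
  have nonneg: "0 \<le> prod_list (map norm vs)" for vs :: "'a list" by (rule prod_list_nonneg) auto
  have Q: "bounded_linear Q" "range Q \<subseteq> F" and Qs: "\<forall>Q\<in>set Qs. bounded_linear Q \<and> range Q \<subseteq> F"
    using Cons.prems(1) by auto
  let ?q = "\<lambda>y. map (\<lambda>Q. Q y) Qs"
  have qF: "set (?q y) \<subseteq> F" for y using Qs by auto
  obtain B where B: "B > 0" "\<And>h. norm (Q h) \<le> norm h * B" using bounded_linear.pos_bounded[OF Q(1)] by blast
  define c where "c = 2 * (norm (Q z) + 1)"
  have c: "c > 0" by (simp add: c_def add_nonneg_pos)
  have ec: "e / c > 0" and eB: "e / (2 * B) > 0" and mN: "m = (N + 1) + length Qs" using Cons.prems c B by auto
  have lim: "filterlim P (nhds (P z)) (nhds z)"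
    using linear_continuous_at[OF P(1), of z] isCont_def tendsto_at_iff_tendsto_nhds by blast
  obtain T where T: "open T" "U = F \<inter> T" using openin by (auto simp: openin_open)
  have "\<forall>\<^sub>F u in nhds (P z). u \<in> T"
    using T z by (intro eventually_nhds_in_open) auto
  from Cons.IH[OF Qs ec mN] continuous_slots[OF P z Qs eB mN] eventually_compose_filterlim[OF this lim]
  show ?case
  proof eventually_elim
    case (elim y)
    have Py: "P y \<in> U" using elim(3) T P by auto
    show ?case
    proof (intro allI impI)
      fix vs :: "'a list" assume vs: "length vs = N" "set vs \<subseteq> F"
      let ?p = "prod_list (map norm vs)" and ?h = "y - z"
      let ?S = "\<Sum>k<length Qs. D m (P z) (vs @ Q z # (?q z)[k := (Qs ! k) ?h])"
      have QF: "Q h \<in> F" for h using Q by auto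
      have Qy: "Q y = Q z + Q ?h" by (simp add: linear_diff[OF bounded_linear.linear[OF Q(1)]])
      have split: "D m (P y) (vs @ Q y # ?q y) = D m (P y) (vs @ Q z # ?q y) + D m (P y) (vs @ Q ?h # ?q y)"
        unfolding Qy by (rule add_slot) (use Py vs qF QF Cons.prems(3) in auto)
      have sum: "(\<Sum>k<length (Q # Qs). D m (P z) (vs @ (map (\<lambda>Q. Q z) (Q # Qs))[k := ((Q # Qs) ! k) ?h]))
          = D m (P z) (vs @ Q ?h # ?q z) + ?S"
        by (simp add: sum.lessThan_Suc_shift del: sum.lessThan_Suc)
      \<comment> \<open>With \<open>Q z\<close> frozen, the first bracket is the induction
        hypothesis. The second contains the increment of \<open>Q\<close>, already of first order,
        so continuity of the other slots makes it of smaller order.\<close>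
      have "D m (P y) (vs @ Q y # ?q y) - D m (P z) (vs @ Q z # ?q z)
            - (D (Suc m) (P z) (P ?h # vs @ Q z # ?q z) + (D m (P z) (vs @ Q ?h # ?q z) + ?S))
          = (D m (P y) (vs @ Q z # ?q y) - D m (P z) (vs @ Q z # ?q z)
              - (D (Suc m) (P z) (P ?h # vs @ Q z # ?q z) + ?S))
            + (D m (P y) (vs @ Q ?h # ?q y) - D m (P z) (vs @ Q ?h # ?q z))" (is "?lhs = ?a + ?b")
        unfolding split by (simp add: algebra_simps)
      then have "norm ?lhs \<le> norm ?a + norm ?b" by (simp only: norm_triangle_ineq)
      also have "\<dots> \<le> e / c * norm ?h * (?p * norm (Q z)) + e / (2 * B) * (?p * norm (Q ?h))"
        using elim(1)[rule_format, of "vs @ [Q z]"] elim(2)[rule_format, of "vs @ [Q ?h]"] vs QF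
        by (intro add_mono) auto
      also have "\<dots> \<le> e / c * norm ?h * (?p * (c / 2)) + e / (2 * B) * (?p * (norm ?h * B))"
        using Cons.prems(2) c B by (intro add_mono mult_left_mono B nonneg) (auto simp: c_def)
      also have "\<dots> = e * norm ?h * ?p" using c B by (simp add: field_simps)
      finally show "norm (D m (P y) (vs @ map (\<lambda>Q. Q y) (Q # Qs)) - D m (P z) (vs @ map (\<lambda>Q. Q z) (Q # Qs))
             - (D (Suc m) (P z) (P ?h # vs @ map (\<lambda>Q. Q z) (Q # Qs))
               + (\<Sum>k<length (Q # Qs). D m (P z) (vs @ (map (\<lambda>Q. Q z) (Q # Qs))[k := ((Q # Qs) ! k) ?h]))))
             \<le> e * norm ?h * ?p"
        unfolding sum by simp
    qed
  qed
qed

lemma has_derivative_slots: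
  assumes P: "bounded_linear P" "range P \<subseteq> F" and z: "P z \<in> U"
    and Qs: "\<forall>Q\<in>set Qs. bounded_linear Q \<and> range Q \<subseteq> F"
  defines "m \<equiv> length Qs"
  shows "((\<lambda>y. D m (P y) (map (\<lambda>Q. Q y) Qs)) has_derivative
           (\<lambda>h. D (Suc m) (P z) (P h # map (\<lambda>Q. Q z) Qs)
              + (\<Sum>k<m. D m (P z) ((map (\<lambda>Q. Q z) Qs)[k := (Qs ! k) h])))) (at z)"
    (is "(?f has_derivative ?f') _")
proof -
  have qF: "set (map (\<lambda>Q. Q z) Qs) \<subseteq> F" using Qs by auto
  have "bounded_linear (\<lambda>h. D (Suc m) (P z) ([] @ P h # map (\<lambda>Q. Q z) Qs))"
    by (rule bounded_linear_slot[OF z _ _ qF P]) (auto simp: m_def)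
  then have "bounded_linear ?f'"
    by (intro bounded_linear_add bounded_linear_sum bounded_linear_update z qF)
       (use Qs in \<open>auto simp: m_def\<close>)
  moreover have "\<exists>d>0. \<forall>y. norm (y - z) < d \<longrightarrow> norm (?f y - ?f z - ?f' (y - z)) \<le> e * norm (y - z)"
    if "e > 0" for e
    using derivative_slots[OF P z Qs that, of m 0]
    by (simp add: m_def eventually_nhds_metric dist_norm)
  ultimately show ?thesis unfolding has_derivative_at_alt by blast
qed

end

text \<open>The functions \<open>K (D m (P z) [Q_1 z, ..., Q_m z])\<close> with bounded linear
  \<open>K\<close>, \<open>P\<close>, \<open>Q_k\<close> form a class that the tangent lift maps
  into finite sums of its own members. By the product rule, \<open>P\<close> and the
  \<open>Q_k\<close> get precomposed with \<open>vfst\<close>, and at most one argument, new or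
  replaced, reads \<open>vsnd\<close>. Generalising over \<open>K\<close>, \<open>P\<close> and the
  list makes the induction on \<open>n\<close> work although the order of the form grows.\<close>

lemma derivative_tower_smooth_order:
  fixes K :: "'b::real_normed_vector \<Rightarrow> 'e::real_normed_vector seqs"
  assumes D: "derivative_tower F U D"
    and K: "bounded_linear K" and P: "bounded_linear P" "range P \<subseteq> F"
    and Qs: "\<forall>Q\<in>set Qs. bounded_linear Q \<and> range Q \<subseteq> F"
  shows "smooth_order n (P -` U) (\<lambda>z :: 'e seqs. K (D (length Qs) (P z) (map (\<lambda>Q. Q z) Qs)))"
  using K P Qs
proof (induction n arbitrary: K P Qs)
  case 0
  obtain T where T: "open T" "U = F \<inter> T" using derivative_tower.openin[OF D] by (auto simp: openin_open)
  then have "P -` U = P -` T" using 0 by auto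
  then show ?case using open_vimage[OF T(1) linear_continuous_on[OF 0(2)]] by simp
next
  case (Suc n)
  interpret derivative_tower F U D by fact
  note [intro] = bounded_linear_vfst bounded_linear_vsnd
  let ?m = "length Qs" and ?f = "\<lambda>z. K (D (length Qs) (P z) (map (\<lambda>Q. Q z) Qs))"
  let ?f1 = "\<lambda>z h. K (D (Suc ?m) (P z) (P h # map (\<lambda>Q. Q z) Qs))"
  let ?f2 = "\<lambda>k z h. K (D ?m (P z) ((map (\<lambda>Q. Q z) Qs)[k := (Qs ! k) h]))"
  have lK: "linear K" using Suc.prems(1) by (rule bounded_linear.linear)
  have d: "(?f has_derivative (\<lambda>h. ?f1 z h + (\<Sum>k<?m. ?f2 k z h))) (at z)" if "P z \<in> U" for z
    using bounded_linear.has_derivative[OF Suc.prems(1) has_derivative_slots[OF Suc.prems(2,3) that Suc.prems(4)]]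
    by (simp add: linear_add[OF lK] linear_sum[OF lK])
  obtain T where T: "open T" "U = F \<inter> T" using openin by (auto simp: openin_open)
  then have "P -` U = P -` T" using Suc.prems by auto
  then have V: "open (P -` U)" using open_vimage[OF T(1) linear_continuous_on[OF Suc.prems(2)]] by simp
  let ?P = "\<lambda>z. P (vfst z)" and ?Q = "map (\<lambda>Q z. Q (vfst z)) Qs"
  have pre: "vfst -` (P -` U) = ?P -` U" by auto
  have bl: "bounded_linear ?P" "range ?P \<subseteq> F" "bounded_linear (\<lambda>z. P (vsnd z))" "range (\<lambda>z. P (vsnd z)) \<subseteq> F"
    using Suc.prems by (auto intro: bounded_linear_compose)
  have blQ: "\<forall>Q\<in>set ?Q. bounded_linear Q \<and> range Q \<subseteq> F"
    using Suc.prems(4) by (auto intro: bounded_linear_compose dest: range_subsetD)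
  \<comment> \<open>The two halves of the lift are produced separately: \<open>K\<close> is followed
    by the embedding into the first or the second component, and the results are added.\<close>
  have K1: "bounded_linear (\<lambda>v. vpair (K v) 0)" and K2: "bounded_linear (\<lambda>v. vpair 0 (K v))"
    by (intro bounded_linear_vpair Suc.prems bounded_linear_zero)+
  have "smooth_order n (?P -` U) (\<lambda>z. vpair (?f (vfst z)) 0)"
    using Suc.IH[OF K1 bl(1,2) blQ] by (simp add: o_def)
  moreover have "smooth_order n (?P -` U) (\<lambda>z. vpair 0 (?f1 (vfst z) (vsnd z)))"
    using Suc.IH[OF K2 bl(1,2), of "(\<lambda>z. P (vsnd z)) # ?Q"] bl blQ by (simp add: o_def)
  moreover have "smooth_order n (?P -` U) (\<lambda>z. vpair 0 (?f2 k (vfst z) (vsnd z)))" if "k < ?m" for k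
  proof -
    have "bounded_linear (Qs ! k)" "range (Qs ! k) \<subseteq> F" using Suc.prems(4) that by auto
    then have "bounded_linear (\<lambda>z. (Qs ! k) (vsnd z)) \<and> range (\<lambda>z. (Qs ! k) (vsnd z)) \<subseteq> F"
      by (auto intro: bounded_linear_compose)
    then have "\<forall>Q\<in>set (?Q[k := \<lambda>z. (Qs ! k) (vsnd z)]). bounded_linear Q \<and> range Q \<subseteq> F"
      using blQ set_update_subset_insert[of ?Q k] by blast
    from Suc.IH[OF K2 bl(1,2) this] show ?thesis by (simp add: map_update o_def)
  qed
  ultimately have "smooth_order n (?P -` U)
      (\<lambda>z. vpair (?f (vfst z)) 0 + vpair 0 (?f1 (vfst z) (vsnd z)) + (\<Sum>k<?m. vpair 0 (?f2 k (vfst z) (vsnd z))))"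
    by (intro smooth_order_add smooth_order_sum) (auto intro: smooth_order_open)
  then have "smooth_order n (?P -` U) (tangent_lift ?f)"
  proof (rule smooth_order_cong)
    fix z assume "z \<in> ?P -` U"
    then have z: "P (vfst z) \<in> U" by simp
    have lin: "linear (\<lambda>v :: 'e seqs. vpair 0 v)"
      by (intro bounded_linear.linear bounded_linear_vpair bounded_linear_zero bounded_linear_ident)
    have split: "vpair a b = vpair a 0 + vpair 0 b" for a b :: "'e seqs"
      by (rule bcontfun_eqI) (simp add: apply_vpair)
    have "tangent_lift ?f z = vpair (?f (vfst z)) 0 + vpair 0 (?f1 (vfst z) (vsnd z) + (\<Sum>k<?m. ?f2 k (vfst z) (vsnd z)))"
      unfolding tangent_lift_eq[OF d[OF z]] by (rule split)
    then show "vpair (?f (vfst z)) 0 + vpair 0 (?f1 (vfst z) (vsnd z)) + (\<Sum>k<?m. vpair 0 (?f2 k (vfst z) (vsnd z)))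
        = tangent_lift ?f z"
      by (simp only: linear_add[OF lin] linear_sum[OF lin] add.assoc)
  qed
  then show ?case using V d pre by (auto simp: differentiable_def)
qed

text \<open>The case of an empty argument list. \<open>P\<close> leads from the sequence space into
  \<open>F\<close> and \<open>K\<close> leads back, which turns a map between other normed spaces
  into one from the sequence space to itself.\<close>

lemma smooth_within_imp_lift_smooth:
  fixes K :: "'b::real_normed_vector \<Rightarrow> 'e::real_normed_vector seqs"
  assumes "smooth_within F U f" "subspace F" "openin (top_of_set F) U"
    and K: "bounded_linear K" and P: "bounded_linear P" "range P \<subseteq> F"
  shows "lift_smooth (P -` U) (\<lambda>z. K (f (P z)))"
proof -
  obtain D where D0: "\<forall>x\<in>U. D 0 x [] = f x" and "derivative_tower F U D"
    using assms unfolding smooth_within_def derivative_tower_def by blast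
  then have "smooth_order n (P -` U) (\<lambda>z. K (D 0 (P z) []))" for n
    using derivative_tower_smooth_order[of F U D K P "[]" n] K P by simp
  then have "smooth_order n (P -` U) (\<lambda>z. K (f (P z)))" for n
    by (rule smooth_order_cong) (simp add: D0)
  then show ?thesis by (simp add: lift_smooth_def)
qed

section \<open>Symmetry of second derivatives and its form for tangent lifts\<close>

text \<open>Only the derivative of \<open>g' v u\<close> in \<open>v\<close> for one fixed
  \<open>u\<close> is assumed, because this is the form in which differentiability of a tangent lift
  supplies second derivatives. The estimate is the mean value inequality for the difference of
  \<open>g\<close> on two parallel segments in direction \<open>u\<close>, shifted by
  \<open>r *\<^sub>R w\<close>, with the expected value subtracted.\<close>

lemma second_difference:
  fixes g :: "'a::real_normed_vector \<Rightarrow> 'b::real_normed_vector"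
  assumes V: "open V" "x \<in> V" and g: "\<And>u. u \<in> V \<Longrightarrow> (g has_derivative g' u) (at u)"
    and H: "((\<lambda>v. g' v u) has_derivative H) (at x)" and e: "e > 0"
  shows "\<exists>d>0. \<forall>r. 0 < r \<and> r < d \<longrightarrow>
    norm (g (x + r *\<^sub>R u + r *\<^sub>R w) - g (x + r *\<^sub>R u) - g (x + r *\<^sub>R w) + g x - r\<^sup>2 *\<^sub>R H w) \<le> e * r\<^sup>2"
proof -
  interpret H: bounded_linear H using H by (rule has_derivative_bounded_linear)
  \<comment> \<open>The distances of corresponding points of the two segments from \<open>x\<close>
    add up to at most \<open>r * (C - 1)\<close>: one contributes \<open>norm u\<close>, the other
    \<open>norm u + norm w\<close>.\<close>
  define C where "C = 2 * norm u + norm w + 1"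
  have C: "C > 0" by (simp add: C_def add_nonneg_pos)
  then have "e / C > 0" using e by simp
  with H obtain d2 where d2: "d2 > 0"
    "\<And>v. norm (v - x) < d2 \<Longrightarrow> norm (g' v u - g' x u - H (v - x)) \<le> e / C * norm (v - x)"
    unfolding has_derivative_at_alt by blast
  obtain d1 where d1: "d1 > 0" "ball x d1 \<subseteq> V" using V by (metis openE)
  define d where "d = min d1 d2 / C"
  have "d > 0" using d1 d2 C by (simp add: d_def)
  moreover have "norm (g (x + r *\<^sub>R u + r *\<^sub>R w) - g (x + r *\<^sub>R u) - g (x + r *\<^sub>R w) + g x - r\<^sup>2 *\<^sub>R H w) \<le> e * r\<^sup>2"
    if r: "0 < r" "r < d" for r
  proof -
    have le: "norm (q *\<^sub>R (r *\<^sub>R u) + p *\<^sub>R (r *\<^sub>R w)) \<le> r * (norm u + p * norm w)"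
      if "0 \<le> q" "q \<le> 1" "0 \<le> p" "p \<le> 1" for q p
    proof -
      have "norm (q *\<^sub>R (r *\<^sub>R u) + p *\<^sub>R (r *\<^sub>R w)) \<le> q * (r * norm u) + p * (r * norm w)"
        using that r by (intro norm_triangle_le) simp
      also have "\<dots> \<le> 1 * (r * norm u) + p * (r * norm w)"
        using that r by (intro add_mono mult_right_mono) auto
      finally show ?thesis by (simp add: algebra_simps)
    qed
    have small: "norm (q *\<^sub>R (r *\<^sub>R u) + p *\<^sub>R (r *\<^sub>R w)) < min d1 d2"
      if "0 \<le> q" "q \<le> 1" "0 \<le> p" "p \<le> 1" for q p
    proof -
      have "p * norm w \<le> 1 * norm w" using that by (intro mult_right_mono) auto
      then have "norm u + p * norm w < C" by (simp add: C_def) (smt (verit) norm_ge_zero)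
      then have "r * (norm u + p * norm w) < r * C" using r by (intro mult_strict_left_mono) auto
      also have "\<dots> \<le> d * C" using r C by (intro mult_right_mono) auto
      also have "\<dots> = min d1 d2" using C by (simp add: d_def)
      finally show ?thesis using le[OF that] by linarith
    qed
    let ?a = "\<lambda>q. x + q *\<^sub>R (r *\<^sub>R u) + r *\<^sub>R w" and ?b = "\<lambda>q. x + q *\<^sub>R (r *\<^sub>R u)"
    have na: "?a q \<in> V" "norm (?a q - x) < d2" "norm (?a q - x) \<le> r * (norm u + norm w)"
      and nb: "?b q \<in> V" "norm (?b q - x) < d2" "norm (?b q - x) \<le> r * norm u"
      if "0 \<le> q" "q \<le> 1" for q
      using small[of q 1] small[of q 0] le[of q 1] le[of q 0] that d1
      by (auto simp: dist_norm add.assoc subset_iff norm_minus_commute)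
    define \<psi> where "\<psi> q = g (?a q) - g (?b q) - q *\<^sub>R (r\<^sup>2 *\<^sub>R H w)" for q
    define \<psi>' where "\<psi>' q = r *\<^sub>R (g' (?a q) u - g' (?b q) u) - r\<^sup>2 *\<^sub>R H w" for q
    have der\<psi>: "(\<psi> has_derivative (\<lambda>h. h *\<^sub>R \<psi>' q)) (at q within {0..1})"
      if q: "q \<in> {0..1}" for q
    proof -
      have sc: "g' v (h *\<^sub>R (r *\<^sub>R u)) = h *\<^sub>R (r *\<^sub>R g' v u)" if "v \<in> V" for v h
        using linear_scale[OF has_derivative_linear[OF g[OF that]]] by simp
      have 1: "((\<lambda>q. g (?a q)) has_derivative (\<lambda>h. g' (?a q) (h *\<^sub>R (r *\<^sub>R u)))) (at q within {0..1})"
        by (rule has_derivative_compose[OF _ g]) (use q na in \<open>auto intro!: derivative_eq_intros\<close>)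
      have 2: "((\<lambda>q. g (?b q)) has_derivative (\<lambda>h. g' (?b q) (h *\<^sub>R (r *\<^sub>R u)))) (at q within {0..1})"
        by (rule has_derivative_compose[OF _ g]) (use q nb in \<open>auto intro!: derivative_eq_intros\<close>)
      have 3: "((\<lambda>q. q *\<^sub>R (r\<^sup>2 *\<^sub>R H w)) has_derivative (\<lambda>h. h *\<^sub>R (r\<^sup>2 *\<^sub>R H w))) (at q within {0..1})"
        by (auto intro!: derivative_eq_intros)
      have "g' (?a q) (h *\<^sub>R (r *\<^sub>R u)) - g' (?b q) (h *\<^sub>R (r *\<^sub>R u)) - h *\<^sub>R (r\<^sup>2 *\<^sub>R H w) = h *\<^sub>R \<psi>' q" for h
        using q na nb by (simp only: sc \<psi>'_def scaleR_diff_right atLeastAtMost_iff)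
      with has_derivative_diff[OF has_derivative_diff[OF 1 2] 3] show ?thesis
        by (simp add: \<psi>_def[abs_def])
    qed
    have bound: "norm (\<psi>' q) \<le> e * r\<^sup>2" if q: "0 \<le> q" "q \<le> 1" for q
    proof -
      let ?E = "\<lambda>v. g' v u - g' x u - H (v - x)"
      have "H (?a q - x) - H (?b q - x) = r *\<^sub>R H w"
        by (simp only: H.diff[symmetric] H.scaleR[symmetric]) simp
      then have "\<psi>' q = r *\<^sub>R (?E (?a q) - ?E (?b q))"
        unfolding \<psi>'_def by (simp add: power2_eq_square algebra_simps)
      then have "norm (\<psi>' q) \<le> r * (norm (?E (?a q)) + norm (?E (?b q)))"
        using r norm_triangle_ineq4[of "?E (?a q)" "?E (?b q)"] by simp
      also have "\<dots> \<le> r * (e / C * norm (?a q - x) + e / C * norm (?b q - x))"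
        using r na[OF q] nb[OF q] by (intro mult_left_mono add_mono d2) auto
      also have "\<dots> \<le> r * (e / C * (r * (norm u + norm w)) + e / C * (r * norm u))"
        using r na[OF q] nb[OF q] e C by (intro mult_left_mono add_mono) auto
      also have "\<dots> = e / C * r\<^sup>2 * (C - 1)"
      proof -
        have C1: "C - 1 = 2 * norm u + norm w" by (simp add: C_def)
        show ?thesis unfolding C1 by (simp add: power2_eq_square algebra_simps)
      qed
      also have "\<dots> \<le> e / C * r\<^sup>2 * C" using e C by (intro mult_left_mono) auto
      also have "\<dots> = e * r\<^sup>2" using C by simp
      finally show ?thesis .
    qed
    have "norm (\<psi> 1 - \<psi> 0) \<le> e * r\<^sup>2 * norm (1 - 0 :: real)"
    proof (rule differentiable_bound[of "{0..1}" \<psi> "\<lambda>q h. h *\<^sub>R \<psi>' q"])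
      show "onorm (\<lambda>h. h *\<^sub>R \<psi>' q) \<le> e * r\<^sup>2" if "q \<in> {0..1}" for q
        using bound[of q] that by (intro onorm_le) (simp add: mult.commute mult_left_mono)
    qed (use der\<psi> in auto)
    then show ?thesis by (simp add: \<psi>_def algebra_simps)
  qed
  ultimately show ?thesis by blast
qed

text \<open>The second difference over the parallelogram spanned by \<open>u\<close> and
  \<open>w\<close> is unchanged when they are exchanged; divided by \<open>r\<^sup>2\<close> it
  tends both to \<open>H w\<close> and to \<open>G u\<close>.\<close>

lemma second_derivative_symmetric:
  fixes g :: "'a::real_normed_vector \<Rightarrow> 'b::real_normed_vector"
  assumes V: "open V" "x \<in> V" and g: "\<And>u. u \<in> V \<Longrightarrow> (g has_derivative g' u) (at u)"
    and H: "((\<lambda>v. g' v u) has_derivative H) (at x)" and G: "((\<lambda>v. g' v w) has_derivative G) (at x)"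
  shows "H w = G u"
proof -
  have "norm (H w - G u) \<le> e" if "e > 0" for e
  proof -
    let ?\<Delta> = "\<lambda>r. g (x + r *\<^sub>R u + r *\<^sub>R w) - g (x + r *\<^sub>R u) - g (x + r *\<^sub>R w) + g x"
    have swap: "g (x + r *\<^sub>R w + r *\<^sub>R u) - g (x + r *\<^sub>R w) - g (x + r *\<^sub>R u) + g x = ?\<Delta> r" for r
      by (simp add: algebra_simps)
    have "e / 2 > 0" using that by simp
    from second_difference[OF V g H this, of w] second_difference[OF V g G this, of u]
    obtain a b where a: "a > 0" "\<And>r. 0 < r \<Longrightarrow> r < a \<Longrightarrow> norm (?\<Delta> r - r\<^sup>2 *\<^sub>R H w) \<le> e / 2 * r\<^sup>2"
      and b: "b > 0" "\<And>r. 0 < r \<Longrightarrow> r < b \<Longrightarrow> norm (?\<Delta> r - r\<^sup>2 *\<^sub>R G u) \<le> e / 2 * r\<^sup>2"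
      unfolding swap by blast
    define r where "r = min a b / 2"
    have r: "0 < r" "r < a" "r < b" using a(1) b(1) by (auto simp: r_def)
    have "r\<^sup>2 *\<^sub>R (H w - G u) = (?\<Delta> r - r\<^sup>2 *\<^sub>R G u) - (?\<Delta> r - r\<^sup>2 *\<^sub>R H w)"
      by (simp add: algebra_simps)
    then have "norm (r\<^sup>2 *\<^sub>R (H w - G u)) \<le> norm (?\<Delta> r - r\<^sup>2 *\<^sub>R G u) + norm (?\<Delta> r - r\<^sup>2 *\<^sub>R H w)"
      by (simp only: norm_triangle_ineq4)
    also have "\<dots> \<le> e / 2 * r\<^sup>2 + e / 2 * r\<^sup>2"
      by (rule add_mono[OF b(2)[OF r(1,3)] a(2)[OF r(1,2)]])
    finally have "r\<^sup>2 * norm (H w - G u) \<le> r\<^sup>2 * e" by (simp add: mult.commute)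
    then show ?thesis using r(1) by simp
  qed
  then have "norm (H w - G u) \<le> 0" by (rule dense_ge)
  then show ?thesis by simp
qed

text \<open>In coordinates the double lift sends (x, y, X, Y) to (g x, g' y, g' X, g''(X, y) + g'
  Y), with derivatives taken at x. Exchanging y and X commutes with it because g'' is
  symmetric.\<close>

lemma tangent_lift_vflip:
  assumes g: "lift_smooth V g" and z: "vfst (vfst z) \<in> V"
  shows "tangent_lift (tangent_lift g) (vflip z) = vflip (tangent_lift (tangent_lift g) z)"
proof -
  obtain x y X Y where z_eq: "z = vpair (vpair x y) (vpair X Y)" by (metis vpair_vfst_vsnd)
  with z have x: "x \<in> V" by simp
  let ?g' = "\<lambda>x. frechet_derivative g (at x)" and ?T = "\<lambda>p. frechet_derivative (tangent_lift g) (at p)"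
  note g' = lift_smooth_has_derivative[OF g]
  have T: "(tangent_lift g has_derivative ?T (vpair x u)) (at (vpair x u))" for u
    by (rule lift_smooth_has_derivative[OF lift_smoothD(3)[OF g]]) (simp add: x)
  have fst: "vfst (?T (vpair x u) (vpair a b)) = ?g' x a" for u a b
  proof -
    have "((\<lambda>p. vfst (tangent_lift g p)) has_derivative (\<lambda>h. vfst (?T (vpair x u) h))) (at (vpair x u))"
      by (rule bounded_linear.has_derivative[OF bounded_linear_vfst T])
    moreover have "((\<lambda>p. vfst (tangent_lift g p)) has_derivative (\<lambda>h. ?g' x (vfst h))) (at (vpair x u))"
      using has_derivative_compose[OF bounded_linear_imp_has_derivative[OF bounded_linear_vfst], of g "?g' x" "vpair x u" UNIV]
        g'[OF x] by simp
    ultimately have "(\<lambda>h. vfst (?T (vpair x u) h)) = (\<lambda>h. ?g' x (vfst h))" by (rule has_derivative_unique)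
    then show ?thesis by (metis vfst_vpair)
  qed
  \<comment> \<open>Freezing the fibre coordinate \<open>u\<close> isolates the derivative of
    \<open>?g' v u\<close> in \<open>v\<close>, which is what the symmetry lemma takes as
    input.\<close>
  have partial1: "((\<lambda>v. ?g' v u) has_derivative (\<lambda>h. vsnd (?T (vpair x u) (vpair h 0)))) (at x)" for u
  proof -
    have "((\<lambda>v. vpair v u) has_derivative (\<lambda>h. vpair h 0)) (at x)"
      by (intro has_derivative_vpair has_derivative_ident has_derivative_const)
    from bounded_linear.has_derivative[OF bounded_linear_vsnd has_derivative_compose[OF this T]]
    show ?thesis by (simp add: tangent_lift_def)
  qed
  \<comment> \<open>With the base point frozen, the second component is the linear map
    \<open>?g' x\<close>, which is its own derivative.\<close>
  have partial2: "vsnd (?T (vpair x u) (vpair 0 b)) = ?g' x b" for u b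
  proof -
    have "((\<lambda>v. vpair x v) has_derivative (\<lambda>h. vpair 0 h)) (at u)"
      by (intro has_derivative_vpair has_derivative_ident has_derivative_const)
    from bounded_linear.has_derivative[OF bounded_linear_vsnd has_derivative_compose[OF this T]]
    have "(?g' x has_derivative (\<lambda>h. vsnd (?T (vpair x u) (vpair 0 h)))) (at u)"
      by (simp add: tangent_lift_def)
    moreover have "(?g' x has_derivative ?g' x) (at u)"
      by (rule bounded_linear_imp_has_derivative[OF has_derivative_bounded_linear[OF g'[OF x]]])
    ultimately have "(\<lambda>h. vsnd (?T (vpair x u) (vpair 0 h))) = ?g' x" by (rule has_derivative_unique)
    then show ?thesis by metis
  qed
  have snd: "vsnd (?T (vpair x u) (vpair a b)) = vsnd (?T (vpair x u) (vpair a 0)) + ?g' x b" for u a b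
  proof -
    have "vpair a b = vpair a 0 + vpair 0 b" by (rule bcontfun_eqI) (simp add: apply_vpair)
    then show ?thesis
      by (simp add: partial2 linear_add[OF has_derivative_linear[OF T]]
          linear_add[OF bounded_linear.linear[OF bounded_linear_vsnd]])
  qed
  have sym: "vsnd (?T (vpair x y) (vpair X 0)) = vsnd (?T (vpair x X) (vpair y 0))"
    by (rule second_derivative_symmetric[OF lift_smoothD(1)[OF g] x g' partial1 partial1])
  have T_eq: "?T (vpair x u) (vpair a b) = vpair (?g' x a) (vsnd (?T (vpair x u) (vpair a 0)) + ?g' x b)" for u a b
    by (metis fst snd vpair_vfst_vsnd)
  have TT: "tangent_lift (tangent_lift g) (vpair (vpair x u) (vpair a b))
      = vpair (vpair (g x) (?g' x u)) (vpair (?g' x a) (vsnd (?T (vpair x u) (vpair a 0)) + ?g' x b))" for u a b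
    unfolding tangent_lift_def[of "tangent_lift g"] vfst_vpair vsnd_vpair T_eq[of u a b]
    unfolding tangent_lift_def vfst_vpair vsnd_vpair ..
  show ?thesis unfolding z_eq vflip_def vfst_vpair vsnd_vpair TT sym ..
qed

section \<open>Smooth maps of manifolds and their tangent maps\<close>

text \<open>Derivatives within a subspace may differ off it, so only values on \<open>F\<close> are
  compared. The line \<open>x + t *\<^sub>R v\<close> stays in \<open>F\<close> and reduces the
  claim to uniqueness of derivatives in one real variable.\<close>

lemma has_derivative_within_subspace_unique:
  assumes F: "subspace F" "x \<in> F" "v \<in> F"
    and A: "(f has_derivative A) (at x within F)" and B: "(f has_derivative B) (at x within F)"
  shows "A v = B v"
proof -
  have line: "((\<lambda>t::real. x + t *\<^sub>R v) has_derivative (\<lambda>t. t *\<^sub>R v)) (at 0 within UNIV)"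
    by (auto intro!: derivative_eq_intros)
  have sub: "range (\<lambda>t::real. x + t *\<^sub>R v) \<subseteq> F" using F by (auto intro: subspace_add subspace_scale)
  have "((\<lambda>t. f (x + t *\<^sub>R v)) has_derivative (\<lambda>t. A (t *\<^sub>R v))) (at 0)"
    using has_derivative_in_compose[OF line] has_derivative_subset[OF A sub] by simp
  moreover have "((\<lambda>t. f (x + t *\<^sub>R v)) has_derivative (\<lambda>t. B (t *\<^sub>R v))) (at 0)"
    using has_derivative_in_compose[OF line] has_derivative_subset[OF B sub] by simp
  ultimately have "(\<lambda>t. A (t *\<^sub>R v)) = (\<lambda>t. B (t *\<^sub>R v))" by (rule has_derivative_unique)
  from fun_cong[OF this, of 1] show ?thesis by simp
qed

text \<open>\<open>A v\<close> is a limit of difference quotients of \<open>g\<close> along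
  \<open>v\<close>. Near \<open>x\<close> these lie in the subspace \<open>G\<close>, and closedness
  keeps the limit there.\<close>

lemma derivative_in_closed_subspace:
  assumes g: "(g has_derivative A) (at x)" and V: "open V" "x \<in> V" "\<And>u. u \<in> V \<Longrightarrow> u \<in> F \<Longrightarrow> g u \<in> G"
    and F: "subspace F" "x \<in> F" "v \<in> F" and G: "subspace G" "closed G"
  shows "A v \<in> G"
proof -
  interpret A: bounded_linear A using g by (rule has_derivative_bounded_linear)
  have "\<exists>w\<in>G. dist w (A v) < e" if e: "e > 0" for e
  proof -
    \<comment> \<open>The summand 1 covers \<open>v = 0\<close> and makes \<open>norm v / c\<close>
      less than 1, which yields the strict inequality.\<close>
    define c where "c = norm v + 1"
    have c: "c > 0" "norm v < c" by (auto simp: c_def add_nonneg_pos)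
    obtain d1 where d1: "d1 > 0" "ball x d1 \<subseteq> V" using V by (metis openE)
    obtain d2 where d2: "d2 > 0" "\<And>y. norm (y - x) < d2 \<Longrightarrow> norm (g y - g x - A (y - x)) \<le> e / c * norm (y - x)"
      using g e c unfolding has_derivative_at_alt by (meson divide_pos_pos)
    define t where "t = min d1 d2 / c"
    have t: "t > 0" using d1 d2 c by (simp add: t_def)
    have "t * norm v < t * c" using t c by simp
    moreover have "t * c = min d1 d2" using c by (simp add: t_def)
    ultimately have small: "norm (t *\<^sub>R v) < min d1 d2" using t by simp
    let ?w = "inverse t *\<^sub>R (g (x + t *\<^sub>R v) - g x)"
    have "x + t *\<^sub>R v \<in> V" using small d1 by (auto simp: dist_norm subset_iff)
    then have "?w \<in> G"
      using V F G by (intro subspace_scale subspace_diff) (auto intro: subspace_add subspace_scale)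
    moreover have "dist ?w (A v) < e"
    proof -
      have "?w - A v = inverse t *\<^sub>R (g (x + t *\<^sub>R v) - g x - A (x + t *\<^sub>R v - x))"
        using t by (simp add: A.scaleR algebra_simps)
      then have "norm (?w - A v) = inverse t * norm (g (x + t *\<^sub>R v) - g x - A (x + t *\<^sub>R v - x))"
        using t by simp
      also have "\<dots> \<le> inverse t * (e / c * norm (x + t *\<^sub>R v - x))"
        using small t by (intro mult_left_mono d2) auto
      also have "\<dots> = e * (norm v / c)" using t by (simp add: field_simps)
      also have "\<dots> < e * 1" using c e by (intro mult_strict_left_mono) auto
      finally show ?thesis by (simp add: dist_norm)
    qed
    ultimately show ?thesis by blast
  qed
  then show ?thesis using closed_approachable[OF G(2)] by blast
qed

section \<open>Chart representatives extended to the ambient space\<close>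

text \<open>
  The function \<open>g\<close> extends the chart representation of \<open>f\<close> near \<open>p\<close> from the model space of
  \<open>N\<close> to a neighbourhood \<open>V\<close> in the ambient space, where derivatives are unique.
\<close>

definition chart_germ ::
    "('p, 'i, 'e::real_normed_vector seqs) manifold \<Rightarrow> ('q, 'j, 'e seqs) manifold \<Rightarrow> 'i \<Rightarrow> 'j
      \<Rightarrow> ('p \<Rightarrow> 'q) \<Rightarrow> 'p \<Rightarrow> 'e seqs set \<Rightarrow> ('e seqs \<Rightarrow> 'e seqs) \<Rightarrow> bool" where
  "chart_germ N N' i j f p V g \<longleftrightarrow> lift_smooth V g \<and> p \<in> chart_dom N i \<and> chart N i p \<in> V \<and>
     (\<forall>v \<in> V \<inter> model N. \<exists>q \<in> chart_dom N i.
        chart N i q = v \<and> f q \<in> chart_dom N' j \<and> chart N' j (f q) = g v)"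

text \<open>Smoothness as existence of local extensions. Continuity is included: a germ sends a
  whole relative neighbourhood of the chart point into the target chart.\<close>

definition smooth_between ::
    "('p, 'i, 'e::real_normed_vector seqs) manifold \<Rightarrow> ('q, 'j, 'e seqs) manifold \<Rightarrow> ('p \<Rightarrow> 'q) \<Rightarrow> bool" where
  "smooth_between N N' f \<longleftrightarrow> f ` carrier N \<subseteq> carrier N' \<and>
     (\<forall>i\<in>index N. \<forall>j\<in>index N'. \<forall>p\<in>chart_dom N i. f p \<in> chart_dom N' j \<longrightarrow> (\<exists>V g. chart_germ N N' i j f p V g))"

text \<open>Properties of an atlas that pass to the tangent bundle. For \<open>id\<close> and a
  single chart, \<open>smooth_between\<close> also says that chart images are relatively open, since
  a germ provides a point over every model vector in \<open>V\<close>. Closedness of the model keeps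
  the values of derivatives in it.\<close>

definition regular_atlas :: "('p, 'i, 'e::real_normed_vector seqs) manifold \<Rightarrow> bool" where
  "regular_atlas N \<longleftrightarrow> subspace (model N) \<and> closed (model N) \<and>
     (\<Union>i\<in>index N. chart_dom N i) = carrier N \<and>
     (\<forall>i\<in>index N. inj_on (chart N i) (chart_dom N i) \<and> chart N i ` chart_dom N i \<subseteq> model N) \<and>
     smooth_between N N id"

text \<open>The expression common to \<open>tangent_carrier\<close> and \<open>tangent_map\<close>;
  naming it lets one chain rule treat both transition rules and tangent maps.\<close>

definition chart_differential ::
    "('p, 'i, 'v::real_normed_vector) manifold \<Rightarrow> ('q, 'j, 'w::real_normed_vector) manifold \<Rightarrow> 'i \<Rightarrow> 'j
      \<Rightarrow> ('p \<Rightarrow> 'q) \<Rightarrow> 'p \<Rightarrow> 'v \<Rightarrow> 'w" where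
  "chart_differential N N' i j f p = frechet_derivative (local_rep N N' i j f) (at (chart N i p) within model N)"

lemma regular_atlasD:
  assumes "regular_atlas N"
  shows "subspace (model N)" "closed (model N)" "smooth_between N N id"
    "p \<in> carrier N \<Longrightarrow> \<exists>i\<in>index N. p \<in> chart_dom N i"
    "i \<in> index N \<Longrightarrow> p \<in> chart_dom N i \<Longrightarrow> p \<in> carrier N"
    "i \<in> index N \<Longrightarrow> p \<in> chart_dom N i \<Longrightarrow> chart N i p \<in> model N"
    "i \<in> index N \<Longrightarrow> p \<in> chart_dom N i \<Longrightarrow> q \<in> chart_dom N i \<Longrightarrow> chart N i p = chart N i q \<Longrightarrow> p = q"
  using assms unfolding regular_atlas_def inj_on_def by blast+

lemma smooth_betweenD:
  assumes "smooth_between N N' f"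
  shows "p \<in> carrier N \<Longrightarrow> f p \<in> carrier N'"
    "i \<in> index N \<Longrightarrow> j \<in> index N' \<Longrightarrow> p \<in> chart_dom N i \<Longrightarrow> f p \<in> chart_dom N' j \<Longrightarrow> \<exists>V g. chart_germ N N' i j f p V g"
  using assms unfolding smooth_between_def by blast+

lemma chart_germD:
  assumes "chart_germ N N' i j f p V g"
  shows "lift_smooth V g" "p \<in> chart_dom N i" "chart N i p \<in> V"
    "v \<in> V \<Longrightarrow> v \<in> model N \<Longrightarrow> \<exists>q \<in> chart_dom N i. chart N i q = v \<and> f q \<in> chart_dom N' j \<and> chart N' j (f q) = g v"
  using assms unfolding chart_germ_def by blast+

text \<open>A germ names only some point over each vector; injectivity of the chart identifies it
  with \<open>q\<close>.\<close>

lemma chart_germ_apply: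
  assumes N: "regular_atlas N" and i: "i \<in> index N" and g: "chart_germ N N' i j f p V g"
    and q: "q \<in> chart_dom N i" "chart N i q \<in> V"
  shows "f q \<in> chart_dom N' j" "chart N' j (f q) = g (chart N i q)"
proof -
  obtain q' where "q' \<in> chart_dom N i" "chart N i q' = chart N i q" "f q' \<in> chart_dom N' j" "chart N' j (f q') = g (chart N i q)"
    using chart_germD(4)[OF g q(2) regular_atlasD(6)[OF N i q(1)]] by blast
  with regular_atlasD(7)[OF N i this(1) q(1)] show "f q \<in> chart_dom N' j" "chart N' j (f q) = g (chart N i q)" by auto
qed

text \<open>The bridge from the definitions to calculus: the derivative within the model is a choice
  among linear maps that agree on model vectors only, whereas \<open>g\<close> lives on an open set
  and has a unique derivative. Hence the restriction to \<open>v\<close> in the model.\<close>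

lemma chart_differential_eq:
  assumes N: "regular_atlas N" and i: "i \<in> index N" and g: "chart_germ N N' i j f p V g"
    and v: "v \<in> model N"
  shows "chart_differential N N' i j f p v = frechet_derivative g (at (chart N i p)) v"
proof -
  let ?F = "model N" and ?x = "chart N i p"
  have x: "?x \<in> ?F" "?x \<in> V" using regular_atlasD(6)[OF N i] chart_germD[OF g] by auto
  obtain d where d: "d > 0" "ball ?x d \<subseteq> V"
    using x lift_smoothD(1)[OF chart_germD(1)[OF g]] by (metis openE)
  have "local_rep N N' i j f u = g u" if u: "u \<in> V" "u \<in> ?F" for u
  proof -
    obtain q where q: "q \<in> chart_dom N i" "chart N i q = u" "chart N' j (f q) = g u"
      using chart_germD(4)[OF g u] by blast
    moreover have "inv_into (chart_dom N i) (chart N i) u = q"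
      using q regular_atlasD(7)[OF N i] by (metis inv_into_into f_inv_into_f image_eqI)
    ultimately show ?thesis by (simp add: local_rep_def)
  qed
  moreover have "u \<in> V" if "dist u ?x < d" for u using that d(2) by (auto simp: dist_commute subset_iff)
  ultimately have eq: "g u = local_rep N N' i j f u" if "u \<in> ?F" "dist u ?x < d" for u
    using that by metis
  have "(g has_derivative frechet_derivative g (at ?x)) (at ?x within ?F)"
    by (rule has_derivative_at_withinI[OF lift_smooth_has_derivative[OF chart_germD(1)[OF g] x(2)]])
  from has_derivative_transform_within[OF this d(1) x(1) eq]
  have *: "(local_rep N N' i j f has_derivative frechet_derivative g (at ?x)) (at ?x within ?F)" .
  then have "(local_rep N N' i j f has_derivative chart_differential N N' i j f p) (at ?x within ?F)"
    unfolding chart_differential_def frechet_derivative_works[symmetric] by (auto simp: differentiable_def)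
  then show ?thesis
    by (rule has_derivative_within_subspace_unique[OF regular_atlasD(1)[OF N] x(1) v _ *])
qed

lemma chart_germ_extension_cong:
  assumes "chart_germ N N' i j f p V g" "lift_smooth V h" "\<And>v. v \<in> V \<Longrightarrow> v \<in> model N \<Longrightarrow> g v = h v"
  shows "chart_germ N N' i j f p V h"
  using assms unfolding chart_germ_def by (metis IntE)

lemma chart_germ_cong:
  assumes N: "regular_atlas N" and i: "i \<in> index N" and g: "chart_germ N N' i j f p V g"
    and eq: "\<And>q. q \<in> carrier N \<Longrightarrow> f q = h q"
  shows "chart_germ N N' i j h p V g"
proof -
  have "f q = h q" if "q \<in> chart_dom N i" for q using eq regular_atlasD(5)[OF N i that] .
  then show ?thesis using g unfolding chart_germ_def by metis
qed

lemma smooth_between_cong: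
  assumes N: "regular_atlas N" and f: "smooth_between N N' f"
    and eq: "\<And>q. q \<in> carrier N \<Longrightarrow> f q = h q"
  shows "smooth_between N N' h"
  unfolding smooth_between_def
proof (intro conjI ballI impI)
  show "h ` carrier N \<subseteq> carrier N'" using f eq by (force simp: smooth_between_def)
  fix i j p assume *: "i \<in> index N" "j \<in> index N'" "p \<in> chart_dom N i" "h p \<in> chart_dom N' j"
  then have "f p \<in> chart_dom N' j" using eq regular_atlasD(5)[OF N] by metis
  then obtain V g where "chart_germ N N' i j f p V g" using smooth_betweenD(2)[OF f *(1-3)] by blast
  then have "chart_germ N N' i j h p V g" by (rule chart_germ_cong[OF N *(1)]) (rule eq)
  then show "\<exists>V g. chart_germ N N' i j h p V g" by blast
qed

lemma chart_germ_compose: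
  assumes N: "regular_atlas N" "i \<in> index N" and N': "regular_atlas N'" "j \<in> index N'"
    and g: "chart_germ N N' i j f p V g" and k: "chart_germ N' N'' j k h (f p) W k'"
  shows "chart_germ N N'' i k (h \<circ> f) p (V \<inter> g -` W) (\<lambda>v. k' (g v))"
  unfolding chart_germ_def
proof (intro conjI ballI)
  show "lift_smooth (V \<inter> g -` W) (\<lambda>v. k' (g v))"
    by (rule lift_smooth_compose[OF chart_germD(1)[OF g] chart_germD(1)[OF k]])
  show p: "p \<in> chart_dom N i" by (rule chart_germD(2)[OF g])
  show "chart N i p \<in> V \<inter> g -` W"
    using chart_germ_apply(2)[OF N g p chart_germD(3)[OF g]] chart_germD(3)[OF g] chart_germD(3)[OF k] by auto
  fix v assume v: "v \<in> (V \<inter> g -` W) \<inter> model N"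
  then obtain q where q: "q \<in> chart_dom N i" "chart N i q = v" "f q \<in> chart_dom N' j" "chart N' j (f q) = g v"
    using chart_germD(4)[OF g] by blast
  with chart_germ_apply[OF N' k q(3)] v
  show "\<exists>q\<in>chart_dom N i. chart N i q = v \<and> (h \<circ> f) q \<in> chart_dom N'' k \<and> chart N'' k ((h \<circ> f) q) = k' (g v)"
    by auto
qed

lemma smooth_between_compose:
  assumes N: "regular_atlas N" and N': "regular_atlas N'"
    and f: "smooth_between N N' f" and h: "smooth_between N' N'' h"
  shows "smooth_between N N'' (h \<circ> f)"
  unfolding smooth_between_def
proof (intro conjI ballI impI)
  show "(h \<circ> f) ` carrier N \<subseteq> carrier N''" using smooth_betweenD(1)[OF f] smooth_betweenD(1)[OF h] by auto
  fix i k p assume *: "i \<in> index N" "k \<in> index N''" "p \<in> chart_dom N i" "(h \<circ> f) p \<in> chart_dom N'' k"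
  then have "f p \<in> carrier N'" using smooth_betweenD(1)[OF f] regular_atlasD(5)[OF N] by blast
  then obtain j where j: "j \<in> index N'" "f p \<in> chart_dom N' j" using regular_atlasD(4)[OF N'] by blast
  obtain V g W k' where "chart_germ N N' i j f p V g" "chart_germ N' N'' j k h (f p) W k'"
    using smooth_betweenD(2)[OF f *(1) j(1) *(3) j(2)] smooth_betweenD(2)[OF h j(1) *(2) j(2)] * by auto
  from chart_germ_compose[OF N *(1) N' j(1) this] show "\<exists>V g. chart_germ N N'' i k (h \<circ> f) p V g" by blast
qed

lemma chart_differential_mem:
  assumes N: "regular_atlas N" and N': "regular_atlas N'" and f: "smooth_between N N' f"
    and ij: "i \<in> index N" "j \<in> index N'" "p \<in> chart_dom N i" "f p \<in> chart_dom N' j" and v: "v \<in> model N"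
  shows "chart_differential N N' i j f p v \<in> model N'"
proof -
  obtain V g where g: "chart_germ N N' i j f p V g" using smooth_betweenD(2)[OF f ij] by blast
  note V = chart_germD(1,3)[OF g]
  show ?thesis unfolding chart_differential_eq[OF N ij(1) g v]
  proof (rule derivative_in_closed_subspace[OF lift_smooth_has_derivative[OF V] lift_smoothD(1)[OF V(1)] V(2)])
    show "g u \<in> model N'" if "u \<in> V" "u \<in> model N" for u
      using chart_germD(4)[OF g that] regular_atlasD(6)[OF N' ij(2)] by metis
  qed (use regular_atlasD[OF N] regular_atlasD[OF N'] ij v in auto)
qed

text \<open>The chain rule for the extensions, translated back on model vectors. The intermediate
  vector has to lie in the model of \<open>N'\<close>, which \<open>chart_differential_mem\<close>
  provides.\<close>

lemma chart_differential_compose: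
  assumes N: "regular_atlas N" and N': "regular_atlas N'"
    and f: "smooth_between N N' f" and h: "smooth_between N' N'' h"
    and i: "i \<in> index N" "p \<in> chart_dom N i" and j: "j \<in> index N'" "f p \<in> chart_dom N' j"
    and k: "k \<in> index N''" "h (f p) \<in> chart_dom N'' k" and v: "v \<in> model N"
  shows "chart_differential N N'' i k (h \<circ> f) p v
    = chart_differential N' N'' j k h (f p) (chart_differential N N' i j f p v)"
proof -
  obtain V g where g: "chart_germ N N' i j f p V g" using smooth_betweenD(2)[OF f i(1) j(1) i(2) j(2)] by blast
  obtain W l where l: "chart_germ N' N'' j k h (f p) W l" using smooth_betweenD(2)[OF h j(1) k(1) j(2) k(2)] by blast
  have gx: "g (chart N i p) = chart N' j (f p)"
    using chart_germ_apply(2)[OF N i(1) g i(2) chart_germD(3)[OF g]] by simp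
  have "((\<lambda>v. l (g v)) has_derivative (\<lambda>h. frechet_derivative l (at (g (chart N i p))) (frechet_derivative g (at (chart N i p)) h)))
      (at (chart N i p))"
    using has_derivative_compose[OF lift_smooth_has_derivative[OF chart_germD(1,3)[OF g]], of l]
      lift_smooth_has_derivative[OF chart_germD(1,3)[OF l]] gx by simp
  from frechet_derivative_eq[OF this] show ?thesis
    using chart_differential_eq[OF N i(1) chart_germ_compose[OF N i(1) N' j(1) g l] v]
      chart_differential_eq[OF N i(1) g v]
      chart_differential_eq[OF N' j(1) l chart_differential_mem[OF N N' f i(1) j(1) i(2) j(2) v]] gx
    by simp
qed

lemma chart_differential_cong:
  assumes N: "regular_atlas N" and f: "smooth_between N N' f" and eq: "\<And>q. q \<in> carrier N \<Longrightarrow> f q = h q"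
    and ij: "i \<in> index N" "j \<in> index N'" "p \<in> chart_dom N i" "f p \<in> chart_dom N' j" and v: "v \<in> model N"
  shows "chart_differential N N' i j f p v = chart_differential N N' i j h p v"
proof -
  obtain V g where g: "chart_germ N N' i j f p V g" using smooth_betweenD(2)[OF f ij] by blast
  show ?thesis
    using chart_differential_eq[OF N ij(1) g v] chart_differential_eq[OF N ij(1) chart_germ_cong[OF N ij(1) g, where h = h, OF eq] v] by simp
qed

text \<open>An extension of the identity is known only on the model; there it may be traded for the
  identity of the ambient space, whose derivative is immediate.\<close>

lemma chart_differential_id:
  assumes N: "regular_atlas N" and i: "i \<in> index N" "p \<in> chart_dom N i" and v: "v \<in> model N"
  shows "chart_differential N N i i id p v = v"
proof -
  obtain V g where g: "chart_germ N N i i id p V g"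
    using smooth_betweenD(2)[OF regular_atlasD(3)[OF N] i(1) i(1) i(2)] i by auto
  have "g u = u" if "u \<in> V" "u \<in> model N" for u
    using chart_germD(4)[OF g that] by auto
  moreover have "lift_smooth V (\<lambda>v. v)"
    by (rule lift_smooth_linear[OF bounded_linear_ident lift_smoothD(1)[OF chart_germD(1)[OF g]]])
  ultimately have "chart_germ N N i i id p V (\<lambda>v. v)" by (intro chart_germ_extension_cong[OF g])
  from chart_differential_eq[OF N i(1) this v] show ?thesis
    by (simp add: frechet_derivative_eq[OF has_derivative_ident])
qed

section \<open>Tangent vectors and their components\<close>

lemma Tan_in_tangent_carrier_iff:
  "Tan p \<xi> \<in> tangent_carrier N \<longleftrightarrow> p \<in> carrier N \<and>
     (\<forall>i. i \<in> index N \<longrightarrow> p \<in> chart_dom N i \<longrightarrow> \<xi> i \<in> model N) \<and>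
     (\<forall>i. \<not> (i \<in> index N \<and> p \<in> chart_dom N i) \<longrightarrow> \<xi> i = 0) \<and>
     (\<forall>i j. i \<in> index N \<longrightarrow> j \<in> index N \<longrightarrow> p \<in> chart_dom N i \<longrightarrow> p \<in> chart_dom N j \<longrightarrow>
        \<xi> j = chart_differential N N i j id p (\<xi> i))"
  unfolding tangent_carrier_def chart_differential_def by auto

lemma tangent_carrierE:
  assumes "q \<in> tangent_carrier N"
  obtains p \<xi> where "q = Tan p \<xi>" "Tan p \<xi> \<in> tangent_carrier N" "p \<in> carrier N"
  using assms unfolding tangent_carrier_def by blast

lemma tangent_bundle_simps [simp]:
  "carrier (tangent_bundle N) = tangent_carrier N"
  "index (tangent_bundle N) = index N"
  "q \<in> chart_dom (tangent_bundle N) i \<longleftrightarrow> q \<in> tangent_carrier N \<and> foot q \<in> chart_dom N i"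
  "chart (tangent_bundle N) i q = vpair (chart N i (foot q)) (comps q i)"
  "v \<in> model (tangent_bundle N) \<longleftrightarrow> vfst v \<in> model N \<and> vsnd v \<in> model N"
  unfolding tangent_bundle_def by (auto, metis vpair_vfst_vsnd)

lemma foot_in_carrier: "q \<in> tangent_carrier N \<Longrightarrow> foot q \<in> carrier N"
  by (auto elim: tangent_carrierE)

lemma
  assumes "q \<in> tangent_carrier N"
  shows comps_in_model: "i \<in> index N \<Longrightarrow> foot q \<in> chart_dom N i \<Longrightarrow> comps q i \<in> model N"
    and comps_zero: "\<not> (i \<in> index N \<and> foot q \<in> chart_dom N i) \<Longrightarrow> comps q i = 0"
    and comps_transition: "i \<in> index N \<Longrightarrow> j \<in> index N \<Longrightarrow> foot q \<in> chart_dom N i \<Longrightarrow>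
      foot q \<in> chart_dom N j \<Longrightarrow> comps q j = chart_differential N N i j id (foot q) (comps q i)"
proof -
  obtain p \<xi> where q: "q = Tan p \<xi>" and "Tan p \<xi> \<in> tangent_carrier N"
    using assms by (rule tangent_carrierE)
  note * = iffD1[OF Tan_in_tangent_carrier_iff this(2)]
  show "i \<in> index N \<Longrightarrow> foot q \<in> chart_dom N i \<Longrightarrow> comps q i \<in> model N"
    "\<not> (i \<in> index N \<and> foot q \<in> chart_dom N i) \<Longrightarrow> comps q i = 0"
    "i \<in> index N \<Longrightarrow> j \<in> index N \<Longrightarrow> foot q \<in> chart_dom N i \<Longrightarrow>
      foot q \<in> chart_dom N j \<Longrightarrow> comps q j = chart_differential N N i j id (foot q) (comps q i)"
    unfolding q tpoint.sel using * by blast+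
qed

text \<open>One component fixes all others: in charts at the foot by the transition rule, elsewhere
  by the default value 0.\<close>

lemma tangent_vector_eqI:
  assumes q: "q \<in> tangent_carrier N" "r \<in> tangent_carrier N" and foot: "foot q = foot r"
    and i: "i \<in> index N" "foot q \<in> chart_dom N i" and eq: "comps q i = comps r i"
  shows "q = r"
proof -
  have "comps q j = comps r j" for j
  proof (cases "j \<in> index N \<and> foot q \<in> chart_dom N j")
    case True
    then show ?thesis
      using comps_transition[OF q(1) i(1) _ i(2)] comps_transition[OF q(2) i(1) _ i(2)[unfolded foot]] foot eq by metis
  next
    case False
    then show ?thesis using comps_zero[OF q(1)] comps_zero[OF q(2)] foot by simp
  qed
  then have "comps q = comps r" ..
  moreover obtain p \<xi> where "q = Tan p \<xi>" by (rule tangent_carrierE[OF q(1)])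
  moreover obtain p' \<xi>' where "r = Tan p' \<xi>'" by (rule tangent_carrierE[OF q(2)])
  ultimately show ?thesis using foot by simp
qed

text \<open>The transition rule for the image components is the chain rule for
  \<open>id \<circ> f\<close>.\<close>

lemma differential_in_tangent_carrier:
  assumes N: "regular_atlas N" and N': "regular_atlas N'" and f: "smooth_between N N' f"
    and i: "i \<in> index N" "p \<in> chart_dom N i" and v: "v \<in> model N"
  shows "Tan (f p) (\<lambda>j. if j \<in> index N' \<and> f p \<in> chart_dom N' j then chart_differential N N' i j f p v else 0)
    \<in> tangent_carrier N'" (is "Tan _ ?\<xi> \<in> _")
proof -
  have "f p \<in> carrier N'" using smooth_betweenD(1)[OF f] regular_atlasD(5)[OF N i] by blast
  have compose: "chart_differential N N' i k f p v
      = chart_differential N' N' j k id (f p) (chart_differential N N' i j f p v)"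
    if "j \<in> index N'" "k \<in> index N'" "f p \<in> chart_dom N' j" "f p \<in> chart_dom N' k" for j k
    using chart_differential_compose[OF N N' f regular_atlasD(3)[OF N'] i that(1,3) that(2) _ v] that(4)
    unfolding id_comp id_apply by blast
  have \<xi>: "?\<xi> j = chart_differential N N' i j f p v" if "j \<in> index N'" "f p \<in> chart_dom N' j" for j
    using that by simp
  have transition: "?\<xi> k = chart_differential N' N' j k id (f p) (?\<xi> j)"
    if "j \<in> index N'" "k \<in> index N'" "f p \<in> chart_dom N' j" "f p \<in> chart_dom N' k" for j k
    unfolding \<xi>[OF that(1,3)] \<xi>[OF that(2,4)] by (rule compose[OF that])
  have model: "?\<xi> j \<in> model N'" if "j \<in> index N'" "f p \<in> chart_dom N' j" for j
    unfolding \<xi>[OF that] by (rule chart_differential_mem[OF N N' f i(1) that(1) i(2) that(2) v])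
  show ?thesis
    unfolding Tan_in_tangent_carrier_iff
  proof (intro conjI allI impI)
    show "f p \<in> carrier N'" by fact
    show "?\<xi> j = 0" if "\<not> (j \<in> index N' \<and> f p \<in> chart_dom N' j)" for j by (rule if_not_P[OF that])
  qed (fact model transition)+
qed

text \<open>The prescribed component is spread over all charts by the differential of the
  identity.\<close>

lemma tangent_vector_exists:
  assumes N: "regular_atlas N" and i: "i \<in> index N" "p \<in> chart_dom N i" and v: "v \<in> model N"
  shows "\<exists>q \<in> tangent_carrier N. foot q = p \<and> comps q i = v"
  by (rule bexI[OF _ differential_in_tangent_carrier[OF N N regular_atlasD(3)[OF N] i v]])
     (simp add: i chart_differential_id[OF N i v])

section \<open>Tangent maps and functoriality\<close>

lemma tangent_map_eq:
  assumes N: "regular_atlas N" and q: "q \<in> tangent_carrier N"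
  obtains i where "i \<in> index N" "foot q \<in> chart_dom N i"
    "tangent_map N N' f q = Tan (f (foot q)) (\<lambda>j. if j \<in> index N' \<and> f (foot q) \<in> chart_dom N' j
        then chart_differential N N' i j f (foot q) (comps q i) else 0)"
proof -
  define i where "i = (SOME i. i \<in> index N \<and> foot q \<in> chart_dom N i)"
  have "\<exists>i. i \<in> index N \<and> foot q \<in> chart_dom N i" using regular_atlasD(4)[OF N foot_in_carrier[OF q]] by blast
  from someI_ex[OF this] have "i \<in> index N \<and> foot q \<in> chart_dom N i" unfolding i_def .
  with that show thesis
    unfolding tangent_map_def chart_differential_def Let_def i_def[symmetric] by blast
qed

lemma foot_tangent_map [simp]: "foot (tangent_map N N' f q) = f (foot q)"
  by (simp add: tangent_map_def Let_def)

lemma tangent_map_mem: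
  assumes N: "regular_atlas N" and N': "regular_atlas N'" and f: "smooth_between N N' f"
    and q: "q \<in> tangent_carrier N"
  shows "tangent_map N N' f q \<in> tangent_carrier N'"
proof -
  obtain i where i: "i \<in> index N" "foot q \<in> chart_dom N i"
    "tangent_map N N' f q = Tan (f (foot q)) (\<lambda>j. if j \<in> index N' \<and> f (foot q) \<in> chart_dom N' j
        then chart_differential N N' i j f (foot q) (comps q i) else 0)" by (rule tangent_map_eq[OF N q])
  show ?thesis unfolding i(3)
    by (rule differential_in_tangent_carrier[OF N N' f i(1,2) comps_in_model[OF q i(1,2)]])
qed

text \<open>Independence of the chart picked in the definition: the chain rule for
  \<open>f \<circ> id\<close> passes from the chosen chart \<open>k\<close> to \<open>i\<close>, and
  the transition rule identifies the component in \<open>i\<close>.\<close>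

lemma comps_tangent_map:
  assumes N: "regular_atlas N" and f: "smooth_between N N' f" and q: "q \<in> tangent_carrier N"
    and ij: "i \<in> index N" "j \<in> index N'" "foot q \<in> chart_dom N i" "f (foot q) \<in> chart_dom N' j"
  shows "comps (tangent_map N N' f q) j = chart_differential N N' i j f (foot q) (comps q i)"
proof -
  obtain k where k: "k \<in> index N" "foot q \<in> chart_dom N k"
    "tangent_map N N' f q = Tan (f (foot q)) (\<lambda>j. if j \<in> index N' \<and> f (foot q) \<in> chart_dom N' j
        then chart_differential N N' k j f (foot q) (comps q k) else 0)" by (rule tangent_map_eq[OF N q])
  have "chart_differential N N' k j f (foot q) (comps q k)
      = chart_differential N N' i j f (foot q) (chart_differential N N k i id (foot q) (comps q k))"
    using chart_differential_compose[OF N N regular_atlasD(3)[OF N] f k(1,2) ij(1) _ ij(2) _ comps_in_model[OF q k(1,2)]]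
      ij by simp
  also have "chart_differential N N k i id (foot q) (comps q k) = comps q i"
    using comps_transition[OF q k(1) ij(1) k(2) ij(3)] by simp
  finally show ?thesis using k ij by simp
qed

lemma tangent_map_eqI:
  assumes N: "regular_atlas N" and N': "regular_atlas N'" and f: "smooth_between N N' f"
    and q: "q \<in> tangent_carrier N" and r: "r \<in> tangent_carrier N'" "foot r = f (foot q)"
    and ij: "i \<in> index N" "j \<in> index N'" "foot q \<in> chart_dom N i" "f (foot q) \<in> chart_dom N' j"
    and eq: "comps r j = chart_differential N N' i j f (foot q) (comps q i)"
  shows "tangent_map N N' f q = r"
  by (rule tangent_vector_eqI[OF tangent_map_mem[OF N N' f q] r(1) _ ij(2)])
     (use ij r eq comps_tangent_map[OF N f q ij] in auto)

lemma charts_at: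
  assumes N: "regular_atlas N" and N': "regular_atlas N'" and f: "smooth_between N N' f"
    and q: "q \<in> tangent_carrier N"
  obtains i j where "i \<in> index N" "j \<in> index N'" "foot q \<in> chart_dom N i" "f (foot q) \<in> chart_dom N' j"
  using regular_atlasD(4)[OF N foot_in_carrier[OF q]]
    regular_atlasD(4)[OF N' smooth_betweenD(1)[OF f foot_in_carrier[OF q]]] that by blast

lemma tangent_map_compose:
  assumes N: "regular_atlas N" and N': "regular_atlas N'" and N'': "regular_atlas N''"
    and f: "smooth_between N N' f" and h: "smooth_between N' N'' h" and q: "q \<in> tangent_carrier N"
  shows "tangent_map N N'' (h \<circ> f) q = tangent_map N' N'' h (tangent_map N N' f q)"
proof -
  note q' = tangent_map_mem[OF N N' f q]
  obtain i j where ij: "i \<in> index N" "j \<in> index N'" "foot q \<in> chart_dom N i" "f (foot q) \<in> chart_dom N' j"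
    by (rule charts_at[OF N N' f q])
  obtain k where k: "k \<in> index N''" "h (f (foot q)) \<in> chart_dom N'' k"
    using regular_atlasD(4)[OF N''] smooth_betweenD(1)[OF h] smooth_betweenD(1)[OF f foot_in_carrier[OF q]] by blast
  show ?thesis
  proof (rule tangent_map_eqI[OF N N'' smooth_between_compose[OF N N' f h] q tangent_map_mem[OF N' N'' h q'] _ ij(1) k(1) ij(3)])
    show "comps (tangent_map N' N'' h (tangent_map N N' f q)) k
        = chart_differential N N'' i k (h \<circ> f) (foot q) (comps q i)"
      using comps_tangent_map[OF N' h q' ij(2) k(1)] comps_tangent_map[OF N f q ij] ij k
        chart_differential_compose[OF N N' f h ij(1,3,2,4) k comps_in_model[OF q ij(1,3)]] by simp
  qed (use k in auto)
qed

text \<open>Identities such as the involution being its own inverse hold on carriers only; this is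
  what allows them to be used under D.\<close>

lemma tangent_map_cong:
  assumes N: "regular_atlas N" and N': "regular_atlas N'" and f: "smooth_between N N' f"
    and eq: "\<And>p. p \<in> carrier N \<Longrightarrow> f p = h p" and q: "q \<in> tangent_carrier N"
  shows "tangent_map N N' f q = tangent_map N N' h q"
proof -
  obtain i j where ij: "i \<in> index N" "j \<in> index N'" "foot q \<in> chart_dom N i" "f (foot q) \<in> chart_dom N' j"
    by (rule charts_at[OF N N' f q])
  note h = smooth_between_cong[OF N f eq] and fh = eq[OF foot_in_carrier[OF q]]
  show ?thesis
    by (rule tangent_map_eqI[OF N N' f q tangent_map_mem[OF N N' h q] _ ij])
       (use comps_tangent_map[OF N h q ij(1-3)] ij fh chart_differential_cong[OF N f eq ij comps_in_model[OF q ij(1,3)]] in auto)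
qed

lemma tangent_map_id:
  assumes N: "regular_atlas N" and q: "q \<in> tangent_carrier N"
  shows "tangent_map N N id q = q"
proof -
  obtain i where i: "i \<in> index N" "foot q \<in> chart_dom N i"
    using regular_atlasD(4)[OF N foot_in_carrier[OF q]] by blast
  show ?thesis
    by (rule tangent_map_eqI[OF N N regular_atlasD(3)[OF N] q q, of i i])
       (use i chart_differential_id[OF N i comps_in_model[OF q i]] in auto)
qed

text \<open>The lifted extension serves for Df, so extensions pass up the tower of tangent bundles
  with no further retractions.\<close>

lemma chart_germ_tangent_map:
  assumes N: "regular_atlas N" and N': "regular_atlas N'" and f: "smooth_between N N' f"
    and ij: "i \<in> index N" "j \<in> index N'" and g: "chart_germ N N' i j f (foot q) V g" and q: "q \<in> tangent_carrier N"
  shows "chart_germ (tangent_bundle N) (tangent_bundle N') i j (tangent_map N N' f) q (vfst -` V) (tangent_lift g)"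
  unfolding chart_germ_def
proof (intro conjI ballI)
  show "lift_smooth (vfst -` V) (tangent_lift g)" by (rule lift_smoothD(3)[OF chart_germD(1)[OF g]])
  show "q \<in> chart_dom (tangent_bundle N) i" "chart (tangent_bundle N) i q \<in> vfst -` V"
    using q chart_germD[OF g] by auto
  fix v assume v: "v \<in> vfst -` V \<inter> model (tangent_bundle N)"
  then have "vfst v \<in> V" "vfst v \<in> model N" "vsnd v \<in> model N" by auto
  then obtain p where p: "p \<in> chart_dom N i" "chart N i p = vfst v" "f p \<in> chart_dom N' j" "chart N' j (f p) = g (vfst v)"
    using chart_germD(4)[OF g] by blast
  obtain r where r: "r \<in> tangent_carrier N" "foot r = p" "comps r i = vsnd v"
    using tangent_vector_exists[OF N ij(1) p(1) \<open>vsnd v \<in> model N\<close>] by blast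
  have g': "chart_germ N N' i j f p V g" using g p \<open>vfst v \<in> V\<close> by (simp add: chart_germ_def)
  show "\<exists>q\<in>chart_dom (tangent_bundle N) i. chart (tangent_bundle N) i q = v \<and>
      tangent_map N N' f q \<in> chart_dom (tangent_bundle N') j \<and>
      chart (tangent_bundle N') j (tangent_map N N' f q) = tangent_lift g v"
  proof (intro bexI conjI)
    show "chart (tangent_bundle N) i r = v" using r p by simp
    show "tangent_map N N' f r \<in> chart_dom (tangent_bundle N') j" using tangent_map_mem[OF N N' f r(1)] p r by simp
    have "comps (tangent_map N N' f r) j = frechet_derivative g (at (vfst v)) (vsnd v)"
      using comps_tangent_map[OF N f r(1) ij] chart_differential_eq[OF N ij(1) g' \<open>vsnd v \<in> model N\<close>] p r by simp
    then show "chart (tangent_bundle N') j (tangent_map N N' f r) = tangent_lift g v"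
      using p r by (simp add: tangent_lift_def)
  qed (use r p in simp)
qed

lemma smooth_between_tangent_map:
  assumes N: "regular_atlas N" and N': "regular_atlas N'" and f: "smooth_between N N' f"
  shows "smooth_between (tangent_bundle N) (tangent_bundle N') (tangent_map N N' f)"
  unfolding smooth_between_def
proof (intro conjI ballI impI)
  show "tangent_map N N' f ` carrier (tangent_bundle N) \<subseteq> carrier (tangent_bundle N')"
    using tangent_map_mem[OF N N' f] by auto
  fix i j q assume *: "i \<in> index (tangent_bundle N)" "j \<in> index (tangent_bundle N')"
    "q \<in> chart_dom (tangent_bundle N) i" "tangent_map N N' f q \<in> chart_dom (tangent_bundle N') j"
  then obtain V g where "chart_germ N N' i j f (foot q) V g"
    using smooth_betweenD(2)[OF f, of i j "foot q"] by auto
  from chart_germ_tangent_map[OF N N' f _ _ this] *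
  show "\<exists>V g. chart_germ (tangent_bundle N) (tangent_bundle N') i j (tangent_map N N' f) q V g" by auto
qed

text \<open>Transition functions of the tangent bundle are tangent lifts of those below, because D
  of the identity is the identity on the carrier.\<close>

lemma chart_germ_tangent_bundle_id:
  assumes N: "regular_atlas N" and ij: "i \<in> index N" "j \<in> index N" and q: "q \<in> tangent_carrier N"
    and g: "chart_germ N N i j id (foot q) V g"
  shows "chart_germ (tangent_bundle N) (tangent_bundle N) i j id q (vfst -` V) (tangent_lift g)"
  using chart_germ_tangent_map[OF N N regular_atlasD(3)[OF N] ij g q] tangent_map_id[OF N]
  by (simp add: chart_germ_def)

lemma regular_atlas_tangent_bundle:
  assumes N: "regular_atlas N"
  shows "regular_atlas (tangent_bundle N)"
  unfolding regular_atlas_def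
proof (intro conjI ballI)
  have model: "model (tangent_bundle N) = vfst -` model N \<inter> vsnd -` model N" by auto
  show "subspace (model (tangent_bundle N))"
    unfolding model using regular_atlasD(1)[OF N]
    by (intro subspace_inter linear_subspace_vimage bounded_linear.linear bounded_linear_vfst bounded_linear_vsnd)
  show "closed (model (tangent_bundle N))"
    unfolding model using regular_atlasD(2)[OF N]
    by (intro closed_Int closed_vimage continuous_on_vfst continuous_on_vsnd)
  show "(\<Union>i\<in>index (tangent_bundle N). chart_dom (tangent_bundle N) i) = carrier (tangent_bundle N)"
    using regular_atlasD(4)[OF N foot_in_carrier] by auto
  show "inj_on (chart (tangent_bundle N) i) (chart_dom (tangent_bundle N) i)" if i: "i \<in> index (tangent_bundle N)" for i
  proof (rule inj_onI)
    fix q r assume "q \<in> chart_dom (tangent_bundle N) i" "r \<in> chart_dom (tangent_bundle N) i"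
      "chart (tangent_bundle N) i q = chart (tangent_bundle N) i r"
    with i regular_atlasD(7)[OF N, of i "foot q" "foot r"] show "q = r"
      by (intro tangent_vector_eqI[of q N r i]) (auto simp: vpair_eq_iff)
  qed
  show "chart (tangent_bundle N) i ` chart_dom (tangent_bundle N) i \<subseteq> model (tangent_bundle N)"
    if i: "i \<in> index (tangent_bundle N)" for i
    using i regular_atlasD(6)[OF N] comps_in_model by auto
  show "smooth_between (tangent_bundle N) (tangent_bundle N) id"
    unfolding smooth_between_def
  proof (intro conjI ballI impI)
    fix i j q assume *: "i \<in> index (tangent_bundle N)" "j \<in> index (tangent_bundle N)"
      "q \<in> chart_dom (tangent_bundle N) i" "id q \<in> chart_dom (tangent_bundle N) j"
    then obtain V g where "chart_germ N N i j id (foot q) V g"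
      using smooth_betweenD(2)[OF regular_atlasD(3)[OF N], of i j "foot q"] by auto
    with chart_germ_tangent_bundle_id[OF N _ _ _ this] *
    show "\<exists>V g. chart_germ (tangent_bundle N) (tangent_bundle N) i j id q V g" by auto
  qed simp
qed

section \<open>The canonical involution and complete lifts\<close>

lemma chart_flip_vflip:
  "chart (tangent_bundle (tangent_bundle N)) i (flip (Tan (Tan p \<xi>) \<eta>))
     = vflip (chart (tangent_bundle (tangent_bundle N)) i (Tan (Tan p \<xi>) \<eta>))"
  by (simp add: vflip_def)

lemma tangent_carrier2E:
  assumes "q \<in> tangent_carrier (tangent_bundle N)"
  obtains p \<xi> \<eta> where "q = Tan (Tan p \<xi>) \<eta>" "Tan p \<xi> \<in> tangent_carrier N" "p \<in> carrier N"
proof -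
  obtain r \<eta> where r: "q = Tan r \<eta>" "r \<in> carrier (tangent_bundle N)"
    by (rule tangent_carrierE[OF assms])
  then have "r \<in> tangent_carrier N" by simp
  then obtain p \<xi> where "r = Tan p \<xi>" "Tan p \<xi> \<in> tangent_carrier N" "p \<in> carrier N" by (rule tangent_carrierE)
  with r that show thesis by blast
qed

lemma foot_foot_flip: "q \<in> tangent_carrier (tangent_bundle N) \<Longrightarrow> foot (foot (flip q)) = foot (foot q)"
  by (auto elim: tangent_carrier2E)

lemma flip_flip: "q \<in> tangent_carrier (tangent_bundle N) \<Longrightarrow> flip (flip q) = q"
  by (auto elim: tangent_carrier2E)

text \<open>Transition functions of the second tangent bundle are represented by double lifts;
  evaluating the doubly lifted germ at \<open>q\<close> itself gives the formula.\<close>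

lemma chart_transition2:
  assumes N: "regular_atlas N" and ij: "i \<in> index N" "j \<in> index N"
    and q: "q \<in> tangent_carrier (tangent_bundle N)"
    and foot: "foot (foot q) = p" "p \<in> chart_dom N i" and g: "chart_germ N N i j id p V g"
  shows "chart (tangent_bundle (tangent_bundle N)) j q
    = tangent_lift (tangent_lift g) (chart (tangent_bundle (tangent_bundle N)) i q)"
proof -
  have fq: "foot q \<in> tangent_carrier N" using foot_in_carrier[OF q] by simp
  have "chart_germ (tangent_bundle N) (tangent_bundle N) i j id (foot q) (vfst -` V) (tangent_lift g)"
    by (rule chart_germ_tangent_bundle_id[OF N ij fq]) (simp add: foot g)
  then have "chart_germ (tangent_bundle (tangent_bundle N)) (tangent_bundle (tangent_bundle N)) i j id q
      (vfst -` (vfst -` V)) (tangent_lift (tangent_lift g))"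
    by (intro chart_germ_tangent_bundle_id[OF regular_atlas_tangent_bundle[OF N] _ _ q]) (use ij in auto)
  from chart_germ_apply(2)[OF regular_atlas_tangent_bundle[OF regular_atlas_tangent_bundle[OF N]] _ this chart_germD(2,3)[OF this]]
  show ?thesis using ij by simp
qed

text \<open>
  The components of \<open>flip q\<close> transform correctly because the second derivatives of the transition
  maps are symmetric.
\<close>

lemma flip_in_tangent_carrier:
  assumes N: "regular_atlas N" and q: "q \<in> tangent_carrier (tangent_bundle N)"
  shows "flip q \<in> tangent_carrier (tangent_bundle N)"
proof -
  obtain p \<xi> \<eta> where q_eq: "q = Tan (Tan p \<xi>) \<eta>" and p\<xi>: "Tan p \<xi> \<in> tangent_carrier N" and p: "p \<in> carrier N"
    using q by (rule tangent_carrier2E)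
  note TN = regular_atlas_tangent_bundle[OF N]
  obtain i where i: "i \<in> index N" "p \<in> chart_dom N i" using regular_atlasD(4)[OF N p] by blast
  have \<xi>i: "\<xi> i \<in> model N" using comps_in_model[OF p\<xi> i(1)] i by simp
  have \<eta>i: "vfst (\<eta> i) \<in> model N" "vsnd (\<eta> i) \<in> model N"
    using comps_in_model[OF q, of i] i p\<xi> by (auto simp: q_eq)
  \<comment> \<open>\<open>r\<close> and \<open>s\<close> are candidates for the foot and the whole
    of \<open>flip q\<close>, prescribed in the single chart \<open>i\<close>. They are tangent
    vectors by construction; it remains to compare all their components with those of
    \<open>flip q\<close>.\<close>
  obtain r where r: "r \<in> tangent_carrier N" "foot r = p" "comps r i = vfst (\<eta> i)"
    using tangent_vector_exists[OF N i \<eta>i(1)] by blast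
  obtain s where s: "s \<in> tangent_carrier (tangent_bundle N)" "foot s = r" "comps s i = vpair (\<xi> i) (vsnd (\<eta> i))"
    using tangent_vector_exists[OF TN, of i r "vpair (\<xi> i) (vsnd (\<eta> i))"] i r \<xi>i \<eta>i by auto
  have "comps r j = vfst (\<eta> j) \<and> comps s j = vpair (\<xi> j) (vsnd (\<eta> j))" for j
  proof (cases "j \<in> index N \<and> p \<in> chart_dom N j")
    case True
    then obtain V g where g: "chart_germ N N i j id p V g"
      using smooth_betweenD(2)[OF regular_atlasD(3)[OF N] i(1) _ i(2), of j] by auto
    let ?c = "chart (tangent_bundle (tangent_bundle N))"
    have "?c j s = tangent_lift (tangent_lift g) (?c i s)"
      by (rule chart_transition2[OF N i(1) _ s(1) _ i(2) g]) (use True r s in auto)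
    also have "?c i s = vflip (?c i q)" using r s by (simp add: vflip_def q_eq)
    also have "tangent_lift (tangent_lift g) (vflip (?c i q)) = vflip (tangent_lift (tangent_lift g) (?c i q))"
      by (rule tangent_lift_vflip[OF chart_germD(1)[OF g]]) (use chart_germD(3)[OF g] in \<open>simp add: q_eq\<close>)
    also have "tangent_lift (tangent_lift g) (?c i q) = ?c j q"
      by (rule chart_transition2[OF N i(1) _ q _ i(2) g, symmetric]) (use True in \<open>auto simp: q_eq\<close>)
    finally show ?thesis using r s by (simp add: q_eq vflip_def vpair_eq_iff)
  next
    case False
    then show ?thesis
      using comps_zero[OF p\<xi>, of j] comps_zero[OF q, of j] comps_zero[OF r(1), of j] comps_zero[OF s(1), of j] r s
      by (auto simp: q_eq vfst_zero vsnd_zero vpair_zero)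
  qed
  moreover obtain p' \<xi>' where "r = Tan p' \<xi>'" by (rule tangent_carrierE[OF r(1)])
  moreover obtain r' \<eta>' where "s = Tan r' \<eta>'" by (rule tangent_carrierE[OF s(1)])
  ultimately have "flip q = s" using r s by (auto simp: q_eq fun_eq_iff)
  then show ?thesis using s by simp
qed

text \<open>A transition function followed by \<open>vflip\<close> represents the involution. The
  same charts are available at \<open>q\<close> and at \<open>flip q\<close>, since both have the
  same base point in \<open>N\<close>.\<close>

lemma smooth_between_flip:
  assumes N: "regular_atlas N"
  shows "smooth_between (tangent_bundle (tangent_bundle N)) (tangent_bundle (tangent_bundle N)) flip"
    (is "smooth_between ?T ?T flip")
  unfolding smooth_between_def
proof (intro conjI ballI impI)
  show "flip ` carrier ?T \<subseteq> carrier ?T" using flip_in_tangent_carrier[OF N] by auto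
  fix i j q assume *: "i \<in> index ?T" "j \<in> index ?T" "q \<in> chart_dom ?T i" "flip q \<in> chart_dom ?T j"
  have "q \<in> chart_dom ?T j" using * foot_foot_flip[of q N] foot_in_carrier[of q "tangent_bundle N"] by auto
  then obtain V g where g: "chart_germ ?T ?T i j id q V g"
    using smooth_betweenD(2)[OF regular_atlasD(3)[OF regular_atlas_tangent_bundle[OF regular_atlas_tangent_bundle[OF N]]], of i j q]
      * by (auto simp del: tangent_bundle_simps(3))
  have "chart_germ ?T ?T i j flip q V (\<lambda>v. vflip (g v))"
    unfolding chart_germ_def
  proof (intro conjI ballI)
    show "lift_smooth V (\<lambda>v. vflip (g v))"
      using lift_smooth_compose[OF chart_germD(1)[OF g] lift_smooth_linear[OF bounded_linear_vflip open_UNIV]] by simp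
    show "q \<in> chart_dom ?T i" "chart ?T i q \<in> V" using chart_germD[OF g] by blast+
    fix v assume v: "v \<in> V \<inter> model ?T"
    then obtain r where r: "r \<in> chart_dom ?T i" "chart ?T i r = v" "r \<in> chart_dom ?T j" "chart ?T j r = g v"
      using chart_germD(4)[OF g, of v] by auto
    then have rT: "r \<in> tangent_carrier (tangent_bundle N)" by simp
    then have "chart ?T j (flip r) = vflip (g v)"
      using r(4) chart_flip_vflip by (metis tangent_carrier2E)
    moreover have "flip r \<in> chart_dom ?T j"
      using r(3) flip_in_tangent_carrier[OF N rT] foot_foot_flip[OF rT]
        foot_in_carrier[OF flip_in_tangent_carrier[OF N rT]] by simp
    ultimately show "\<exists>q\<in>chart_dom ?T i. chart ?T i q = v \<and> flip q \<in> chart_dom ?T j \<and> chart ?T j (flip q) = vflip (g v)"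
      using r by blast
  qed
  then show "\<exists>V g. chart_germ ?T ?T i j flip q V g" by blast
qed

section \<open>The bundle projection and its tangent map\<close>

lemma chart_germ_foot:
  assumes N: "regular_atlas N" and ij: "i \<in> index N" and q: "q \<in> tangent_carrier N"
    and g: "chart_germ N N i j id (foot q) V g"
  shows "chart_germ (tangent_bundle N) N i j foot q (vfst -` V) (\<lambda>v. g (vfst v))"
  unfolding chart_germ_def
proof (intro conjI ballI)
  show "lift_smooth (vfst -` V) (\<lambda>v. g (vfst v))"
    using lift_smooth_compose[OF lift_smooth_linear[OF bounded_linear_vfst open_UNIV] chart_germD(1)[OF g]] by simp
  show "q \<in> chart_dom (tangent_bundle N) i" "chart (tangent_bundle N) i q \<in> vfst -` V"
    using q chart_germD[OF g] by auto
  fix v assume v: "v \<in> vfst -` V \<inter> model (tangent_bundle N)"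
  then have "vfst v \<in> V" "vfst v \<in> model N" "vsnd v \<in> model N" by auto
  then obtain p where p: "p \<in> chart_dom N i" "chart N i p = vfst v" "p \<in> chart_dom N j" "chart N j p = g (vfst v)"
    using chart_germD(4)[OF g, of "vfst v"] by auto
  obtain r where "r \<in> tangent_carrier N" "foot r = p" "comps r i = vsnd v"
    using tangent_vector_exists[OF N ij p(1) \<open>vsnd v \<in> model N\<close>] by blast
  then show "\<exists>q\<in>chart_dom (tangent_bundle N) i. chart (tangent_bundle N) i q = v \<and>
      foot q \<in> chart_dom N j \<and> chart N j (foot q) = g (vfst v)"
    using p by (intro bexI[of _ r]) auto
qed

lemma smooth_between_foot:
  assumes N: "regular_atlas N"
  shows "smooth_between (tangent_bundle N) N foot"
  unfolding smooth_between_def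
proof (intro conjI ballI impI)
  show "foot ` carrier (tangent_bundle N) \<subseteq> carrier N" by (auto intro: foot_in_carrier)
  fix i j q assume *: "i \<in> index (tangent_bundle N)" "j \<in> index N" "q \<in> chart_dom (tangent_bundle N) i" "foot q \<in> chart_dom N j"
  then obtain V g where "chart_germ N N i j id (foot q) V g"
    using smooth_betweenD(2)[OF regular_atlasD(3)[OF N], of i j "foot q"] by auto
  from chart_germ_foot[OF N _ _ this] * show "\<exists>V g. chart_germ (tangent_bundle N) N i j foot q V g" by auto
qed

text \<open>In charts the projection is linear, hence its own derivative, so its tangent map sends
  (x, y, X, Y) to (x, X), which is also the foot of the flipped vector.\<close>

lemma tangent_map_foot:
  assumes N: "regular_atlas N" and q: "q \<in> tangent_carrier (tangent_bundle N)"
  shows "tangent_map (tangent_bundle N) N foot q = foot (flip q)"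
proof -
  note TN = regular_atlas_tangent_bundle[OF N]
  have fq: "foot q \<in> tangent_carrier N" using foot_in_carrier[OF q] by simp
  obtain i where i: "i \<in> index N" "foot (foot q) \<in> chart_dom N i"
    using regular_atlasD(4)[OF N foot_in_carrier[OF fq]] by blast
  obtain V g where g: "chart_germ N N i i id (foot (foot q)) V g"
    using smooth_betweenD(2)[OF regular_atlasD(3)[OF N] i(1) i(1) i(2)] i by auto
  have eq: "g (vfst v) = vfst v" if "v \<in> vfst -` V" "v \<in> model (tangent_bundle N)" for v
    using chart_germD(4)[OF g, of "vfst v"] that by auto
  \<comment> \<open>On the model the transition function from a chart to itself is the identity, so
    \<open>vfst\<close> alone extends the projection.\<close>
  have "chart_germ (tangent_bundle N) N i i foot (foot q) (vfst -` V) vfst"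
    using lift_smoothD(1)[OF chart_germD(1)[OF g]]
    by (intro chart_germ_extension_cong[OF chart_germ_foot[OF N i(1) fq g]] lift_smooth_linear
        bounded_linear_vfst open_vimage_vfst eq) auto
  from chart_differential_eq[OF TN _ this comps_in_model[OF q, of i]] i fq
  have d: "chart_differential (tangent_bundle N) N i i foot (foot q) (comps q i) = vfst (comps q i)"
    by (simp add: frechet_derivative_eq[OF bounded_linear_imp_has_derivative[OF bounded_linear_vfst]])
  obtain p \<xi> \<eta> where q_eq: "q = Tan (Tan p \<xi>) \<eta>" using q by (rule tangent_carrier2E)
  show ?thesis
  proof (rule tangent_map_eqI[OF TN N smooth_between_foot[OF N] q, of _ i i])
    show "foot (flip q) \<in> tangent_carrier N"
      using foot_in_carrier[OF flip_in_tangent_carrier[OF N q]] by simp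
    show "comps (foot (flip q)) i = chart_differential (tangent_bundle N) N i i foot (foot q) (comps q i)"
      unfolding d by (simp add: q_eq)
  qed (use i fq q_eq in auto)
qed

section \<open>Complete lifts of vector fields on a tangent bundle\<close>

text \<open>The complete lift of a field on TN, where every index of \<open>kappa\<close> is at
  least 2 and so every involution is \<open>flip\<close>. It acts on TTN at the right end and under
  D, and on TTTN in the middle.\<close>

definition vector_field_lift ::
    "('m, 'i, 'e::real_normed_vector) tmanifold \<Rightarrow> (('m, 'i, 'e seqs) tpoint \<Rightarrow> ('m, 'i, 'e seqs) tpoint)
       \<Rightarrow> ('m, 'i, 'e seqs) tpoint \<Rightarrow> ('m, 'i, 'e seqs) tpoint" where
  "vector_field_lift N A =
     tangent_map (tangent_bundle (tangent_bundle N)) (tangent_bundle (tangent_bundle N)) flip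
       \<circ> flip \<circ> tangent_map (tangent_bundle N) (tangent_bundle (tangent_bundle N)) A \<circ> flip"

context
  fixes N :: "('m, 'i, 'e::real_normed_vector) tmanifold" and A
  assumes N: "regular_atlas N"
    and A: "smooth_between (tangent_bundle N) (tangent_bundle (tangent_bundle N)) A"
    and foot_A: "\<And>q. q \<in> tangent_carrier N \<Longrightarrow> foot (A q) = q"
begin

abbreviation (input) "T1 \<equiv> tangent_bundle N"
abbreviation (input) "T2 \<equiv> tangent_bundle T1"
abbreviation (input) "T3 \<equiv> tangent_bundle T2"

lemma T1: "regular_atlas T1" and T2: "regular_atlas T2" and T3: "regular_atlas T3"
  by (intro regular_atlas_tangent_bundle N)+

lemma smooth_between_vector_field_lift: "smooth_between T2 T3 (vector_field_lift N A)"
proof -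
  have "smooth_between T2 T3 (tangent_map T1 T2 A \<circ> flip)"
    by (rule smooth_between_compose[OF T2 T2 smooth_between_flip[OF N] smooth_between_tangent_map[OF T1 T2 A]])
  from smooth_between_compose[OF T2 T3 this smooth_between_flip[OF T1]]
  have "smooth_between T2 T3 (flip \<circ> (tangent_map T1 T2 A \<circ> flip))" .
  from smooth_between_compose[OF T2 T3 this smooth_between_tangent_map[OF T2 T2 smooth_between_flip[OF N]]]
  show ?thesis by (simp add: vector_field_lift_def o_assoc)
qed

text \<open>The projection passes through D of the involution; with the middle involution it becomes
  D of a projection, which cancels DA because \<open>A\<close> is a section. The two remaining
  involutions cancel.\<close>

lemma foot_vector_field_lift:
  assumes q: "q \<in> tangent_carrier T1"
  shows "foot (vector_field_lift N A q) = q"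
proof -
  note q' = flip_in_tangent_carrier[OF N q]
  note DA = tangent_map_mem[OF T1 T2 A q']
  have "foot (vector_field_lift N A q) = flip (foot (flip (tangent_map T1 T2 A (flip q))))"
    by (simp add: vector_field_lift_def)
  also have "foot (flip (tangent_map T1 T2 A (flip q))) = tangent_map T2 T1 foot (tangent_map T1 T2 A (flip q))"
    by (rule tangent_map_foot[OF T1 DA, symmetric])
  also have "\<dots> = tangent_map T1 T1 (foot \<circ> A) (flip q)"
    by (rule tangent_map_compose[OF T1 T2 T1 A smooth_between_foot[OF T1] q', symmetric])
  also have "\<dots> = tangent_map T1 T1 id (flip q)"
    by (rule tangent_map_cong[OF T1 T1 smooth_between_compose[OF T1 T2 A smooth_between_foot[OF T1]] _ q'])
       (simp add: foot_A)
  also have "\<dots> = flip q" by (rule tangent_map_id[OF T1 q'])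
  finally show ?thesis using flip_flip[OF q] by simp
qed

lemma tangent_map2_foot_vector_field_lift:
  assumes q: "q \<in> tangent_carrier T1"
  shows "tangent_map2 T1 N foot (vector_field_lift N A q) = A (tangent_map T1 N foot q)"
proof -
  note q' = flip_in_tangent_carrier[OF N q]
  note DA = tangent_map_mem[OF T1 T2 A q']
  note w = flip_in_tangent_carrier[OF T1 DA]
  note D\<pi> = smooth_between_tangent_map[OF T1 N smooth_between_foot[OF N]]
  let ?w = "flip (tangent_map T1 T2 A (flip q))"
  have "tangent_map2 T1 N foot (vector_field_lift N A q)
      = tangent_map T2 T1 (tangent_map T1 N foot) (tangent_map T2 T2 flip ?w)"
    by (simp add: tangent_map2_def vector_field_lift_def)
  also have "\<dots> = tangent_map T2 T1 (tangent_map T1 N foot \<circ> flip) ?w"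
    by (rule tangent_map_compose[OF T2 T2 T1 smooth_between_flip[OF N] D\<pi> w, symmetric])
  \<comment> \<open>The relation between involution and projection is used at two levels: here over
    \<open>N\<close> and under D, in the next step over \<open>T1\<close>.\<close>
  also have "\<dots> = tangent_map T2 T1 foot ?w"
    by (rule tangent_map_cong[OF T2 T1 smooth_between_compose[OF T2 T2 smooth_between_flip[OF N] D\<pi>] _ w])
       (simp add: tangent_map_foot[OF N flip_in_tangent_carrier[OF N]] flip_flip[of _ N])
  also have "\<dots> = foot (flip ?w)" by (rule tangent_map_foot[OF T1 w])
  also have "flip ?w = tangent_map T1 T2 A (flip q)" by (rule flip_flip[OF DA])
  also have "foot \<dots> = A (foot (flip q))" by simp
  also have "foot (flip q) = tangent_map T1 N foot q" by (rule tangent_map_foot[OF N q, symmetric])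
  finally show ?thesis .
qed

end

text \<open>Stage \<open>j + 1\<close> uses \<open>kappa (j + 2)\<close> and
  \<open>kappa (j + 3)\<close>, both equal to \<open>flip\<close>.\<close>

lemma iter_lift_Suc_eq: "iter_lift M X (Suc j) = vector_field_lift (iter_tangent M j) (iter_lift M X j)"
  by (simp add: complete_lift_def kappa_def vector_field_lift_def)

section \<open>The given manifold and vector field\<close>

text \<open>The retraction \<open>P\<close> extends a local representative from a relatively open
  set of the model to its open preimage under \<open>P\<close>, with no change on the model.\<close>

lemma smooth_map_imp_smooth_between:
  assumes N: "regular_atlas N" and f: "smooth_map N N' f"
    and P: "bounded_linear P" "range P = model N" "\<And>v. v \<in> model N \<Longrightarrow> P v = v"
  shows "smooth_between N N' f"
  unfolding smooth_between_def
proof (intro conjI ballI impI)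
  show "f ` carrier N \<subseteq> carrier N'" using f by (simp add: smooth_map_def)
  fix i j p assume *: "i \<in> index N" "j \<in> index N'" "p \<in> chart_dom N i" "f p \<in> chart_dom N' j"
  let ?U = "local_rep_dom N N' i j f"
  have U: "openin (top_of_set (model N)) ?U" "smooth_within (model N) ?U (local_rep N N' i j f)"
    using f * by (auto simp: smooth_map_def)
  have "chart_germ N N' i j f p (P -` ?U) (\<lambda>z. local_rep N N' i j f (P z))"
    unfolding chart_germ_def
  proof (intro conjI ballI)
    show "lift_smooth (P -` ?U) (\<lambda>z. local_rep N N' i j f (P z))"
      using smooth_within_imp_lift_smooth[OF U(2) regular_atlasD(1)[OF N] U(1) bounded_linear_ident P(1)] P(2) by simp
    show "p \<in> chart_dom N i" by fact
    show "chart N i p \<in> P -` ?U"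
      using * P(3)[OF regular_atlasD(6)[OF N *(1,3)]] by (auto simp: local_rep_dom_def)
    fix v assume v: "v \<in> P -` ?U \<inter> model N"
    then have "P v = v" using P(3) by blast
    with v obtain q where q: "q \<in> chart_dom N i" "chart N i q = v" "f q \<in> chart_dom N' j"
      by (auto simp: local_rep_dom_def)
    moreover have "inv_into (chart_dom N i) (chart N i) v = q"
      using q regular_atlasD(7)[OF N *(1)] by (metis inv_into_into f_inv_into_f image_eqI)
    ultimately show "\<exists>q\<in>chart_dom N i. chart N i q = v \<and> f q \<in> chart_dom N' j \<and> chart N' j (f q) = local_rep N N' i j f (P v)"
      using \<open>P v = v\<close> by (auto simp: local_rep_def)
  qed
  then show "\<exists>V g. chart_germ N N' i j f p V g" by blast
qed

lemma vembed_eval: "v \<in> range vembed \<Longrightarrow> vembed (v 0) = v"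
  by (auto simp: apply_vembed)

text \<open>Evaluation at index 0 is a left inverse of \<open>vembed\<close>; a transition function
  preceded by this evaluation and followed by \<open>vembed\<close> is the required
  extension.\<close>

lemma regular_atlas_base_manifold:
  fixes M :: "('m, 'i, 'e::banach) manifold"
  assumes M: "banach_manifold M"
  shows "regular_atlas (base_manifold M)"
  unfolding regular_atlas_def
proof (intro conjI ballI)
  have S: "smooth_atlas M" and model: "model M = UNIV" using M by (auto simp: banach_manifold_def)
  have [simp]: "index (base_manifold M) = index M" "carrier (base_manifold M) = Base ` carrier M"
    "chart_dom (base_manifold M) i = Base ` chart_dom M i"
    "chart (base_manifold M) i (Base x) = vembed (chart M i x)" "model (base_manifold M) = range vembed" for i x
    by (auto simp: base_manifold_def model)
  have inj: "inj_on (chart M i) (chart_dom M i)" if "i \<in> index M" for i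
    using S that by (auto simp: smooth_atlas_def)
  have vembed_eq: "vembed x = vembed y \<longleftrightarrow> x = y" for x y :: 'e
    by (metis apply_vembed)
  show "subspace (model (base_manifold M))"
    using linear_subspace_image[OF bounded_linear.linear[OF bounded_linear_vembed] subspace_UNIV] by simp
  \<comment> \<open>The model becomes the fixed-point set of a continuous map, hence closed.\<close>
  have "range (vembed :: 'e \<Rightarrow> _) = {v :: 'e seqs. vembed (apply_bcontfun v 0) = v}"
  proof (intro equalityI subsetI)
    show "v \<in> {v. vembed (apply_bcontfun v 0) = v}" if "v \<in> range vembed" for v :: "'e seqs"
      by (rule CollectI) (rule vembed_eval[OF that])
    show "v \<in> range vembed" if "v \<in> {v. vembed (apply_bcontfun v 0) = v}" for v :: "'e seqs"
      by (rule range_eqI[of _ vembed "apply_bcontfun v 0"]) (rule sym, rule CollectD, rule that)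
  qed
  moreover have "closed {v :: 'e seqs. vembed (apply_bcontfun v 0) = v}"
    by (intro closed_Collect_eq continuous_on_id
        linear_continuous_on[OF bounded_linear_compose[OF bounded_linear_vembed bounded_linear_eval]])
  ultimately show "closed (model (base_manifold M))" by simp
  show "(\<Union>i\<in>index (base_manifold M). chart_dom (base_manifold M) i) = carrier (base_manifold M)"
    using S by (simp add: smooth_atlas_def image_UN[symmetric])
  show "inj_on (chart (base_manifold M) i) (chart_dom (base_manifold M) i)" if "i \<in> index (base_manifold M)" for i
    using inj[of i] that by (auto simp: inj_on_def vembed_eq)
  show "chart (base_manifold M) i ` chart_dom (base_manifold M) i \<subseteq> model (base_manifold M)" for i
    by auto
  show "smooth_between (base_manifold M) (base_manifold M) id"
    unfolding smooth_between_def
  proof (intro conjI ballI impI)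
    fix i j p assume *: "i \<in> index (base_manifold M)" "j \<in> index (base_manifold M)"
      "p \<in> chart_dom (base_manifold M) i" "id p \<in> chart_dom (base_manifold M) j"
    then obtain x where x: "p = Base x" "x \<in> chart_dom M i" "x \<in> chart_dom M j" by auto
    let ?U = "local_rep_dom M M i j id" and ?f = "local_rep M M i j id"
    have U: "openin (top_of_set UNIV) ?U" "smooth_within UNIV ?U ?f"
      using S * unfolding smooth_atlas_def model by auto
    have "chart_germ (base_manifold M) (base_manifold M) i j id p ((\<lambda>v :: 'e seqs. v 0) -` ?U) (\<lambda>v :: 'e seqs. vembed (?f (v 0)))"
      unfolding chart_germ_def
    proof (intro conjI ballI)
      show "lift_smooth ((\<lambda>v :: 'e seqs. v 0) -` ?U) (\<lambda>v :: 'e seqs. vembed (?f (v 0)))"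
        using smooth_within_imp_lift_smooth[OF U(2) subspace_UNIV U(1) bounded_linear_vembed bounded_linear_eval] by simp
      show "p \<in> chart_dom (base_manifold M) i" by fact
      show "chart (base_manifold M) i p \<in> (\<lambda>v :: 'e seqs. v 0) -` ?U" using x by (auto simp: apply_vembed local_rep_dom_def)
      fix v assume "v \<in> (\<lambda>v :: 'e seqs. v 0) -` ?U \<inter> model (base_manifold M)"
      then obtain y where y: "y \<in> chart_dom M i" "y \<in> chart_dom M j" "v = vembed (chart M i y)"
        by (auto simp: apply_vembed local_rep_dom_def)
      moreover have "?f (chart M i y) = chart M j y" using y inj[of i] * by (simp add: local_rep_def)
      ultimately show "\<exists>q\<in>chart_dom (base_manifold M) i. chart (base_manifold M) i q = v \<and>
          id q \<in> chart_dom (base_manifold M) j \<and> chart (base_manifold M) j (id q) = vembed (?f (v 0))"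
        by (auto simp: apply_vembed)
    qed
    then show "\<exists>V g. chart_germ (base_manifold M) (base_manifold M) i j id p V g" by blast
  qed auto
qed

lemma regular_atlas_iter_tangent: "banach_manifold M \<Longrightarrow> regular_atlas (iter_tangent M r)"
  by (induction r) (simp_all add: regular_atlas_base_manifold regular_atlas_tangent_bundle)

lemma vector_field_smooth_between:
  fixes M :: "('m, 'i, 'e::banach) manifold"
  assumes M: "banach_manifold M" and X: "X \<in> vector_fields (iter_tangent M 1)"
  shows "smooth_between (iter_tangent M 1) (iter_tangent M 2) X"
proof (rule smooth_map_imp_smooth_between[OF regular_atlas_iter_tangent[OF M]])
  have model: "v \<in> model (iter_tangent M 1) \<longleftrightarrow> vfst v \<in> range vembed \<and> vsnd v \<in> range vembed" for v
    using M by (simp add: base_manifold_def banach_manifold_def)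
  \<comment> \<open>TM is modelled on sequences supported at the indices 0 and 1; the retraction
    keeps these two entries.\<close>
  let ?P = "\<lambda>v :: 'e seqs. vpair (vembed (v 0)) (vembed (v 1))"
  show "smooth_map (iter_tangent M 1) (iter_tangent M 2) X"
    using X by (simp add: vector_fields_def numeral_2_eq_2)
  show "bounded_linear ?P"
    by (intro bounded_linear_vpair bounded_linear_compose[OF bounded_linear_vembed] bounded_linear_eval)
  show P: "?P v = v" if "v \<in> model (iter_tangent M 1)" for v
  proof -
    have "vembed (vfst v 0) = vfst v" "vembed (vsnd v 0) = vsnd v"
      using that vembed_eval unfolding model by blast+
    then show ?thesis by (metis apply_vfst apply_vsnd vpair_vfst_vsnd mult_zero_right add_0)
  qed
  show "range ?P = model (iter_tangent M 1)"
  proof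
    show "range ?P \<subseteq> model (iter_tangent M 1)" unfolding subset_iff model by auto
    show "model (iter_tangent M 1) \<subseteq> range ?P"
    proof
      fix v assume v: "v \<in> model (iter_tangent M 1)"
      show "v \<in> range ?P" by (rule image_eqI[where x = v and f = ?P, OF P[OF v, symmetric] UNIV_I])
    qed
  qed
qed

text \<open>The section property at one stage needs both smoothness and the section property at the
  stage before, so the two go through the induction together.\<close>

lemma iter_lift_vector_field:
  assumes M: "banach_manifold M" and X: "X \<in> vector_fields (iter_tangent M 1)"
  shows "smooth_between (iter_tangent M (j + 1)) (iter_tangent M (j + 2)) (iter_lift M X j) \<and>
    (\<forall>q \<in> carrier (iter_tangent M (j + 1)). foot (iter_lift M X j q) = q)"
proof (induction j)
  case 0
  then show ?case using vector_field_smooth_between[OF M X] X by (simp add: vector_fields_def numeral_2_eq_2)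
next
  case (Suc j)
  then show ?case
    using smooth_between_vector_field_lift[OF regular_atlas_iter_tangent[OF M], of j "iter_lift M X j"]
      foot_vector_field_lift[OF regular_atlas_iter_tangent[OF M], of j "iter_lift M X j"]
    unfolding iter_lift_Suc_eq by (simp add: numeral_2_eq_2)
qed

lemma tangent_map2_foot_iter_lift:
  assumes M: "banach_manifold M" and X: "X \<in> vector_fields (iter_tangent M 1)"
    and p: "p \<in> carrier (iter_tangent M (i + 2))"
  shows "tangent_map2 (iter_tangent M (i + 1)) (iter_tangent M i) foot (iter_lift M X (i + 1) p)
    = iter_lift M X i (tangent_map (iter_tangent M (i + 1)) (iter_tangent M i) foot p)"
  using tangent_map2_foot_vector_field_lift[OF regular_atlas_iter_tangent[OF M], of i "iter_lift M X i" p]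
    iter_lift_vector_field[OF M X, of i] p
  by (simp add: numeral_2_eq_2 iter_lift_Suc_eq del: iter_lift.simps)

section \<open>Composite projections\<close>

text \<open>D is applied to the rule for D of a composite. That rule holds on a carrier only, so
  congruence on carriers precedes functoriality one level up.\<close>

lemma tangent_map2_compose:
  assumes N: "regular_atlas N" and N': "regular_atlas N'" and N'': "regular_atlas N''"
    and f: "smooth_between N N' f" and h: "smooth_between N' N'' h"
    and q: "q \<in> tangent_carrier (tangent_bundle N)"
  shows "tangent_map2 N N'' (h \<circ> f) q = tangent_map2 N' N'' h (tangent_map2 N N' f q)"
proof -
  note T = regular_atlas_tangent_bundle
  have "tangent_map2 N N'' (h \<circ> f) q
      = tangent_map (tangent_bundle N) (tangent_bundle N'') (tangent_map N' N'' h \<circ> tangent_map N N' f) q"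
    unfolding tangent_map2_def
    by (rule tangent_map_cong[OF T[OF N] T[OF N''] smooth_between_tangent_map[OF N N'' smooth_between_compose[OF N N' f h]] _ q])
       (simp add: tangent_map_compose[OF N N' N'' f h])
  also have "\<dots> = tangent_map2 N' N'' h (tangent_map2 N N' f q)"
    unfolding tangent_map2_def
    by (rule tangent_map_compose[OF T[OF N] T[OF N'] T[OF N''] smooth_between_tangent_map[OF N N' f]
          smooth_between_tangent_map[OF N' N'' h] q])
  finally show ?thesis .
qed

lemma smooth_between_funpow_foot:
  assumes M: "banach_manifold M"
  shows "smooth_between (iter_tangent M (k + i)) (iter_tangent M i) (foot ^^ k)"
proof (induction k)
  case 0
  show ?case
    unfolding funpow.simps(1) add_0 by (rule regular_atlasD(3)[OF regular_atlas_iter_tangent[OF M]])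
next
  case (Suc k)
  note R = regular_atlas_iter_tangent[OF M]
  have "smooth_between (iter_tangent M (Suc k + i)) (iter_tangent M (k + i)) foot"
    using smooth_between_foot[OF R] by simp
  from smooth_between_compose[OF R R this Suc] show ?case unfolding funpow_Suc_right .
qed

text \<open>The composite is peeled off at its topmost projection, which lowers the index of the
  lift by one; the induction hypothesis then applies at the image of \<open>p\<close> under the
  tangent map of that projection. Writing the upper index as \<open>k + i\<close> avoids
  subtraction.\<close>

lemma tangent_map2_funpow_foot_iter_lift:
  fixes M :: "('m, 'i, 'e::banach) manifold"
  assumes M: "banach_manifold M" and X: "X \<in> vector_fields (iter_tangent M 1)"
    and p: "p \<in> carrier (iter_tangent M (k + i + 1))"
  shows "tangent_map2 (iter_tangent M (k + i)) (iter_tangent M i) (foot ^^ k) (iter_lift M X (k + i) p)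
    = iter_lift M X i (tangent_map (iter_tangent M (k + i)) (iter_tangent M i) (foot ^^ k) p)"
  using p
proof (induction k arbitrary: p)
  case 0
  note R = regular_atlas_iter_tangent[OF M]
  let ?N = "iter_tangent M i"
  have p: "p \<in> tangent_carrier ?N" using 0 by simp
  then have "iter_lift M X i p \<in> tangent_carrier (tangent_bundle ?N)"
    using smooth_betweenD(1)[of "iter_tangent M (i + 1)" "iter_tangent M (i + 2)" "iter_lift M X i" p]
      iter_lift_vector_field[OF M X, of i] by (simp add: numeral_2_eq_2)
  \<comment> \<open>The second tangent map of the identity fixes the points of the carrier, whence
    the membership established just before.\<close>
  then have "tangent_map2 ?N ?N id (iter_lift M X i p) = iter_lift M X i p"
    unfolding tangent_map2_def
    using tangent_map_cong[OF R[of "Suc i"] R[of "Suc i"], of "tangent_map ?N ?N id" id] tangent_map_id[OF R]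
      smooth_between_tangent_map[OF R R regular_atlasD(3)[OF R[of i]]] tangent_map_id[OF R[of "Suc i"]]
    by simp
  then show ?case unfolding funpow.simps(1) add_0 tangent_map_id[OF R p] .
next
  case (Suc k)
  note R = regular_atlas_iter_tangent[OF M]
  let ?L = "iter_tangent M (Suc k + i)" and ?N = "iter_tangent M (k + i)" and ?N' = "iter_tangent M i"
  let ?\<pi> = "foot :: ('m, 'i, 'e seqs) tpoint \<Rightarrow> _" and ?f = "foot ^^ k :: ('m, 'i, 'e seqs) tpoint \<Rightarrow> _"
  have \<pi>: "smooth_between ?L ?N ?\<pi>" using smooth_between_foot[OF R] by simp
  note f = smooth_between_funpow_foot[OF M, of k i]
  have p: "p \<in> tangent_carrier ?L" using Suc.prems by simp
  have q: "iter_lift M X (Suc k + i) p \<in> tangent_carrier (tangent_bundle ?L)"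
    using p smooth_betweenD(1)[of "iter_tangent M (Suc k + i + 1)" "iter_tangent M (Suc k + i + 2)" "iter_lift M X (Suc k + i)" p]
      iter_lift_vector_field[OF M X, of "Suc k + i"] by (simp add: numeral_2_eq_2 del: iter_lift.simps)
  have "tangent_map2 ?L ?N' (foot ^^ Suc k) (iter_lift M X (Suc k + i) p)
      = tangent_map2 ?N ?N' ?f (tangent_map2 ?L ?N foot (iter_lift M X (Suc k + i) p))"
    unfolding funpow_Suc_right by (rule tangent_map2_compose[OF R R R \<pi> f q])
  also have "tangent_map2 ?L ?N foot (iter_lift M X (Suc k + i) p) = iter_lift M X (k + i) (tangent_map ?L ?N foot p)"
    using tangent_map2_foot_iter_lift[OF M X, of p "k + i"] p by (simp del: iter_lift.simps)
  also have "tangent_map2 ?N ?N' ?f \<dots> = iter_lift M X i (tangent_map ?N ?N' ?f (tangent_map ?L ?N foot p))"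
    by (rule Suc.IH) (use tangent_map_mem[OF R R \<pi> p] in simp)
  also have "tangent_map ?N ?N' ?f (tangent_map ?L ?N foot p) = tangent_map ?L ?N' (foot ^^ Suc k) p"
    unfolding funpow_Suc_right by (rule tangent_map_compose[OF R R R \<pi> f p, symmetric])
  finally show ?case .
qed

theorem proposition3p4:
  fixes M :: "('m, 'i, 'e::banach) manifold"
    and X :: "('m, 'i, 'e seqs) tpoint \<Rightarrow> ('m, 'i, 'e seqs) tpoint"
  assumes "banach_manifold M"
    and "partitionable M"
    and "X \<in> vector_fields (iter_tangent M 1)"
  shows "(\<forall>p \<in> carrier (iter_tangent M 2).
            (tangent_map2 (iter_tangent M 1) (iter_tangent M 0) foot \<circ> iter_lift M X 1) p
              = (X \<circ> tangent_map (iter_tangent M 1) (iter_tangent M 0) foot) p)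
       \<and> (\<forall>i. \<forall>p \<in> carrier (iter_tangent M (i + 2)).
            (tangent_map2 (iter_tangent M (i + 1)) (iter_tangent M i) foot \<circ> iter_lift M X (i + 1)) p
              = (iter_lift M X i \<circ> tangent_map (iter_tangent M (i + 1)) (iter_tangent M i) foot) p)
       \<and> (\<forall>i j. i \<le> j \<longrightarrow> (\<forall>p \<in> carrier (iter_tangent M (j + 1)).
            (tangent_map2 (iter_tangent M j) (iter_tangent M i) (iter_proj j i) \<circ> iter_lift M X j) p
              = (iter_lift M X i \<circ> tangent_map (iter_tangent M j) (iter_tangent M i) (iter_proj j i)) p))"
proof (intro conjI allI impI ballI)
  note ii = tangent_map2_foot_iter_lift[OF assms(1,3)]
  show "(tangent_map2 (iter_tangent M 1) (iter_tangent M 0) foot \<circ> iter_lift M X 1) p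
      = (X \<circ> tangent_map (iter_tangent M 1) (iter_tangent M 0) foot) p"
    if "p \<in> carrier (iter_tangent M 2)" for p
    using ii[of p 0] that unfolding comp_apply add_0 iter_lift.simps(1) .
  show "(tangent_map2 (iter_tangent M (i + 1)) (iter_tangent M i) foot \<circ> iter_lift M X (i + 1)) p
      = (iter_lift M X i \<circ> tangent_map (iter_tangent M (i + 1)) (iter_tangent M i) foot) p"
    if "p \<in> carrier (iter_tangent M (i + 2))" for i p
    unfolding comp_apply by (rule ii[OF that])
  show "(tangent_map2 (iter_tangent M j) (iter_tangent M i) (iter_proj j i) \<circ> iter_lift M X j) p
      = (iter_lift M X i \<circ> tangent_map (iter_tangent M j) (iter_tangent M i) (iter_proj j i)) p"
    if ij: "i \<le> j" and p: "p \<in> carrier (iter_tangent M (j + 1))" for i j p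
  proof -
    \<comment> \<open>The exponent in \<open>iter_proj\<close> is the truncated difference
      \<open>j - i\<close>, from which \<open>i \<le> j\<close> recovers \<open>j\<close>.\<close>
    have "j = (j - i) + i" using ij by simp
    then show ?thesis
      using tangent_map2_funpow_foot_iter_lift[OF assms(1,3), of p "j - i" i] p
      unfolding comp_apply iter_proj_def by metis
  qed
qed

end
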